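(* Let $\Omega\subset\mathbf{R}^d$ be open with boundary $\Gamma$, and let $\sigma$ be the $(d-1)$-dimensional Hausdorff measure on $\Gamma$, assumed to satisfy $\sigma(K)<\infty$ for every compact $K\subset\Gamma$. For all $i,j\in\{1,\ldots,d\}$ let $a_{ij}\in L_\infty(\Omega)$ (complex valued), let $\theta\in[0,\frac\pi2)$ and suppose $\sum_{i,j=1}^d a_{ij}(x)\,\xi_i\,\overline{\xi_j}\in\Sigma_\theta$ for all $\xi\in\mathbf{C}^d$ and a.e. $x\in\Omega$. Let $b_N$ be the form with $D(b_N)=H^1(\Omega)$ and $b_N(u,v)=\sum_{i,j=1}^d\int_\Omega(\partial_iu)\,a_{ij}\,\overline{\partial_jv}$, and assume $b_N$ is closable. Let $H^1_{b,\sigma}(\Omega)$, $\widetilde\Gamma$ and $\operatorname{Tr}\colon H^1_{b,\sigma}(\Omega)\to L_2(\widetilde\Gamma)$ be as defined in the context, and assume that $\operatorname{Tr}\colon(H^1_{b,\sigma}(\Omega),\|\cdot\|_{\overline{b_N}})\to L_2(\widetilde\Gamma)$ is continuous. Let $\alpha\in L_\infty(\widetilde\Gamma)$ and let $B$ be a bounded linear operator on $L_2(\widetilde\Gamma)$, and assume that there is an $\omega>0$ such that $$\omega\,\|B\varphi\|_{L_2(\widetilde\Gamma)}^2+\int_{\widetilde\Gamma}(\operatorname{Re}\alpha)\,|\varphi|^2\,d\sigma\ge0\qquad\text{for all }\varphi\in L_2(\widetilde\Gamma).$$ Define the form $a$ by $D(a)=H^1_{b,\sigma}(\Omega)$ and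 $a(u,v)=\overline{b_N}(u,v)+\int_{\widetilde\Gamma}\operatorname{Tr}u\,\overline{\operatorname{Tr}v}\,\alpha\,d\sigma$. Let $H$ be the closure of $\{(u,B(\operatorname{Tr}u)):u\in H^1_{b,\sigma}(\Omega)\}$ in $L_2(\Omega)\oplus L_2(\widetilde\Gamma)$, with the induced norm, define $j\colon H^1_{b,\sigma}(\Omega)\to H$ by $j(u)=(u,B(\operatorname{Tr}u))$, and let $A$ be the operator associated with $(a,j)$. Let $x,y\in H$. Then $x\in D(A)$ and $Ax=y$ if and only if there exist $u\in H^1_{b,\sigma}(\Omega)$ and $\psi\in L_2(\widetilde\Gamma)$ such that $x=(u,B(\operatorname{Tr}u))$, $\mathcal{A}u\in L_2(\Omega)$ weakly on $\Omega$, $B^*\psi-\alpha\operatorname{Tr}u$ is the $(a_{ij})$-normal derivative of $u$, and $y=(\mathcal{A}u,\psi)$.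
   Context: $\Sigma_\theta=\{re^{i\alpha}:r\ge0,\ |\alpha|\le\theta\}$. $L_p$-spaces on subsets of $\Gamma$ are with respect to $\sigma$; functions on $\widetilde\Gamma\subset\Gamma$ are extended by $0$ to $\Gamma$. Let $D(b)=\{u\in H^1(\Omega)\cap C(\overline\Omega):\int_\Gamma|u|^2\,d\sigma<\infty\}$ and $b(u,v)=b_N(u,v)+\int_\Gamma u\,\overline v\,d\sigma$ for $u,v\in D(b)$. The closure $\overline{b_N}$ has domain $D(\overline{b_N})\subset L_2(\Omega)$ and norm $\|u\|_{\overline{b_N}}=(\operatorname{Re}\overline{b_N}(u,u)+\|u\|_2^2)^{1/2}$. For $u\in D(\overline{b_N})$ and $\varphi\in L_2(\Gamma)$, $\varphi$ is a trace of $u$ if there exist $u_1,u_2,\ldots\in D(b)$ with $u_n\to u$ in $D(\overline{b_N})$ and $u_n|_\Gamma\to\varphi$ in $L_2(\Gamma)$. $H^1_{b,\sigma}(\Omega)$ is the set of all $u\in D(\overline{b_N})$ having a trace. There is a Borel set $\widetilde\Gamma\subset\Gamma$ (also written $\Gamma_{b,\sigma}$), unique up to $\sigma$-null sets, such that the set of traces of $0$ is exactly $L_2(\Gamma\setminus\widetilde\Gamma)$; for $u\in H^1_{b,\sigma}(\Omega)$, $\operatorname{Tr}u$ is the unique element of $L_2(\widetilde\Gamma)$ that is a trace of $u$. $H^1_{b,\sigma}(\Omega)$ is a Hilbert space for the norm $(\|u\|_{\overline{b_N}}^2+\|\operatorname{Tr}u\|_{L_2(\widetilde\Gamma)}^2)^{1/2}$.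 For $u\in D(\overline{b_N})$: $\mathcal{A}u\in L_2(\Omega)$ weakly on $\Omega$ means there is a (necessarily unique) $f\in L_2(\Omega)$, denoted $\mathcal{A}u$, with $\overline{b_N}(u,v)=\int_\Omega f\,\overline v$ for all $v\in C_c^\infty(\Omega)$. In that case $\varphi\in L_2(\Gamma)$ is the $(a_{ij})$-normal derivative of $u$ if $\overline{b_N}(u,v)-\int_\Omega(\mathcal{A}u)\,\overline v=\int_\Gamma\varphi\,\overline v\,d\sigma$ for all $v\in D(b)$. Under the stated assumptions $a$ is continuous and $j$-elliptic (i.e. $\operatorname{Re}a(u,u)+\omega'\|j(u)\|_H^2\ge\mu'\|u\|^2$ for some $\omega'\in\mathbf{R}$, $\mu'>0$), $j$ is bounded with dense range, and the operator $A$ associated with $(a,j)$ is the well-defined $m$-sectorial operator in $H$ such that $x\in D(A)$ and $Ax=y$ if and only if there is a $u\in H^1_{b,\sigma}(\Omega)$ with $j(u)=x$ and $a(u,v)=(y,j(v))_H$ for all $v\in H^1_{b,\sigma}(\Omega)$. *)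

theory Defs
  imports "HOL-Analysis.Analysis"
begin

definition sector :: "real \<Rightarrow> complex set" where
  "sector \<theta> = {complex_of_real r * cis \<alpha> | r \<alpha>. 0 \<le> r \<and> \<bar>\<alpha>\<bar> \<le> \<theta>}"

(* Elements of L_2(M) and L_infinity(M) are represented by functions; equality in the space is
   equality almost everywhere. Accordingly, operators act on representatives, and equations
   between elements are stated with "AE". *)

definition L2 :: "'a measure \<Rightarrow> ('a \<Rightarrow> complex) set" where
  "L2 M = {f \<in> borel_measurable M. integrable M (\<lambda>x. (cmod (f x))\<^sup>2)}"

definition L2_norm :: "'a measure \<Rightarrow> ('a \<Rightarrow> complex) \<Rightarrow> real" where
  "L2_norm M f = sqrt (\<integral>x. (cmod (f x))\<^sup>2 \<partial>M)"

definition L2_inner :: "'a measure \<Rightarrow> ('a \<Rightarrow> complex) \<Rightarrow> ('a \<Rightarrow> complex) \<Rightarrow> complex" where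
  "L2_inner M f g = (\<integral>x. f x * cnj (g x) \<partial>M)"

definition Linf :: "'a measure \<Rightarrow> ('a \<Rightarrow> complex) set" where
  "Linf M = {f \<in> borel_measurable M. \<exists>C. AE x in M. cmod (f x) \<le> C}"

(* Linearity is modulo null sets; together with the bound it implies that B respects equality
   almost everywhere. *)
definition bounded_operator_L2 ::
  "'a measure \<Rightarrow> (('a \<Rightarrow> complex) \<Rightarrow> ('a \<Rightarrow> complex)) \<Rightarrow> bool" where
  "bounded_operator_L2 M B \<longleftrightarrow>
     (\<forall>\<phi>\<in>L2 M. B \<phi> \<in> L2 M) \<and>
     (\<forall>\<phi>\<in>L2 M. \<forall>\<psi>\<in>L2 M. AE x in M. B (\<lambda>x. \<phi> x + \<psi> x) x = B \<phi> x + B \<psi> x) \<and>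
     (\<forall>c. \<forall>\<phi>\<in>L2 M. AE x in M. B (\<lambda>x. c * \<phi> x) x = c * B \<phi> x) \<and>
     (\<exists>C. \<forall>\<phi>\<in>L2 M. L2_norm M (B \<phi>) \<le> C * L2_norm M \<phi>)"

definition L2_adjoint ::
  "'a measure \<Rightarrow> (('a \<Rightarrow> complex) \<Rightarrow> ('a \<Rightarrow> complex)) \<Rightarrow> ('a \<Rightarrow> complex) \<Rightarrow> ('a \<Rightarrow> complex)" where
  "L2_adjoint M B \<psi> =
     (SOME \<eta>. \<eta> \<in> L2 M \<and> (\<forall>\<phi>\<in>L2 M. L2_inner M (B \<phi>) \<psi> = L2_inner M \<phi> \<eta>))"

(* The direct sum of L_2(M) and L_2(N). *)

definition sum_inner ::
  "'a measure \<Rightarrow> 'b measure \<Rightarrow> ('a \<Rightarrow> complex) \<times> ('b \<Rightarrow> complex) \<Rightarrow>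
     ('a \<Rightarrow> complex) \<times> ('b \<Rightarrow> complex) \<Rightarrow> complex" where
  "sum_inner M N p q = L2_inner M (fst p) (fst q) + L2_inner N (snd p) (snd q)"

definition sum_eq ::
  "'a measure \<Rightarrow> 'b measure \<Rightarrow> ('a \<Rightarrow> complex) \<times> ('b \<Rightarrow> complex) \<Rightarrow>
     ('a \<Rightarrow> complex) \<times> ('b \<Rightarrow> complex) \<Rightarrow> bool" where
  "sum_eq M N p q \<longleftrightarrow> (AE x in M. fst p x = fst q x) \<and> (AE x in N. snd p x = snd q x)"

definition sum_closure ::
  "'a measure \<Rightarrow> 'b measure \<Rightarrow> (('a \<Rightarrow> complex) \<times> ('b \<Rightarrow> complex)) set \<Rightarrow>
     (('a \<Rightarrow> complex) \<times> ('b \<Rightarrow> complex)) set" where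
  "sum_closure M N S = {p \<in> L2 M \<times> L2 N. \<exists>s. (\<forall>n. s n \<in> S) \<and>
     (\<lambda>n::nat. sqrt ((L2_norm M (\<lambda>x. fst (s n) x - fst p x))\<^sup>2 +
                     (L2_norm N (\<lambda>x. snd (s n) x - snd p x))\<^sup>2)) \<longlonglongrightarrow> 0}"

section \<open>Sesquilinear forms in \<open>L\<^sub>2\<close> and their closures\<close>

type_synonym 'a form = "('a \<Rightarrow> complex) \<Rightarrow> ('a \<Rightarrow> complex) \<Rightarrow> complex"

definition form_norm :: "'a measure \<Rightarrow> 'a form \<Rightarrow> ('a \<Rightarrow> complex) \<Rightarrow> real" where
  "form_norm M b u = sqrt (Re (b u u) + (L2_norm M u)\<^sup>2)"

definition form_Cauchy ::
  "'a measure \<Rightarrow> ('a \<Rightarrow> complex) set \<Rightarrow> 'a form \<Rightarrow> (nat \<Rightarrow> 'a \<Rightarrow> complex) \<Rightarrow> bool" where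
  "form_Cauchy M D b U \<longleftrightarrow> (\<forall>n. U n \<in> D) \<and>
     (\<forall>\<epsilon>>0. \<exists>N. \<forall>m\<ge>N. \<forall>n\<ge>N. form_norm M b (\<lambda>x. U m x - U n x) < \<epsilon>)"

definition closable_form :: "'a measure \<Rightarrow> ('a \<Rightarrow> complex) set \<Rightarrow> 'a form \<Rightarrow> bool" where
  "closable_form M D b \<longleftrightarrow>
     (\<forall>U. form_Cauchy M D b U \<and> (\<lambda>n. L2_norm M (U n)) \<longlonglongrightarrow> 0 \<longrightarrow> (\<lambda>n. b (U n) (U n)) \<longlonglongrightarrow> 0)"

definition form_approx ::
  "'a measure \<Rightarrow> ('a \<Rightarrow> complex) set \<Rightarrow> 'a form \<Rightarrow> (nat \<Rightarrow> 'a \<Rightarrow> complex) \<Rightarrow> ('a \<Rightarrow> complex) \<Rightarrow> bool" where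
  "form_approx M D b U u \<longleftrightarrow> form_Cauchy M D b U \<and> (\<lambda>n. L2_norm M (\<lambda>x. U n x - u x)) \<longlonglongrightarrow> 0"

definition closure_dom :: "'a measure \<Rightarrow> ('a \<Rightarrow> complex) set \<Rightarrow> 'a form \<Rightarrow> ('a \<Rightarrow> complex) set" where
  "closure_dom M D b = {u \<in> L2 M. \<exists>U. form_approx M D b U u}"

definition closure_form :: "'a measure \<Rightarrow> ('a \<Rightarrow> complex) set \<Rightarrow> 'a form \<Rightarrow> 'a form" where
  "closure_form M D b u v =
     (THE c. \<forall>U V. form_approx M D b U u \<and> form_approx M D b V v \<longrightarrow>
                   (\<lambda>n. b (U n) (V n)) \<longlonglongrightarrow> c)"

section \<open>The operator associated with a form and a map \<open>j\<close>\<close>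

(* V is the form domain, H a space with inner product ip and equality eq, and j maps V into H. *)
definition associated_graph ::
  "'v set \<Rightarrow> ('v \<Rightarrow> 'v \<Rightarrow> complex) \<Rightarrow> ('v \<Rightarrow> 'h) \<Rightarrow> 'h set \<Rightarrow> ('h \<Rightarrow> 'h \<Rightarrow> complex) \<Rightarrow>
     ('h \<Rightarrow> 'h \<Rightarrow> bool) \<Rightarrow> 'h \<Rightarrow> 'h \<Rightarrow> bool" where
  "associated_graph V a j H ip eq x y \<longleftrightarrow>
     x \<in> H \<and> y \<in> H \<and> (\<exists>u\<in>V. eq (j u) x \<and> (\<forall>v\<in>V. a u v = ip y (j v)))"

definition associated_dom ::
  "'v set \<Rightarrow> ('v \<Rightarrow> 'v \<Rightarrow> complex) \<Rightarrow> ('v \<Rightarrow> 'h) \<Rightarrow> 'h set \<Rightarrow> ('h \<Rightarrow> 'h \<Rightarrow> complex) \<Rightarrow>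
     ('h \<Rightarrow> 'h \<Rightarrow> bool) \<Rightarrow> 'h set" where
  "associated_dom V a j H ip eq = {x. \<exists>y. associated_graph V a j H ip eq x y}"

definition associated_operator ::
  "'v set \<Rightarrow> ('v \<Rightarrow> 'v \<Rightarrow> complex) \<Rightarrow> ('v \<Rightarrow> 'h) \<Rightarrow> 'h set \<Rightarrow> ('h \<Rightarrow> 'h \<Rightarrow> complex) \<Rightarrow>
     ('h \<Rightarrow> 'h \<Rightarrow> bool) \<Rightarrow> 'h \<Rightarrow> 'h" where
  "associated_operator V a j H ip eq x = (SOME y. associated_graph V a j H ip eq x y)"

section \<open>Hausdorff measure\<close>

(* Normalised so that the s-dimensional measure of the unit ball of an s-dimensional subspace is
   its Lebesgue volume. For s = 0 a nonempty set of diameter 0 has weight 1 (0 ^ 0 = 1). *)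
definition hausdorff_weight :: "nat \<Rightarrow> 'a::metric_space set \<Rightarrow> ennreal" where
  "hausdorff_weight s E =
     (if E = {} then 0 else ennreal (unit_ball_vol (real s) * (diameter E / 2) ^ s))"

definition hausdorff_premeasure :: "nat \<Rightarrow> real \<Rightarrow> 'a::metric_space set \<Rightarrow> ennreal" where
  "hausdorff_premeasure s \<delta> S =
     (INF E \<in> {E :: nat \<Rightarrow> 'a set. S \<subseteq> (\<Union>n. E n) \<and> (\<forall>n. bounded (E n) \<and> diameter (E n) \<le> \<delta>)}.
        \<Sum>n. hausdorff_weight s (E n))"

definition hausdorff_outer :: "nat \<Rightarrow> 'a::metric_space set \<Rightarrow> ennreal" where
  "hausdorff_outer s S = (SUP \<delta>\<in>{0<..}. hausdorff_premeasure s \<delta> S)"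

(* hausdorff_outer s is a metric outer measure, hence countably additive on the Borel sets,
   so emeasure (hausdorff s) agrees with it there. *)
definition hausdorff :: "nat \<Rightarrow> 'a::metric_space measure" where
  "hausdorff s = measure_of UNIV (sets borel) (hausdorff_outer s)"

definition surf :: "(real ^ 'd) set \<Rightarrow> (real ^ 'd) measure" where
  "surf G = restrict_space (hausdorff (CARD('d) - 1)) G"

definition zero_ext :: "'a set \<Rightarrow> ('a \<Rightarrow> complex) \<Rightarrow> 'a \<Rightarrow> complex" where
  "zero_ext G \<phi> x = (if x \<in> G then \<phi> x else 0)"

section \<open>Test functions and the Sobolev space \<open>H\<^sup>1\<close>\<close>

definition partial :: "'d \<Rightarrow> (real ^ 'd::finite \<Rightarrow> complex) \<Rightarrow> real ^ 'd \<Rightarrow> complex" where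
  "partial i f x = frechet_derivative f (at x) (axis i 1)"

primrec Ck :: "nat \<Rightarrow> (real ^ 'd::finite \<Rightarrow> complex) \<Rightarrow> bool" where
  "Ck 0 f \<longleftrightarrow> continuous_on UNIV f"
| "Ck (Suc k) f \<longleftrightarrow> (\<forall>x. f differentiable (at x)) \<and> (\<forall>i. Ck k (partial i f))"

definition test_functions :: "(real ^ 'd::finite) set \<Rightarrow> (real ^ 'd \<Rightarrow> complex) set" where
  "test_functions \<Omega> =
     {f. (\<forall>k. Ck k f) \<and> compact (closure {x. f x \<noteq> 0}) \<and> closure {x. f x \<noteq> 0} \<subseteq> \<Omega>}"

definition is_weak_partial ::
  "(real ^ 'd::finite) set \<Rightarrow> 'd \<Rightarrow> (real ^ 'd \<Rightarrow> complex) \<Rightarrow> (real ^ 'd \<Rightarrow> complex) \<Rightarrow> bool" where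
  "is_weak_partial \<Omega> i u g \<longleftrightarrow> g \<in> L2 (lebesgue_on \<Omega>) \<and>
     (\<forall>f\<in>test_functions \<Omega>.
        (\<integral>x. u x * partial i f x \<partial>lebesgue_on \<Omega>) = - (\<integral>x. g x * f x \<partial>lebesgue_on \<Omega>))"

definition H1 :: "(real ^ 'd::finite) set \<Rightarrow> (real ^ 'd \<Rightarrow> complex) set" where
  "H1 \<Omega> = {u \<in> L2 (lebesgue_on \<Omega>). \<forall>i. \<exists>g. is_weak_partial \<Omega> i u g}"

definition weak_partial ::
  "(real ^ 'd::finite) set \<Rightarrow> 'd \<Rightarrow> (real ^ 'd \<Rightarrow> complex) \<Rightarrow> real ^ 'd \<Rightarrow> complex" where
  "weak_partial \<Omega> i u = (SOME g. is_weak_partial \<Omega> i u g)"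

section \<open>The elliptic form, its closure, and traces\<close>

type_synonym 'd coeffs = "'d \<Rightarrow> 'd \<Rightarrow> real ^ 'd \<Rightarrow> complex"

definition b_N :: "(real ^ 'd::finite) set \<Rightarrow> 'd coeffs \<Rightarrow> (real ^ 'd) form" where
  "b_N \<Omega> a u v = (\<Sum>i\<in>UNIV. \<Sum>j\<in>UNIV.
     \<integral>x. weak_partial \<Omega> i u x * a i j x * cnj (weak_partial \<Omega> j v x) \<partial>lebesgue_on \<Omega>)"

definition bbar_dom :: "(real ^ 'd::finite) set \<Rightarrow> 'd coeffs \<Rightarrow> (real ^ 'd \<Rightarrow> complex) set" where
  "bbar_dom \<Omega> a = closure_dom (lebesgue_on \<Omega>) (H1 \<Omega>) (b_N \<Omega> a)"

definition bbar :: "(real ^ 'd::finite) set \<Rightarrow> 'd coeffs \<Rightarrow> (real ^ 'd) form" where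
  "bbar \<Omega> a = closure_form (lebesgue_on \<Omega>) (H1 \<Omega>) (b_N \<Omega> a)"

definition bbar_norm :: "(real ^ 'd::finite) set \<Rightarrow> 'd coeffs \<Rightarrow> (real ^ 'd \<Rightarrow> complex) \<Rightarrow> real" where
  "bbar_norm \<Omega> a = form_norm (lebesgue_on \<Omega>) (bbar \<Omega> a)"

(* An element of H1 with a continuous extension to the closure is represented by a function that
   is itself continuous on the closure, so its restriction to the boundary is meaningful. *)
definition D_b :: "(real ^ 'd::finite) set \<Rightarrow> (real ^ 'd \<Rightarrow> complex) set" where
  "D_b \<Omega> = {u \<in> H1 \<Omega>. continuous_on (closure \<Omega>) u \<and>
     (\<integral>\<^sup>+x. ennreal ((cmod (u x))\<^sup>2) \<partial>surf (frontier \<Omega>)) < \<infinity>}"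

definition is_trace ::
  "(real ^ 'd::finite) set \<Rightarrow> 'd coeffs \<Rightarrow> (real ^ 'd \<Rightarrow> complex) \<Rightarrow> (real ^ 'd \<Rightarrow> complex) \<Rightarrow> bool" where
  "is_trace \<Omega> a u \<phi> \<longleftrightarrow> u \<in> bbar_dom \<Omega> a \<and> \<phi> \<in> L2 (surf (frontier \<Omega>)) \<and>
     (\<exists>U. (\<forall>n::nat. U n \<in> D_b \<Omega>) \<and>
        (\<lambda>n. bbar_norm \<Omega> a (\<lambda>x. U n x - u x)) \<longlonglongrightarrow> 0 \<and>
        (\<lambda>n. L2_norm (surf (frontier \<Omega>)) (\<lambda>x. U n x - \<phi> x)) \<longlonglongrightarrow> 0)"

definition H1_b\<sigma> :: "(real ^ 'd::finite) set \<Rightarrow> 'd coeffs \<Rightarrow> (real ^ 'd \<Rightarrow> complex) set" where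
  "H1_b\<sigma> \<Omega> a = {u \<in> bbar_dom \<Omega> a. \<exists>\<phi>. is_trace \<Omega> a u \<phi>}"

(* G is an admissible choice of the boundary part that carries the traces (it is only determined
   up to null sets); functions vanishing almost everywhere on G are the elements of
   L_2(frontier \<Omega> - G) extended by zero. *)
definition is_trace_part :: "(real ^ 'd::finite) set \<Rightarrow> 'd coeffs \<Rightarrow> (real ^ 'd) set \<Rightarrow> bool" where
  "is_trace_part \<Omega> a G \<longleftrightarrow> G \<in> sets borel \<and> G \<subseteq> frontier \<Omega> \<and>
     {\<phi>. is_trace \<Omega> a (\<lambda>x. 0) \<phi>} =
     {\<phi> \<in> L2 (surf (frontier \<Omega>)). AE x in surf (frontier \<Omega>). x \<in> G \<longrightarrow> \<phi> x = 0}"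

definition Tr ::
  "(real ^ 'd::finite) set \<Rightarrow> 'd coeffs \<Rightarrow> (real ^ 'd) set \<Rightarrow> (real ^ 'd \<Rightarrow> complex) \<Rightarrow> real ^ 'd \<Rightarrow> complex" where
  "Tr \<Omega> a G u = (SOME \<phi>. \<phi> \<in> L2 (surf G) \<and> is_trace \<Omega> a u (zero_ext G \<phi>))"

(* Epsilon-delta continuity of Tr with respect to the norm of the closed form alone, without the
   trace term of the Hilbert space norm. *)
definition Tr_continuous :: "(real ^ 'd::finite) set \<Rightarrow> 'd coeffs \<Rightarrow> (real ^ 'd) set \<Rightarrow> bool" where
  "Tr_continuous \<Omega> a G \<longleftrightarrow>
     (\<forall>u\<in>H1_b\<sigma> \<Omega> a. \<forall>\<epsilon>>0. \<exists>\<delta>>0. \<forall>v\<in>H1_b\<sigma> \<Omega> a.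
        bbar_norm \<Omega> a (\<lambda>x. v x - u x) < \<delta> \<longrightarrow>
        L2_norm (surf G) (\<lambda>x. Tr \<Omega> a G v x - Tr \<Omega> a G u x) < \<epsilon>)"

definition is_weak_A ::
  "(real ^ 'd::finite) set \<Rightarrow> 'd coeffs \<Rightarrow> (real ^ 'd \<Rightarrow> complex) \<Rightarrow> (real ^ 'd \<Rightarrow> complex) \<Rightarrow> bool" where
  "is_weak_A \<Omega> a u f \<longleftrightarrow> f \<in> L2 (lebesgue_on \<Omega>) \<and>
     (\<forall>v\<in>test_functions \<Omega>. bbar \<Omega> a u v = (\<integral>x. f x * cnj (v x) \<partial>lebesgue_on \<Omega>))"

definition calA_in_L2 :: "(real ^ 'd::finite) set \<Rightarrow> 'd coeffs \<Rightarrow> (real ^ 'd \<Rightarrow> complex) \<Rightarrow> bool" where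
  "calA_in_L2 \<Omega> a u \<longleftrightarrow> u \<in> bbar_dom \<Omega> a \<and> (\<exists>f. is_weak_A \<Omega> a u f)"

definition calA ::
  "(real ^ 'd::finite) set \<Rightarrow> 'd coeffs \<Rightarrow> (real ^ 'd \<Rightarrow> complex) \<Rightarrow> real ^ 'd \<Rightarrow> complex" where
  "calA \<Omega> a u = (SOME f. is_weak_A \<Omega> a u f)"

definition is_normal_derivative ::
  "(real ^ 'd::finite) set \<Rightarrow> 'd coeffs \<Rightarrow> (real ^ 'd \<Rightarrow> complex) \<Rightarrow> (real ^ 'd \<Rightarrow> complex) \<Rightarrow> bool" where
  "is_normal_derivative \<Omega> a u \<phi> \<longleftrightarrow> calA_in_L2 \<Omega> a u \<and> \<phi> \<in> L2 (surf (frontier \<Omega>)) \<and>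
     (\<forall>v\<in>D_b \<Omega>. bbar \<Omega> a u v - (\<integral>x. calA \<Omega> a u x * cnj (v x) \<partial>lebesgue_on \<Omega>) =
                 (\<integral>x. \<phi> x * cnj (v x) \<partial>surf (frontier \<Omega>)))"

section \<open>The form \<open>a\<close>, the space \<open>H\<close> and the operator \<open>A\<close>\<close>

definition form_a ::
  "(real ^ 'd::finite) set \<Rightarrow> 'd coeffs \<Rightarrow> (real ^ 'd) set \<Rightarrow> (real ^ 'd \<Rightarrow> complex) \<Rightarrow> (real ^ 'd) form" where
  "form_a \<Omega> a G \<alpha> u v = bbar \<Omega> a u v +
     (\<integral>x. Tr \<Omega> a G u x * cnj (Tr \<Omega> a G v x) * \<alpha> x \<partial>surf G)"

type_synonym 'd fpair = "(real ^ 'd \<Rightarrow> complex) \<times> (real ^ 'd \<Rightarrow> complex)"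

definition jmap ::
  "(real ^ 'd::finite) set \<Rightarrow> 'd coeffs \<Rightarrow> (real ^ 'd) set \<Rightarrow>
     ((real ^ 'd \<Rightarrow> complex) \<Rightarrow> (real ^ 'd \<Rightarrow> complex)) \<Rightarrow> (real ^ 'd \<Rightarrow> complex) \<Rightarrow> 'd fpair" where
  "jmap \<Omega> a G B u = (u, B (Tr \<Omega> a G u))"

definition spaceH ::
  "(real ^ 'd::finite) set \<Rightarrow> 'd coeffs \<Rightarrow> (real ^ 'd) set \<Rightarrow>
     ((real ^ 'd \<Rightarrow> complex) \<Rightarrow> (real ^ 'd \<Rightarrow> complex)) \<Rightarrow> 'd fpair set" where
  "spaceH \<Omega> a G B =
     sum_closure (lebesgue_on \<Omega>) (surf G) {(u, B (Tr \<Omega> a G u)) | u. u \<in> H1_b\<sigma> \<Omega> a}"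

definition dom_A ::
  "(real ^ 'd::finite) set \<Rightarrow> 'd coeffs \<Rightarrow> (real ^ 'd) set \<Rightarrow> (real ^ 'd \<Rightarrow> complex) \<Rightarrow>
     ((real ^ 'd \<Rightarrow> complex) \<Rightarrow> (real ^ 'd \<Rightarrow> complex)) \<Rightarrow> 'd fpair set" where
  "dom_A \<Omega> a G \<alpha> B =
     associated_dom (H1_b\<sigma> \<Omega> a) (form_a \<Omega> a G \<alpha>) (jmap \<Omega> a G B) (spaceH \<Omega> a G B)
       (sum_inner (lebesgue_on \<Omega>) (surf G)) (sum_eq (lebesgue_on \<Omega>) (surf G))"

definition op_A ::
  "(real ^ 'd::finite) set \<Rightarrow> 'd coeffs \<Rightarrow> (real ^ 'd) set \<Rightarrow> (real ^ 'd \<Rightarrow> complex) \<Rightarrow>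
     ((real ^ 'd \<Rightarrow> complex) \<Rightarrow> (real ^ 'd \<Rightarrow> complex)) \<Rightarrow> 'd fpair \<Rightarrow> 'd fpair" where
  "op_A \<Omega> a G \<alpha> B =
     associated_operator (H1_b\<sigma> \<Omega> a) (form_a \<Omega> a G \<alpha>) (jmap \<Omega> a G B) (spaceH \<Omega> a G B)
       (sum_inner (lebesgue_on \<Omega>) (surf G)) (sum_eq (lebesgue_on \<Omega>) (surf G))"

end

(* Write y = (f, psi). The equation a(u, v) = (y, j v) for all v in H^1_{b,sigma} reads
     b(u, v) = (f, v) + (B* psi - alpha Tr u, Tr v),
   b denoting the closure of b_N. Inserting test functions, whose trace is 0, gives A u = f, and
   inserting v in D(b), whose trace is its restriction to the boundary, gives the normal derivative.
   Conversely, the weak equation and the normal derivative give the identity for v in D(b). By the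
   definition of traces every v in H^1_{b,sigma} is a limit of elements of D(b) for which the
   restrictions to the boundary converge to Tr v as well; since b is sectorial, both sides are
   continuous for this convergence. The value A x is unique: j(u) determines u and hence Tr u, so
   two values of A x differ by an element orthogonal to the range of j, which is dense in H. *)

theory Submission
  imports Defs
begin

section \<open>Sectorial forms and \<open>L\<^sub>2\<close>\<close>

text \<open>Elements of L_2 are represented by functions, and \<open>weak_partial\<close>,
  \<open>Tr\<close>, \<open>calA\<close> and \<open>L2_adjoint\<close> are arbitrary choices, so
  facts that are immediate for classes become statements about null sets. The longest detour comes
  from here: additivity of the chosen weak derivative rests on uniqueness of weak derivatives, hence
  on the fundamental lemma of the calculus of variations, and that calls for an explicit supply of
  smooth functions with compact support. Likewise the chosen adjoint is meaningful only after
  completeness of L_2 and Riesz representation. Sectoriality enters through the single inequality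
  |b(u,u)| <= C Re b(u,u). The locale below draws a Cauchy-Schwarz inequality from it and serves
  three times: for the L_2 inner product with C = 1, and for \<open>b_N\<close> and its closure with
  C = 1 / cos \<theta>. Convergence in the form norm controls only Re b on the diagonal; this
  inequality makes the full complex form continuous.\<close>

locale sectorial_form =
  fixes D :: "('a \<Rightarrow> complex) set" and b :: "'a form" and C :: real
  assumes C_pos: "C > 0"
    and zero_mem: "(\<lambda>x. 0) \<in> D"
    and add_mem: "u \<in> D \<Longrightarrow> v \<in> D \<Longrightarrow> (\<lambda>x. u x + v x) \<in> D"
    and scale_mem: "u \<in> D \<Longrightarrow> (\<lambda>x. c * u x) \<in> D"
    and add_left: "u \<in> D \<Longrightarrow> v \<in> D \<Longrightarrow> w \<in> D \<Longrightarrow> b (\<lambda>x. u x + v x) w = b u w + b v w"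
    and scale_left: "u \<in> D \<Longrightarrow> w \<in> D \<Longrightarrow> b (\<lambda>x. c * u x) w = c * b u w"
    and add_right: "u \<in> D \<Longrightarrow> v \<in> D \<Longrightarrow> w \<in> D \<Longrightarrow> b w (\<lambda>x. u x + v x) = b w u + b w v"
    and scale_right: "u \<in> D \<Longrightarrow> w \<in> D \<Longrightarrow> b w (\<lambda>x. c * u x) = cnj c * b w u"
    and sectorial: "u \<in> D \<Longrightarrow> cmod (b u u) \<le> C * Re (b u u)"
begin

lemma diff_mem: "u \<in> D \<Longrightarrow> v \<in> D \<Longrightarrow> (\<lambda>x. u x - v x) \<in> D"
  using add_mem[OF _ scale_mem[of v "-1"], of u] by simp

lemma diff_left:
  assumes "u \<in> D" "v \<in> D" "w \<in> D" shows "b (\<lambda>x. u x - v x) w = b u w - b v w"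
  using add_left[OF assms(1) scale_mem[OF assms(2), of "-1"] assms(3)] scale_left[OF assms(2,3), of "-1"]
  by simp

lemma diff_right:
  assumes "u \<in> D" "v \<in> D" "w \<in> D" shows "b w (\<lambda>x. u x - v x) = b w u - b w v"
  using add_right[OF assms(1) scale_mem[OF assms(2), of "-1"] assms(3)] scale_right[OF assms(2,3), of "-1"]
  by simp

lemma zero_left: "w \<in> D \<Longrightarrow> b (\<lambda>x. 0) w = 0"
  using scale_left[OF zero_mem, of w 0] by simp

lemma Re_nonneg:
  assumes "u \<in> D" shows "0 \<le> Re (b u u)"
proof -
  have "0 \<le> C * Re (b u u)" using sectorial[OF assms] norm_ge_zero order_trans by blast
  then show ?thesis using C_pos by (simp add: zero_le_mult_iff)
qed

lemma Re_parallelogram: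
  assumes u: "u \<in> D" and v: "v \<in> D"
  shows "Re (b (\<lambda>x. u x + v x) (\<lambda>x. u x + v x)) + Re (b (\<lambda>x. u x - v x) (\<lambda>x. u x - v x))
    = 2 * Re (b u u) + 2 * Re (b v v)"
  using u v by (simp add: add_left diff_left add_right diff_right add_mem diff_mem)

lemma Re_add_le:
  assumes "u \<in> D" "v \<in> D"
  shows "Re (b (\<lambda>x. u x + v x) (\<lambda>x. u x + v x)) \<le> 2 * Re (b u u) + 2 * Re (b v v)"
  using Re_parallelogram[OF assms] Re_nonneg[OF diff_mem[OF assms]] by simp

lemma Re_diff_le:
  assumes "u \<in> D" "v \<in> D"
  shows "Re (b (\<lambda>x. u x - v x) (\<lambda>x. u x - v x)) \<le> 2 * Re (b u u) + 2 * Re (b v v)"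
  using Re_parallelogram[OF assms] Re_nonneg[OF add_mem[OF assms]] by simp

lemma polarization:
  assumes u: "u \<in> D" and v: "v \<in> D"
  shows "4 * b u v = b (\<lambda>x. u x + v x) (\<lambda>x. u x + v x) - b (\<lambda>x. u x - v x) (\<lambda>x. u x - v x)
    + \<i> * b (\<lambda>x. u x + \<i> * v x) (\<lambda>x. u x + \<i> * v x) - \<i> * b (\<lambda>x. u x - \<i> * v x) (\<lambda>x. u x - \<i> * v x)"
proof -
  \<comment> \<open>To be used with w = v and with w = i v; after the second instance is multiplied
    by i, the two contributions of b v u cancel.\<close>
  have q: "b (\<lambda>x. u x + w x) (\<lambda>x. u x + w x) - b (\<lambda>x. u x - w x) (\<lambda>x. u x - w x) = 2 * b u w + 2 * b w u"
    if w: "w \<in> D" for w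
    using add_mem[OF u w] diff_mem[OF u w]
    by (simp add: add_left[OF u w] add_right[OF u w] diff_left[OF u w] diff_right[OF u w] u w)
  have "b u (\<lambda>x. \<i> * v x) = - \<i> * b u v" "b (\<lambda>x. \<i> * v x) u = \<i> * b v u"
    using scale_left[OF v u, of \<i>] scale_right[OF v u, of \<i>] by simp_all
  then show ?thesis
    unfolding add_diff_eq[symmetric] right_diff_distrib[symmetric] q[OF v] q[OF scale_mem[OF v, of \<i>]]
    by (simp add: algebra_simps)
qed

text \<open>Polarization expresses b u v by four diagonal values. Sectoriality bounds each of them
  by its real part, and the parallelogram law adds these real parts up to 4 (Re (b u u) + Re (b v
  v)), because v and i v have the same diagonal value.\<close>

lemma bound_sum:
  assumes u: "u \<in> D" and v: "v \<in> D"
  shows "cmod (b u v) \<le> C * (Re (b u u) + Re (b v v))"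
proof -
  have iv: "(\<lambda>x. \<i> * v x) \<in> D" by (rule scale_mem[OF v])
  let ?p = "\<lambda>w. b (\<lambda>x. u x + w x) (\<lambda>x. u x + w x)" and ?m = "\<lambda>w. b (\<lambda>x. u x - w x) (\<lambda>x. u x - w x)"
  have "4 * cmod (b u v) = cmod (?p v - ?m v + \<i> * ?p (\<lambda>x. \<i> * v x) - \<i> * ?m (\<lambda>x. \<i> * v x))"
    using arg_cong[OF polarization[OF u v], of cmod] by (simp add: norm_mult)
  also have "\<dots> \<le> cmod (?p v) + cmod (?m v) + cmod (?p (\<lambda>x. \<i> * v x)) + cmod (?m (\<lambda>x. \<i> * v x))"
    using norm_triangle_ineq4[of "?p v - ?m v + \<i> * ?p (\<lambda>x. \<i> * v x)" "\<i> * ?m (\<lambda>x. \<i> * v x)"]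
      norm_triangle_ineq[of "?p v - ?m v" "\<i> * ?p (\<lambda>x. \<i> * v x)"] norm_triangle_ineq4[of "?p v" "?m v"]
    by (simp only: norm_mult norm_ii mult_1)
  also have "\<dots> \<le> C * (Re (?p v) + Re (?m v)) + C * (Re (?p (\<lambda>x. \<i> * v x)) + Re (?m (\<lambda>x. \<i> * v x)))"
    using sectorial[OF add_mem[OF u v]] sectorial[OF diff_mem[OF u v]]
      sectorial[OF add_mem[OF u iv]] sectorial[OF diff_mem[OF u iv]]
    by (simp add: algebra_simps)
  also have "\<dots> = 4 * (C * (Re (b u u) + Re (b v v)))"
    unfolding Re_parallelogram[OF u v] Re_parallelogram[OF u iv] scale_left[OF v iv] scale_right[OF v v]
    by (simp add: distrib_left)
  finally show ?thesis by simp
qed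

text \<open>Cauchy-Schwarz for a nonsymmetric form: b u v is unchanged when u is multiplied by t and
  v by 1/t, so \<open>bound_sum\<close> may be optimised over t. The optimal t^2 is the quotient of
  the square roots of Re (b v v) and Re (b u u).\<close>

lemma bound:
  assumes u: "u \<in> D" and v: "v \<in> D"
  shows "cmod (b u v) \<le> 2 * C * (sqrt (Re (b u u)) * sqrt (Re (b v v)))"
proof -
  let ?A = "Re (b u u)" and ?B = "Re (b v v)"
  have scaled: "cmod (b u v) \<le> C * (t\<^sup>2 * ?A + ?B / t\<^sup>2)" if t: "t > 0" for t :: real
  proof -
    let ?u = "\<lambda>x. of_real t * u x" and ?v = "\<lambda>x. of_real (1/t) * v x"
    have D: "?u \<in> D" "?v \<in> D" using u v scale_mem by blast+
    have "b u v = b ?u ?v"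
      unfolding scale_left[OF u D(2)] scale_right[OF v u] using t by simp
    then show ?thesis
      using bound_sum[OF D] unfolding scale_left[OF u D(1)] scale_right[OF u u] scale_left[OF v D(2)] scale_right[OF v v]
      by (simp add: power2_eq_square mult.assoc)
  qed
  \<comment> \<open>Either diagonal value may be 0, and then there is no optimal t. Both are raised
    by e > 0, and e tends to 0 at the end.\<close>
  have eps: "cmod (b u v) \<le> 2 * C * (sqrt (?A + e) * sqrt (?B + e))" if e: "e > 0" for e
  proof -
    define p q where "p = ?A + e" and "q = ?B + e"
    have pq: "p > 0" "q > 0" using Re_nonneg u v e unfolding p_def q_def by (auto simp: add_nonneg_pos)
    define s where "s = sqrt q / sqrt p"
    have s: "s > 0" using pq by (simp add: s_def)
    have "cmod (b u v) \<le> C * (s * ?A + ?B / s)"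
      using scaled[of "sqrt s"] s by simp
    also have "\<dots> \<le> C * (s * p + q / s)"
      using s e C_pos by (intro mult_left_mono add_mono divide_right_mono) (auto simp: p_def q_def)
    also have "s * p = sqrt q * sqrt p"
      using pq real_sqrt_mult_self[of p] by (simp add: s_def field_simps)
    also have "q / s = sqrt q * sqrt p"
      using pq real_sqrt_mult_self[of q] by (simp add: s_def field_simps)
    finally show ?thesis by (simp add: p_def q_def mult.commute mult.left_commute)
  qed
  have "((\<lambda>e. 2 * C * (sqrt (?A + e) * sqrt (?B + e))) \<longlongrightarrow> 2 * C * (sqrt (?A + 0) * sqrt (?B + 0))) (at_right 0)"
    by (intro tendsto_intros)
  then have "cmod (b u v) \<le> 2 * C * (sqrt (?A + 0) * sqrt (?B + 0))"
    by (rule tendsto_lowerbound) (auto simp: eventually_at_right_less eventually_at intro!: exI[of _ 1] eps)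
  then show ?thesis by simp
qed

end

section \<open>Elementary L_2 theory: linear structure, norm and inner product\<close>

lemma borel_measurable_cnj [measurable (raw)]:
  "f \<in> borel_measurable M \<Longrightarrow> (\<lambda>x. cnj (f x)) \<in> borel_measurable M"
  by (rule measurable_compose[OF _ borel_measurable_continuous_onI[OF continuous_on_cnj[OF continuous_on_id]]])

lemma L2_D: "f \<in> L2 M \<Longrightarrow> f \<in> borel_measurable M" "f \<in> L2 M \<Longrightarrow> integrable M (\<lambda>x. (cmod (f x))\<^sup>2)"
  by (auto simp: L2_def)

lemma L2_bound:
  assumes "g \<in> L2 M" "f \<in> borel_measurable M" "AE x in M. cmod (f x) \<le> C * cmod (g x)"
  shows "f \<in> L2 M"
proof -
  have "integrable M (\<lambda>x. C\<^sup>2 * (cmod (g x))\<^sup>2)" using assms(1) by (simp add: L2_def)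
  then have "integrable M (\<lambda>x. (cmod (f x))\<^sup>2)"
  proof (rule Bochner_Integration.integrable_bound)
    show "AE x in M. norm ((cmod (f x))\<^sup>2) \<le> norm (C\<^sup>2 * (cmod (g x))\<^sup>2)"
      using assms(3) by eventually_elim (metis norm_ge_zero power_mono power_mult_distrib real_norm_def abs_of_nonneg zero_le_power2)
  qed (use assms(2) in measurable)
  then show ?thesis using assms(2) by (simp add: L2_def)
qed

lemma L2_zero [simp]: "(\<lambda>x. 0) \<in> L2 M"
  by (simp add: L2_def)

lemma L2_add:
  assumes "f \<in> L2 M" "g \<in> L2 M" shows "(\<lambda>x. f x + g x) \<in> L2 M"
proof -
  have "integrable M (\<lambda>x. 2 * (cmod (f x))\<^sup>2 + 2 * (cmod (g x))\<^sup>2)" using assms by (simp add: L2_def)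
  then have "integrable M (\<lambda>x. (cmod (f x + g x))\<^sup>2)"
  proof (rule Bochner_Integration.integrable_bound)
    have "(cmod (f x + g x))\<^sup>2 \<le> 2 * (cmod (f x))\<^sup>2 + 2 * (cmod (g x))\<^sup>2" for x
    proof -
      have "(cmod (f x + g x))\<^sup>2 \<le> (cmod (f x) + cmod (g x))\<^sup>2"
        by (intro power_mono norm_triangle_ineq) simp
      also have "\<dots> \<le> 2 * (cmod (f x))\<^sup>2 + 2 * (cmod (g x))\<^sup>2"
        using zero_le_power2[of "cmod (f x) - cmod (g x)"] by (simp add: power2_eq_square algebra_simps)
      finally show ?thesis .
    qed
    then show "AE x in M. norm ((cmod (f x + g x))\<^sup>2) \<le> norm (2 * (cmod (f x))\<^sup>2 + 2 * (cmod (g x))\<^sup>2)"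
      by simp
  qed (use assms in \<open>auto simp: L2_def\<close>)
  then show ?thesis using assms by (auto simp: L2_def)
qed

lemma L2_scale: "f \<in> L2 M \<Longrightarrow> (\<lambda>x. c * f x) \<in> L2 M"
  by (rule L2_bound[where C="cmod c"]) (auto simp: L2_def norm_mult)

lemma L2_diff: "f \<in> L2 M \<Longrightarrow> g \<in> L2 M \<Longrightarrow> (\<lambda>x. f x - g x) \<in> L2 M"
  using L2_add[OF _ L2_scale[of g M "-1"], of f] by simp

lemma L2_cnj: "f \<in> L2 M \<Longrightarrow> (\<lambda>x. cnj (f x)) \<in> L2 M"
  by (rule L2_bound[where C=1])
(auto simp: L2_def)

lemma L2_mult_Linf:
  assumes "\<alpha> \<in> Linf M" "f \<in> L2 M" shows "(\<lambda>x. \<alpha> x * f x) \<in> L2 M"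
proof -
  obtain C where "AE x in M. cmod (\<alpha> x) \<le> C" using assms(1) by (auto simp: Linf_def)
  then have "AE x in M. cmod (\<alpha> x * f x) \<le> C * cmod (f x)"
    by eventually_elim (simp add: norm_mult mult_right_mono)
  then show ?thesis using assms by (intro L2_bound[OF assms(2)]) (auto simp: L2_def Linf_def)
qed

lemma L2_mult_integrable:
  assumes "f \<in> L2 M" "g \<in> L2 M" shows "integrable M (\<lambda>x. f x * g x)"
proof -
  have "integrable M (\<lambda>x. (cmod (f x))\<^sup>2 + (cmod (g x))\<^sup>2)" using assms by (simp add: L2_def)
  then show ?thesis
  proof (rule Bochner_Integration.integrable_bound)
    have "cmod (f x) * cmod (g x) \<le> (cmod (f x))\<^sup>2 + (cmod (g x))\<^sup>2" for x
      using sum_squares_bound[of "cmod (f x)" "cmod (g x)"] mult_nonneg_nonneg[of "cmod (f x)" "cmod (g x)"]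
      by (simp del: mult_nonneg_nonneg)
    then show "AE x in M. norm (f x * g x) \<le> norm ((cmod (f x))\<^sup>2 + (cmod (g x))\<^sup>2)"
      by (simp add: norm_mult)
  qed (use assms in \<open>auto simp: L2_def\<close>)
qed

lemma L2_mult_cnj_integrable:
  assumes "f \<in> L2 M" "g \<in> L2 M" shows "integrable M (\<lambda>x. f x * cnj (g x))"
  by (rule L2_mult_integrable[OF assms(1) L2_cnj[OF assms(2)]])

lemma L2_norm_cong:
  assumes "AE x in M. f x = g x" "f \<in> borel_measurable M" "g \<in> borel_measurable M"
  shows "L2_norm M f = L2_norm M g"
  unfolding L2_norm_def
  by (intro arg_cong[of _ _ sqrt] integral_cong_AE) (use assms in auto)

lemma L2_norm_sq: "(L2_norm M f)\<^sup>2 = (\<integral>x. (cmod (f x))\<^sup>2 \<partial>M)"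
  unfolding L2_norm_def by (rule real_sqrt_pow2) (rule integral_nonneg_AE, simp)

lemma L2_norm_nonneg [simp]: "0 \<le> L2_norm M f"
  unfolding L2_norm_def by (simp add: integral_nonneg_AE)

lemma L2_inner_self:
  assumes "f \<in> L2 M" shows "L2_inner M f f = of_real ((L2_norm M f)\<^sup>2)"
  unfolding L2_inner_def L2_norm_sq complex_norm_square[symmetric] by (rule integral_complex_of_real)

lemma L2_inner_commute: "L2_inner M g f = cnj (L2_inner M f g)"
  unfolding L2_inner_def Bochner_Integration.integral_cnj[symmetric] by (simp add: mult.commute)

text \<open>The diagonal of the inner product is real and nonnegative, hence C = 1. The
  interpretation that follows supplies sesquilinearity, the parallelogram law and a Cauchy-Schwarz
  inequality under the prefix \<open>L2\<close>.\<close>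

lemma L2_sectorial: "sectorial_form (L2 M) (L2_inner M) 1"
proof
  fix u v w :: "'a \<Rightarrow> complex" and c assume u: "u \<in> L2 M" and w: "w \<in> L2 M"
  show "L2_inner M (\<lambda>x. c * u x) w = c * L2_inner M u w"
    using L2_mult_cnj_integrable[OF u w] by (simp add: L2_inner_def mult.assoc)
  show "L2_inner M w (\<lambda>x. c * u x) = cnj c * L2_inner M w u"
    using L2_mult_cnj_integrable[OF w u] by (simp add: L2_inner_def mult.left_commute)
  assume v: "v \<in> L2 M"
  show "L2_inner M (\<lambda>x. u x + v x) w = L2_inner M u w + L2_inner M v w"
    using L2_mult_cnj_integrable[OF u w] L2_mult_cnj_integrable[OF v w]
    by (simp add: L2_inner_def distrib_right)
  show "L2_inner M w (\<lambda>x. u x + v x) = L2_inner M w u + L2_inner M w v"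
    using L2_mult_cnj_integrable[OF w u] L2_mult_cnj_integrable[OF w v]
    by (simp add: L2_inner_def distrib_left)
next
  fix u :: "'a \<Rightarrow> complex" assume "u \<in> L2 M"
  then show "cmod (L2_inner M u u) \<le> 1 * Re (L2_inner M u u)"
    by (simp add: L2_inner_self norm_power)
qed (auto intro: L2_add L2_scale)

interpretation L2: sectorial_form "L2 M" "L2_inner M" 1 for M
  by (rule L2_sectorial)

text \<open>This is \<open>L2.bound\<close> with C = 1. The factor 2 left over from polarization is
  harmless, because the estimate only serves limits and the boundedness of functionals.\<close>

lemma L2_inner_bound:
  assumes "f \<in> L2 M" "g \<in> L2 M"
  shows "cmod (L2_inner M f g) \<le> 2 * (L2_norm M f * L2_norm M g)"
  using L2.bound[OF assms] assms by (simp add: L2_inner_self)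

text \<open>A quasi-triangle inequality read off from the parallelogram law. It and the version for
  differences take the place of the triangle inequality wherever null sequences or Cauchy sequences
  are combined.\<close>

lemma L2_norm_add_sq:
  assumes "f \<in> L2 M" "g \<in> L2 M"
  shows "(L2_norm M (\<lambda>x. f x + g x))\<^sup>2 \<le> 2 * (L2_norm M f)\<^sup>2 + 2 * (L2_norm M g)\<^sup>2"
  using L2.Re_add_le[OF assms] assms L2_add[OF assms] by (simp add: L2_inner_self)

lemma L2_norm_diff_sq:
  assumes "f \<in> L2 M" "g \<in> L2 M"
  shows "(L2_norm M (\<lambda>x. f x - g x))\<^sup>2 \<le> 2 * (L2_norm M f)\<^sup>2 + 2 * (L2_norm M g)\<^sup>2"
  using L2.Re_diff_le[OF assms] assms L2_diff[OF assms] by (simp add: L2_inner_self)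

lemma L2_norm_scale: "L2_norm M (\<lambda>x. c * f x) = cmod c * L2_norm M f"
  unfolding L2_norm_def by (simp add: norm_mult power_mult_distrib real_sqrt_mult)

lemma L2_norm_minus_commute: "L2_norm M (\<lambda>x. f x - g x) = L2_norm M (\<lambda>x. g x - f x)"
  unfolding L2_norm_def by (simp add: norm_minus_commute)

lemma L2_norm_zero [simp]: "L2_norm M (\<lambda>x. 0) = 0"
  by (simp add: L2_norm_def)

lemma L2_norm_eq_0D:
  assumes "f \<in> L2 M" "L2_norm M f = 0" shows "AE x in M. f x = 0"
proof -
  have "(\<integral>x. (cmod (f x))\<^sup>2 \<partial>M) = 0" using assms L2_norm_sq[of M f] by simp
  then have "AE x in M. (cmod (f x))\<^sup>2 = 0"
    by (subst (asm) integral_nonneg_eq_0_iff_AE) (use assms in \<open>auto simp: L2_def\<close>)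
  then show ?thesis by simp
qed

lemma L2_inner_cong:
  assumes "AE x in M. f x = f' x" "AE x in M. g x = g' x"
    "f \<in> borel_measurable M" "g \<in> borel_measurable M" "f' \<in> borel_measurable M" "g' \<in> borel_measurable M"
  shows "L2_inner M f g = L2_inner M f' g'"
  unfolding L2_inner_def by (rule integral_cong_AE) (use assms in auto)

lemma L2_inner_tendsto:
  assumes "f \<in> L2 M" "g \<in> L2 M" "\<And>n. G n \<in> L2 M" "(\<lambda>n. L2_norm M (\<lambda>x. G n x - g x)) \<longlonglongrightarrow> 0"
  shows "(\<lambda>n. L2_inner M f (G n)) \<longlonglongrightarrow> L2_inner M f g"
proof -
  have "(\<lambda>n. L2_inner M f (G n) - L2_inner M f g) \<longlonglongrightarrow> 0"
  proof (rule Lim_null_comparison)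
    show "\<forall>\<^sub>F n in sequentially. cmod (L2_inner M f (G n) - L2_inner M f g)
        \<le> 2 * (L2_norm M f * L2_norm M (\<lambda>x. G n x - g x))"
      using L2_inner_bound[OF assms(1) L2_diff[OF assms(3,2)]] L2.diff_right[OF assms(3,2,1)] by simp
    show "(\<lambda>n. 2 * (L2_norm M f * L2_norm M (\<lambda>x. G n x - g x))) \<longlonglongrightarrow> 0"
      using tendsto_mult_left[OF assms(4), of "2 * L2_norm M f"] by (simp add: mult.assoc)
  qed
  then show ?thesis using LIM_zero_iff by blast
qed

lemma tendsto_L2_norm_diff:
  assumes "\<And>n. U n \<in> L2 M" "\<And>n. V n \<in> L2 M"
    and "(\<lambda>n. L2_norm M (U n)) \<longlonglongrightarrow> 0" "(\<lambda>n. L2_norm M (V n)) \<longlonglongrightarrow> 0"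
  shows "(\<lambda>n. L2_norm M (\<lambda>x. U n x - V n x)) \<longlonglongrightarrow> 0"
proof -
  have "(\<lambda>n. 2 * (L2_norm M (U n))\<^sup>2 + 2 * (L2_norm M (V n))\<^sup>2) \<longlonglongrightarrow> 2 * 0\<^sup>2 + 2 * 0\<^sup>2"
    by (intro tendsto_intros assms)
  then have "(\<lambda>n. 2 * (L2_norm M (U n))\<^sup>2 + 2 * (L2_norm M (V n))\<^sup>2) \<longlonglongrightarrow> 0" by simp
  then have "(\<lambda>n. (L2_norm M (\<lambda>x. U n x - V n x))\<^sup>2) \<longlonglongrightarrow> 0"
    by (rule Lim_null_comparison[rotated]) (use L2_norm_diff_sq[OF assms(1,2)] in auto)
  then show ?thesis using tendsto_real_sqrt by fastforce
qed

section \<open>Completeness of L_2, Riesz representation and adjoints\<close>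

lemma L2_limit_of_fast_Cauchy:
  assumes f: "\<And>n. f n \<in> L2 M"
    and fast: "\<And>n k. n \<le> k \<Longrightarrow> (L2_norm M (\<lambda>x. f k x - f n x))\<^sup>2 \<le> (1/8) ^ n"
  shows "\<exists>g \<in> L2 M. \<forall>n. (L2_norm M (\<lambda>x. g x - f n x))\<^sup>2 \<le> (1/8) ^ n"
proof -
  define d where "d n x = f (Suc n) x - f n x" for n x
  have fm [measurable]: "f n \<in> borel_measurable M" for n using f by (simp add: L2_def)
  have dm [measurable]: "d n \<in> borel_measurable M" for n unfolding d_def[abs_def] by measurable
  have dL: "d n \<in> L2 M" for n unfolding d_def by (intro L2_diff f)
  \<comment> \<open>The squared increments have integral at most 8^-n, so weighting them with 4^n
    still leaves the summable bound 2^-n. The weighted sum S is therefore finite almost everywhere,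
    and where it is, the n-th increment is at most sqrt S * 2^-n, which gives pointwise
    convergence.\<close>
  have "(\<integral>\<^sup>+x. (\<Sum>n. ennreal (4^n * (cmod (d n x))\<^sup>2)) \<partial>M) = (\<Sum>n. \<integral>\<^sup>+x. ennreal (4^n * (cmod (d n x))\<^sup>2) \<partial>M)"
    by (rule nn_integral_suminf) measurable
  also have "\<dots> \<le> (\<Sum>n. ennreal ((1/2)^n))"
  proof (rule suminf_le)
    fix n
    have "(\<integral>\<^sup>+x. ennreal (4^n * (cmod (d n x))\<^sup>2) \<partial>M) = ennreal (\<integral>x. 4^n * (cmod (d n x))\<^sup>2 \<partial>M)"
      by (rule nn_integral_eq_integral) (use dL[of n] in \<open>auto simp: L2_def\<close>)
    also have "(\<integral>x. 4^n * (cmod (d n x))\<^sup>2 \<partial>M) = 4^n * (L2_norm M (d n))\<^sup>2"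
      by (simp add: L2_norm_sq)
    also have "ennreal \<dots> \<le> ennreal (4^n * (1/8)^n)"
      using fast[of n "Suc n"] by (intro ennreal_leI mult_left_mono) (auto simp: d_def[abs_def])
    also have "4^n * (1/8)^n = (1/2::real)^n" by (simp add: power_mult_distrib[symmetric])
    finally show "(\<integral>\<^sup>+x. ennreal (4^n * (cmod (d n x))\<^sup>2) \<partial>M) \<le> ennreal ((1/2)^n)" .
  qed auto
  also have "\<dots> = ennreal (\<Sum>n. (1/2)^n)" by (intro suminf_ennreal2) auto
  also have "\<dots> < \<infinity>" by simp
  finally have "AE x in M. (\<Sum>n. ennreal (4^n * (cmod (d n x))\<^sup>2)) \<noteq> \<infinity>"
    by (intro nn_integral_noteq_infinite) auto
  then have conv: "AE x in M. convergent (\<lambda>n. f n x)"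
  proof eventually_elim
    fix x assume fin: "(\<Sum>n. ennreal (4^n * (cmod (d n x))\<^sup>2)) \<noteq> \<infinity>"
    define S where "S = enn2real (\<Sum>n. ennreal (4^n * (cmod (d n x))\<^sup>2))"
    have S: "(\<Sum>n. ennreal (4^n * (cmod (d n x))\<^sup>2)) = ennreal S" "S \<ge> 0"
      using fin by (auto simp: S_def less_top)
    have "cmod (d n x) \<le> sqrt S * (1/2)^n" for n
    proof -
      have "ennreal (4^n * (cmod (d n x))\<^sup>2) \<le> ennreal S"
      proof -
        have "(\<Sum>n\<in>{n}. ennreal (4^n * (cmod (d n x))\<^sup>2)) \<le> (\<Sum>n. ennreal (4^n * (cmod (d n x))\<^sup>2))"
          by (rule sum_le_suminf) auto
        then show ?thesis unfolding S(1) sum.insert_remove[OF finite.emptyI] by simp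
      qed
      then have "4^n * (cmod (d n x))\<^sup>2 \<le> S" using S(2) by simp
      then have "sqrt (4^n * (cmod (d n x))\<^sup>2) \<le> sqrt S" by simp
      moreover have "sqrt (4^n * (cmod (d n x))\<^sup>2) = 2^n * cmod (d n x)"
        by (simp add: real_sqrt_mult real_sqrt_power)
      ultimately show ?thesis by (simp add: field_simps)
    qed
    then have "\<exists>N. \<forall>n\<ge>N. norm (d n x) \<le> sqrt S * (1/2)^n" by blast
    then have "summable (\<lambda>n. d n x)"
      by (rule summable_comparison_test) (intro summable_mult summable_geometric, simp)
    then have "convergent (\<lambda>n. \<Sum>k<n. d k x)" by (simp add: summable_iff_convergent)
    moreover have "(\<Sum>k<n. d k x) = f n x - f 0 x" for n
      unfolding d_def by (rule sum_lessThan_telescope)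
    ultimately have "convergent (\<lambda>n. f n x - f 0 x)" by simp
    then show "convergent (\<lambda>n. f n x)" by (simp add: convergent_diff_const_right_iff)
  qed
  define g where "g x = lim (\<lambda>n. f n x)" for x
  have gm [measurable]: "g \<in> borel_measurable M" unfolding g_def[abs_def] by measurable
  have lim: "AE x in M. (\<lambda>n. f n x) \<longlonglongrightarrow> g x"
    using conv by eventually_elim (simp add: g_def convergent_LIMSEQ_iff)
  \<comment> \<open>Fatou's lemma carries the rate from f k - f n over to g - f n.\<close>
  have le: "(\<integral>\<^sup>+x. ennreal ((cmod (g x - f n x))\<^sup>2) \<partial>M) \<le> ennreal ((1/8)^n)" for n
  proof -
    have "(\<integral>\<^sup>+x. ennreal ((cmod (g x - f n x))\<^sup>2) \<partial>M) = (\<integral>\<^sup>+x. liminf (\<lambda>k. ennreal ((cmod (f k x - f n x))\<^sup>2)) \<partial>M)"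
    proof (intro nn_integral_cong_AE, use lim in eventually_elim)
      fix x assume "(\<lambda>n. f n x) \<longlonglongrightarrow> g x"
      then have "(\<lambda>k. ennreal ((cmod (f k x - f n x))\<^sup>2)) \<longlonglongrightarrow> ennreal ((cmod (g x - f n x))\<^sup>2)"
        by (intro tendsto_intros)
      then show "ennreal ((cmod (g x - f n x))\<^sup>2) = liminf (\<lambda>k. ennreal ((cmod (f k x - f n x))\<^sup>2))"
        by (rule lim_imp_Liminf[OF trivial_limit_sequentially, symmetric])
    qed
    also have "\<dots> \<le> liminf (\<lambda>k. \<integral>\<^sup>+x. ennreal ((cmod (f k x - f n x))\<^sup>2) \<partial>M)"
      by (rule nn_integral_liminf) measurable
    also have "\<dots> \<le> ennreal ((1/8)^n)"
    proof (rule Liminf_le)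
      show "\<forall>\<^sub>F k in sequentially. (\<integral>\<^sup>+x. ennreal ((cmod (f k x - f n x))\<^sup>2) \<partial>M) \<le> ennreal ((1/8)^n)"
        using eventually_ge_at_top[of n]
      proof eventually_elim
        fix k assume "n \<le> k"
        have "(\<integral>\<^sup>+x. ennreal ((cmod (f k x - f n x))\<^sup>2) \<partial>M) = ennreal ((L2_norm M (\<lambda>x. f k x - f n x))\<^sup>2)"
          unfolding L2_norm_sq
          by (rule nn_integral_eq_integral) (use L2_diff[OF f f, of k n] in \<open>auto simp: L2_def\<close>)
        then show "(\<integral>\<^sup>+x. ennreal ((cmod (f k x - f n x))\<^sup>2) \<partial>M) \<le> ennreal ((1/8)^n)"
          using fast[OF \<open>n \<le> k\<close>] by (simp add: ennreal_leI)
      qed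
    qed simp
    finally show ?thesis .
  qed
  have diff: "(\<lambda>x. g x - f n x) \<in> L2 M" for n
  proof -
    have "integrable M (\<lambda>x. (cmod (g x - f n x))\<^sup>2)"
    proof (rule integrableI_bounded)
      show "(\<integral>\<^sup>+x. ennreal (norm ((cmod (g x - f n x))\<^sup>2)) \<partial>M) < \<infinity>"
        using le_less_trans[OF le[of n]] by simp
    qed measurable
    then show ?thesis by (simp add: L2_def)
  qed
  have "g \<in> L2 M" using L2_add[OF diff[of 0] f[of 0]] by simp
  moreover have "(L2_norm M (\<lambda>x. g x - f n x))\<^sup>2 \<le> (1/8) ^ n" for n
  proof -
    have "ennreal ((L2_norm M (\<lambda>x. g x - f n x))\<^sup>2) = (\<integral>\<^sup>+x. ennreal ((cmod (g x - f n x))\<^sup>2) \<partial>M)"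
      unfolding L2_norm_sq
      by (rule nn_integral_eq_integral[symmetric]) (use diff[of n] in \<open>auto simp: L2_def\<close>)
    then have "ennreal ((L2_norm M (\<lambda>x. g x - f n x))\<^sup>2) \<le> ennreal ((1/8)^n)" using le[of n] by simp
    then show ?thesis by (subst (asm) ennreal_le_iff) auto
  qed
  ultimately show ?thesis by blast
qed

(* The representing element minimises g \<mapsto> norm(g)^2 - 2 Re (l g). *)
lemma L2_Riesz:
  fixes l :: "('a \<Rightarrow> complex) \<Rightarrow> complex"
  assumes add: "\<And>f g. f \<in> L2 M \<Longrightarrow> g \<in> L2 M \<Longrightarrow> l (\<lambda>x. f x + g x) = l f + l g"
    and scale: "\<And>c f. f \<in> L2 M \<Longrightarrow> l (\<lambda>x. c * f x) = c * l f"
    and bdd: "\<And>f. f \<in> L2 M \<Longrightarrow> cmod (l f) \<le> C * L2_norm M f"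
  shows "\<exists>\<eta>\<in>L2 M. \<forall>f\<in>L2 M. l f = L2_inner M f \<eta>"
proof -
  define F where "F g = (L2_norm M g)\<^sup>2 - 2 * Re (l g)" for g
  define m where "m = Inf (F ` L2 M)"
  \<comment> \<open>The bound comes from completing the square in
    \<open>L2_norm M g - C\<close>.\<close>
  have lower: "- C\<^sup>2 \<le> F g" if "g \<in> L2 M" for g
  proof -
    have "Re (l g) \<le> C * L2_norm M g" using bdd[OF that] complex_Re_le_cmod order_trans by blast
    then show ?thesis
      using zero_le_power2[of "L2_norm M g - C"] by (simp add: F_def power2_eq_square algebra_simps)
  qed
  have bb: "bdd_below (F ` L2 M)" using lower by (intro bdd_belowI[of _ "- C\<^sup>2"]) auto
  have mF: "m \<le> F g" if "g \<in> L2 M" for g unfolding m_def using bb that by (intro cInf_lower) auto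
  \<comment> \<open>The slack 8^-n / 4 is what \<open>par\<close> below turns into squared distances
    of at most 8^-n, the rate of \<open>L2_limit_of_fast_Cauchy\<close>.\<close>
  have "\<exists>g\<in>L2 M. F g < m + (1/8)^n / 4" for n :: nat
  proof -
    have "Inf (F ` L2 M) < m + (1/8)^n / 4" by (simp add: m_def)
    then show ?thesis using cInf_lessD[of "F ` L2 M"] L2_zero[of M] by blast
  qed
  then obtain f where f: "\<And>n. f n \<in> L2 M" and Ff: "\<And>n. F (f n) < m + (1/8)^n / 4" by metis
  \<comment> \<open>At the midpoint of g and h the value of F is at least m; by the parallelogram
    law this forces two near-minimisers to be close to each other.\<close>
  have par: "(L2_norm M (\<lambda>x. g x - h x))\<^sup>2 \<le> 2 * (F g + F h - 2 * m)" if g: "g \<in> L2 M" and h: "h \<in> L2 M" for g h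
  proof -
    let ?w = "\<lambda>x. 1/2 * (g x + h x)"
    have w: "?w \<in> L2 M" by (intro L2_scale L2_add g h)
    have "m \<le> (L2_norm M (\<lambda>x. g x + h x))\<^sup>2 / 4 - Re (l g + l h)"
      using mF[OF w] unfolding F_def L2_norm_scale scale[OF L2_add[OF g h]] add[OF g h]
      by (simp add: power_mult_distrib power2_eq_square field_simps)
    moreover have "(L2_norm M (\<lambda>x. g x + h x))\<^sup>2 + (L2_norm M (\<lambda>x. g x - h x))\<^sup>2 = 2 * (L2_norm M g)\<^sup>2 + 2 * (L2_norm M h)\<^sup>2"
      using L2.Re_parallelogram[OF g h] by (simp add: L2_inner_self g h L2_add L2_diff)
    ultimately show ?thesis by (simp add: F_def)
  qed
  have "\<exists>\<eta>\<in>L2 M. \<forall>n. (L2_norm M (\<lambda>x. \<eta> x - f n x))\<^sup>2 \<le> (1/8) ^ n"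
  proof (rule L2_limit_of_fast_Cauchy[OF f])
    fix n k :: nat assume "n \<le> k"
    then have "(1/8::real)^k \<le> (1/8)^n" by (intro power_decreasing) auto
    then show "(L2_norm M (\<lambda>x. f k x - f n x))\<^sup>2 \<le> (1/8) ^ n"
      using par[OF f f, of k n] Ff[of n] Ff[of k] by argo
  qed
  then obtain \<eta> where \<eta>: "\<eta> \<in> L2 M" and lim: "\<And>n. (L2_norm M (\<lambda>x. \<eta> x - f n x))\<^sup>2 \<le> (1/8) ^ n" by blast
  have "(\<lambda>n. (L2_norm M (\<lambda>x. f n x - \<eta> x))\<^sup>2) \<longlonglongrightarrow> 0"
    by (rule tendsto_sandwich[of "\<lambda>_. 0" _ _ "\<lambda>n. (1/8)^n"]) (use lim L2_norm_minus_commute[of M \<eta>] in \<open>auto simp: LIMSEQ_power_zero\<close>)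
  then have lim0: "(\<lambda>n. L2_norm M (\<lambda>x. f n x - \<eta> x)) \<longlonglongrightarrow> 0"
    using tendsto_real_sqrt by fastforce
  \<comment> \<open>Expanding F (f n) around \<eta> shows that F \<eta> exceeds m by at most 8^-n /
    4 and terms linear in the distance \<open>e n\<close>.\<close>
  have "F \<eta> \<le> m"
  proof -
    define e where "e n = L2_norm M (\<lambda>x. f n x - \<eta> x)" for n
    have bnd: "F \<eta> \<le> m + (1/8)^n/4 + 4 * L2_norm M \<eta> * e n + 2 * C * e n" for n
    proof -
      let ?d = "\<lambda>x. f n x - \<eta> x"
      have d: "?d \<in> L2 M" by (intro L2_diff f \<eta>)
      have "L2_inner M (f n) (f n) = L2_inner M \<eta> \<eta> + L2_inner M \<eta> ?d + L2_inner M ?d \<eta> + L2_inner M ?d ?d"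
        using f[of n] \<eta> d by (simp add: L2.diff_left L2.diff_right)
      then have "Re (L2_inner M (f n) (f n)) = Re (L2_inner M \<eta> \<eta>) + 2 * Re (L2_inner M \<eta> ?d) + Re (L2_inner M ?d ?d)"
        using L2_inner_commute[of M ?d \<eta>] by simp
      then have "(L2_norm M (f n))\<^sup>2 = (L2_norm M \<eta>)\<^sup>2 + 2 * Re (L2_inner M \<eta> ?d) + (e n)\<^sup>2"
        using f[of n] \<eta> d by (simp add: L2_inner_self e_def)
      moreover have "Re (l (f n)) = Re (l \<eta>) + Re (l ?d)" using add[OF \<eta> d] by simp
      moreover have "\<bar>Re (L2_inner M \<eta> ?d)\<bar> \<le> 2 * (L2_norm M \<eta> * e n)"
        using L2_inner_bound[OF \<eta> d] abs_Re_le_cmod order_trans unfolding e_def by blast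
      moreover have "\<bar>Re (l ?d)\<bar> \<le> C * e n"
        using bdd[OF d] abs_Re_le_cmod order_trans unfolding e_def by blast
      ultimately show ?thesis
        using Ff[of n] zero_le_power2[of "e n"] unfolding F_def mult.assoc by argo
    qed
    have "(\<lambda>n. m + (1/8)^n/4 + 4 * L2_norm M \<eta> * e n + 2 * C * e n) \<longlonglongrightarrow> m + 0/4 + 4 * L2_norm M \<eta> * 0 + 2 * C * 0"
      using lim0 unfolding e_def by (intro tendsto_intros LIMSEQ_power_zero) auto
    then show ?thesis using bnd by (intro LIMSEQ_le_const) (auto)
  qed
  have Re_eq: "Re (l g) = Re (L2_inner M g \<eta>)" if g: "g \<in> L2 M" for g
  proof -
    define p where "p = Re (L2_inner M g \<eta>) - Re (l g)"
    \<comment> \<open>Minimality of F at \<eta> along the real line \<eta> + t g; the coefficient of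
      t has to vanish.\<close>
    have var: "0 \<le> 2 * t * p + t\<^sup>2 * (L2_norm M g)\<^sup>2" for t :: real
    proof -
      let ?g = "\<lambda>x. of_real t * g x"
      have tg: "?g \<in> L2 M" by (rule L2_scale[OF g])
      have "L2_inner M (\<lambda>x. \<eta> x + ?g x) (\<lambda>x. \<eta> x + ?g x) = L2_inner M \<eta> \<eta> + L2_inner M \<eta> ?g + L2_inner M ?g \<eta> + L2_inner M ?g ?g"
        using L2.add_left[OF \<eta> tg L2_add[OF \<eta> tg]] L2.add_right[OF \<eta> tg \<eta>] L2.add_right[OF \<eta> tg tg] by simp
      then have "Re (L2_inner M (\<lambda>x. \<eta> x + ?g x) (\<lambda>x. \<eta> x + ?g x)) = Re (L2_inner M \<eta> \<eta>) + 2 * Re (L2_inner M ?g \<eta>) + Re (L2_inner M ?g ?g)"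
        using L2_inner_commute[of M \<eta> ?g] by simp
      then have "(L2_norm M (\<lambda>x. \<eta> x + ?g x))\<^sup>2 = (L2_norm M \<eta>)\<^sup>2 + 2 * Re (L2_inner M ?g \<eta>) + (L2_norm M ?g)\<^sup>2"
        by (simp add: L2_inner_self \<eta> tg L2_add)
      then have "(L2_norm M (\<lambda>x. \<eta> x + ?g x))\<^sup>2 = (L2_norm M \<eta>)\<^sup>2 + 2 * t * Re (L2_inner M g \<eta>) + t\<^sup>2 * (L2_norm M g)\<^sup>2"
        unfolding L2.scale_left[OF g \<eta>] L2_norm_scale by (simp add: power_mult_distrib)
      moreover have "l (\<lambda>x. \<eta> x + ?g x) = l \<eta> + t * l g"
        by (simp add: add[OF \<eta> tg] scale[OF g])
      moreover have "F \<eta> \<le> F (\<lambda>x. \<eta> x + ?g x)" using \<open>F \<eta> \<le> m\<close> mF[OF L2_add[OF \<eta> tg]] by simp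
      ultimately show ?thesis by (simp add: F_def p_def algebra_simps)
    qed
    have "p = 0"
    proof (rule ccontr)
      assume "p \<noteq> 0"
      \<comment> \<open>Adding 1 keeps the divisor positive when g has norm 0; the quadratic is then
        negative at t = - p / s.\<close>
      define s where "s = (L2_norm M g)\<^sup>2 + 1"
      have s: "s \<ge> 1" by (simp add: s_def)
      have "2 * (- p / s) * p + (- p / s)\<^sup>2 * (s - 1) = - (p\<^sup>2 / s) - p\<^sup>2 / s\<^sup>2"
        using s by (simp add: field_simps power2_eq_square)
      moreover have "p\<^sup>2 / s > 0" "p\<^sup>2 / s\<^sup>2 > 0" using s \<open>p \<noteq> 0\<close> by auto
      ultimately show False using var[of "- p / s"] by (simp add: s_def)
    qed
    then show ?thesis by (simp add: p_def)
  qed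
  have "l g = L2_inner M g \<eta>" if g: "g \<in> L2 M" for g
  proof (rule complex_eqI)
    show "Re (l g) = Re (L2_inner M g \<eta>)" by (rule Re_eq[OF g])
    \<comment> \<open>The real part at - i g is the imaginary part at g.\<close>
    show "Im (l g) = Im (L2_inner M g \<eta>)"
      using Re_eq[OF L2_scale[OF g, of "- \<i>"]] unfolding scale[OF g] L2.scale_left[OF g \<eta>] by simp
  qed
  then show ?thesis using \<eta> by blast
qed

text \<open>The choice in \<open>L2_adjoint\<close> is justified by Riesz representation of the
  functional f \<mapsto> (B f, \<psi>). Although B is linear only up to null sets, this functional
  is linear exactly, since integrals do not see null sets.\<close>

lemma L2_adjoint:
  assumes B: "bounded_operator_L2 M B" and \<psi>: "\<psi> \<in> L2 M"
  shows "L2_adjoint M B \<psi> \<in> L2 M"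
    and "\<phi> \<in> L2 M \<Longrightarrow> L2_inner M (B \<phi>) \<psi> = L2_inner M \<phi> (L2_adjoint M B \<psi>)"
proof -
  have BL: "B f \<in> L2 M" if "f \<in> L2 M" for f using B that by (simp add: bounded_operator_L2_def)
  have m: "f \<in> borel_measurable M" if "f \<in> L2 M" for f using that by (rule L2_D)
  obtain C where C: "\<And>f. f \<in> L2 M \<Longrightarrow> L2_norm M (B f) \<le> C * L2_norm M f"
    using B unfolding bounded_operator_L2_def by blast
  have "\<exists>\<eta>\<in>L2 M. \<forall>f\<in>L2 M. L2_inner M (B f) \<psi> = L2_inner M f \<eta>"
  proof (rule L2_Riesz)
    fix f g c assume f: "f \<in> L2 M"
    have "L2_inner M (B (\<lambda>x. c * f x)) \<psi> = L2_inner M (\<lambda>x. c * B f x) \<psi>"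
      by (rule L2_inner_cong) (use B f \<psi> in \<open>auto simp: bounded_operator_L2_def intro: m BL L2_scale\<close>)
    then show "L2_inner M (B (\<lambda>x. c * f x)) \<psi> = c * L2_inner M (B f) \<psi>"
      by (simp add: L2.scale_left BL f \<psi>)
    assume g: "g \<in> L2 M"
    have "L2_inner M (B (\<lambda>x. f x + g x)) \<psi> = L2_inner M (\<lambda>x. B f x + B g x) \<psi>"
      by (rule L2_inner_cong) (use B f g \<psi> in \<open>auto simp: bounded_operator_L2_def intro: m BL L2_add\<close>)
    then show "L2_inner M (B (\<lambda>x. f x + g x)) \<psi> = L2_inner M (B f) \<psi> + L2_inner M (B g) \<psi>"
      by (simp add: L2.add_left BL f g \<psi>)
  next
    fix f assume f: "f \<in> L2 M"
    have "cmod (L2_inner M (B f) \<psi>) \<le> 2 * (L2_norm M (B f) * L2_norm M \<psi>)"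
      by (intro L2_inner_bound BL f \<psi>)
    also have "\<dots> \<le> 2 * ((C * L2_norm M f) * L2_norm M \<psi>)"
      by (intro mult_left_mono mult_right_mono C f) auto
    finally show "cmod (L2_inner M (B f) \<psi>) \<le> (2 * C * L2_norm M \<psi>) * L2_norm M f"
      by (simp add: mult_ac)
  qed
  then obtain \<eta> where "\<eta> \<in> L2 M \<and> (\<forall>f\<in>L2 M. L2_inner M (B f) \<psi> = L2_inner M f \<eta>)" by blast
  then have "L2_adjoint M B \<psi> \<in> L2 M \<and> (\<forall>\<phi>\<in>L2 M. L2_inner M (B \<phi>) \<psi> = L2_inner M \<phi> (L2_adjoint M B \<psi>))"
    unfolding L2_adjoint_def
    by (rule someI[where P="\<lambda>\<eta>. \<eta> \<in> L2 M \<and> (\<forall>f\<in>L2 M. L2_inner M (B f) \<psi> = L2_inner M f \<eta>)"])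
  then show "L2_adjoint M B \<psi> \<in> L2 M"
    and "\<phi> \<in> L2 M \<Longrightarrow> L2_inner M (B \<phi>) \<psi> = L2_inner M \<phi> (L2_adjoint M B \<psi>)" by auto
qed

section \<open>Closures of sectorial forms\<close>

locale closable_sectorial_form = sectorial_form D b C
  for D :: "('a \<Rightarrow> complex) set" and b :: "'a form" and C :: real +
  fixes M :: "'a measure"
  assumes D_L2: "D \<subseteq> L2 M"
    and closable: "closable_form M D b"
begin

lemma D_L2D: "u \<in> D \<Longrightarrow> u \<in> L2 M" using D_L2 by blast

lemma form_norm_sq: "u \<in> D \<Longrightarrow> (form_norm M b u)\<^sup>2 = Re (b u u) + (L2_norm M u)\<^sup>2"
  unfolding form_norm_def using Re_nonneg[of u] by simp

lemma form_norm_nonneg: "u \<in> D \<Longrightarrow> 0 \<le> form_norm M b u"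
  unfolding form_norm_def using Re_nonneg[of u] by simp

lemma sqrt_Re_le_form_norm: "sqrt (Re (b u u)) \<le> form_norm M b u"
  unfolding form_norm_def by simp

lemma form_norm_add_sq:
  assumes "u \<in> D" "v \<in> D"
  shows "(form_norm M b (\<lambda>x. u x + v x))\<^sup>2 \<le> 2 * (form_norm M b u)\<^sup>2 + 2 * (form_norm M b v)\<^sup>2"
  using Re_add_le[OF assms] L2_norm_add_sq[OF assms[THEN D_L2D]] assms
  by (simp add: form_norm_sq add_mem)

text \<open>The factors 2 in \<open>form_norm_add_sq\<close> cost nothing here: 2 (e/2)^2 + 2
  (e/2)^2 = e^2.\<close>

lemma form_norm_add_less:
  assumes "u \<in> D" "v \<in> D" "form_norm M b u < e / 2" "form_norm M b v < e / 2"
  shows "form_norm M b (\<lambda>x. u x + v x) < e"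
proof -
  have "(form_norm M b u)\<^sup>2 < (e/2)\<^sup>2" "(form_norm M b v)\<^sup>2 < (e/2)\<^sup>2"
    using assms form_norm_nonneg by (auto intro!: power_strict_mono)
  then have "(form_norm M b (\<lambda>x. u x + v x))\<^sup>2 < e\<^sup>2"
    using form_norm_add_sq[OF assms(1,2)] by (simp add: power_divide)
  moreover have "0 \<le> e" using form_norm_nonneg[OF assms(1)] assms(3) by simp
  ultimately show ?thesis by (rule power_less_imp_less_base)
qed

lemma form_norm_scale:
  assumes "u \<in> D" shows "form_norm M b (\<lambda>x. c * u x) = cmod c * form_norm M b u"
proof -
  have "Re (b (\<lambda>x. c * u x) (\<lambda>x. c * u x)) = (cmod c)\<^sup>2 * Re (b u u)"
    unfolding scale_left[OF assms scale_mem[OF assms]] scale_right[OF assms assms] mult.assoc[symmetric]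
      complex_norm_square[symmetric] by simp
  then show ?thesis
    unfolding form_norm_def L2_norm_scale
    by (simp add: power_mult_distrib distrib_left[symmetric] real_sqrt_mult)
qed

lemma form_Cauchy_mem: "form_Cauchy M D b U \<Longrightarrow> U n \<in> D"
  by (simp add: form_Cauchy_def)

lemma form_Cauchy_const: "u \<in> D \<Longrightarrow> form_Cauchy M D b (\<lambda>n. u)"
  using zero_left[OF zero_mem] by (simp add: form_Cauchy_def form_norm_def)

lemma form_Cauchy_add:
  assumes U: "form_Cauchy M D b U" and V: "form_Cauchy M D b V"
  shows "form_Cauchy M D b (\<lambda>n x. U n x + V n x)"
  unfolding form_Cauchy_def
proof (intro conjI allI impI)
  show "(\<lambda>x. U n x + V n x) \<in> D" for n by (intro add_mem form_Cauchy_mem[OF U] form_Cauchy_mem[OF V])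
  fix e :: real assume "e > 0"
  then have e: "e / 2 > 0" by simp
  obtain N1 where N1: "\<And>m n. m \<ge> N1 \<Longrightarrow> n \<ge> N1 \<Longrightarrow> form_norm M b (\<lambda>x. U m x - U n x) < e / 2"
    using U e unfolding form_Cauchy_def by meson
  obtain N2 where N2: "\<And>m n. m \<ge> N2 \<Longrightarrow> n \<ge> N2 \<Longrightarrow> form_norm M b (\<lambda>x. V m x - V n x) < e / 2"
    using V e unfolding form_Cauchy_def by meson
  have "form_norm M b (\<lambda>x. (U m x + V m x) - (U n x + V n x)) < e" if "m \<ge> max N1 N2" "n \<ge> max N1 N2" for m n
  proof -
    have "form_norm M b (\<lambda>x. (U m x - U n x) + (V m x - V n x)) < e"
      using that by (intro form_norm_add_less diff_mem form_Cauchy_mem[OF U] form_Cauchy_mem[OF V] N1 N2) auto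
    then show ?thesis by (simp add: algebra_simps)
  qed
  then show "\<exists>N. \<forall>m\<ge>N. \<forall>n\<ge>N. form_norm M b (\<lambda>x. (U m x + V m x) - (U n x + V n x)) < e" by blast
qed

lemma form_Cauchy_scale:
  assumes U: "form_Cauchy M D b U"
  shows "form_Cauchy M D b (\<lambda>n x. c * U n x)"
  unfolding form_Cauchy_def
proof (intro conjI allI impI)
  show "(\<lambda>x. c * U n x) \<in> D" for n by (intro scale_mem form_Cauchy_mem[OF U])
  fix e :: real assume e: "e > 0"
  \<comment> \<open>Since c may be 0, the tolerance is divided by |c| + 1 rather than by
    |c|.\<close>
  have pos: "cmod c + 1 > 0" by (rule add_nonneg_pos) auto
  then obtain N where N: "\<And>m n. m \<ge> N \<Longrightarrow> n \<ge> N \<Longrightarrow> form_norm M b (\<lambda>x. U m x - U n x) < e / (cmod c + 1)"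
    using U e unfolding form_Cauchy_def by (meson divide_pos_pos)
  have "form_norm M b (\<lambda>x. c * U m x - c * U n x) < e" if "m \<ge> N" "n \<ge> N" for m n
  proof -
    have d: "(\<lambda>x. U m x - U n x) \<in> D" by (intro diff_mem form_Cauchy_mem[OF U])
    have "form_norm M b (\<lambda>x. c * U m x - c * U n x) = cmod c * form_norm M b (\<lambda>x. U m x - U n x)"
      using form_norm_scale[OF d, of c] by (simp add: right_diff_distrib)
    also have "\<dots> \<le> (cmod c + 1) * form_norm M b (\<lambda>x. U m x - U n x)"
      by (intro mult_right_mono form_norm_nonneg[OF d]) auto
    also have "\<dots> < e" using N[OF that] pos by (simp add: pos_less_divide_eq mult.commute)
    finally show ?thesis .
  qed
  then show "\<exists>N. \<forall>m\<ge>N. \<forall>n\<ge>N. form_norm M b (\<lambda>x. c * U m x - c * U n x) < e" by blast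
qed

lemma form_approx_const: "u \<in> D \<Longrightarrow> form_approx M D b (\<lambda>n. u) u"
  by (simp add: form_approx_def form_Cauchy_const)

lemma form_approx_mem: "form_approx M D b U u \<Longrightarrow> U n \<in> D"
  by (simp add: form_approx_def form_Cauchy_mem)

lemma form_approx_add:
  assumes U: "form_approx M D b U u" and V: "form_approx M D b V v" and "u \<in> L2 M" "v \<in> L2 M"
  shows "form_approx M D b (\<lambda>n x. U n x + V n x) (\<lambda>x. u x + v x)"
proof -
  have "(\<lambda>n. L2_norm M (\<lambda>x. (U n x - u x) - (v x - V n x))) \<longlonglongrightarrow> 0"
    using U V D_L2D[OF form_approx_mem[OF U]] D_L2D[OF form_approx_mem[OF V]] L2_norm_minus_commute[of M v]
    by (intro tendsto_L2_norm_diff[where U = "\<lambda>n x. U n x - u x" and V = "\<lambda>n x. v x - V n x"])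
      (simp_all add: form_approx_def L2_diff assms(3,4))
  then show ?thesis
    using U V form_Cauchy_add by (simp add: form_approx_def algebra_simps)
qed

lemma form_approx_scale:
  assumes U: "form_approx M D b U u"
  shows "form_approx M D b (\<lambda>n x. c * U n x) (\<lambda>x. c * u x)"
proof -
  have "(\<lambda>n. L2_norm M (\<lambda>x. c * (U n x - u x))) \<longlonglongrightarrow> cmod c * 0"
    unfolding L2_norm_scale using U by (intro tendsto_intros) (simp add: form_approx_def)
  then show ?thesis
    using U form_Cauchy_scale by (simp add: form_approx_def algebra_simps)
qed

lemma form_approx_diff:
  assumes U: "form_approx M D b U u" and V: "form_approx M D b V v" and "u \<in> L2 M" "v \<in> L2 M"
  shows "form_approx M D b (\<lambda>n x. U n x - V n x) (\<lambda>x. u x - v x)"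
  using form_approx_add[OF U form_approx_scale[OF V, of "-1"] assms(3) L2_scale[OF assms(4)]] by simp

text \<open>From some N on, all members lie within form distance 1 of U N, so
  \<open>Re_add_le\<close> bounds their diagonal values by 2 plus twice that of U N. The sum in K
  covers the finitely many earlier members.\<close>

lemma form_Cauchy_bounded:
  assumes U: "form_Cauchy M D b U"
  shows "\<exists>K>0. \<forall>n. sqrt (Re (b (U n) (U n))) \<le> K"
proof -
  note mem = form_Cauchy_mem[OF U]
  obtain N where N: "\<And>m n. m \<ge> N \<Longrightarrow> n \<ge> N \<Longrightarrow> form_norm M b (\<lambda>x. U m x - U n x) < 1"
    using U unfolding form_Cauchy_def by (meson zero_less_one)
  define K where "K = 2 + 2 * (\<Sum>i\<le>N. Re (b (U i) (U i)))"
  have part: "Re (b (U i) (U i)) \<le> (\<Sum>i\<le>N. Re (b (U i) (U i)))" if "i \<le> N" for i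
    using that by (intro member_le_sum) (auto intro: Re_nonneg mem)
  have nn: "0 \<le> (\<Sum>i\<le>N. Re (b (U i) (U i)))" by (intro sum_nonneg Re_nonneg mem)
  have "Re (b (U n) (U n)) \<le> K" for n
  proof (cases "n \<le> N")
    case True then show ?thesis using part[OF True] nn by (simp add: K_def)
  next
    case False
    have d: "(\<lambda>x. U n x - U N x) \<in> D" by (intro diff_mem mem)
    have "form_norm M b (\<lambda>x. U n x - U N x) < 1" using False by (intro N) auto
    then have "sqrt (Re (b (\<lambda>x. U n x - U N x) (\<lambda>x. U n x - U N x))) < 1"
      using sqrt_Re_le_form_norm le_less_trans by blast
    then have "Re (b (\<lambda>x. U n x - U N x) (\<lambda>x. U n x - U N x)) < 1" by simp
    then show ?thesis using Re_add_le[OF d mem[of N]] part[of N] by (simp add: K_def)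
  qed
  then have "sqrt (Re (b (U n) (U n))) \<le> sqrt K" for n by simp
  moreover have "sqrt K > 0" using nn by (simp add: K_def)
  ultimately show ?thesis by blast
qed

text \<open>The difference of two values splits as b (U m - U n) (V m) + b (U n) (V m - V n). In
  each term one argument is small by the Cauchy property and the other is form-bounded, so
  \<open>bound\<close> applies.\<close>

lemma form_Cauchy_convergent:
  assumes U: "form_Cauchy M D b U" and V: "form_Cauchy M D b V"
  shows "convergent (\<lambda>n. b (U n) (V n))"
proof -
  note memU = form_Cauchy_mem[OF U] and memV = form_Cauchy_mem[OF V]
  let ?q = "\<lambda>u. sqrt (Re (b u u))"
  obtain K where K: "K > 0" "\<And>n. ?q (U n) \<le> K" using form_Cauchy_bounded[OF U] by blast
  obtain L where L: "L > 0" "\<And>n. ?q (V n) \<le> L" using form_Cauchy_bounded[OF V] by blast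
  have "Cauchy (\<lambda>n. b (U n) (V n))"
  proof (rule metric_CauchyI)
    fix e :: real assume e: "e > 0"
    define d where "d = e / (2 * C * (K + L))"
    have d: "d > 0" using e K L C_pos by (simp add: d_def)
    obtain N1 where N1: "\<And>m n. m \<ge> N1 \<Longrightarrow> n \<ge> N1 \<Longrightarrow> form_norm M b (\<lambda>x. U m x - U n x) < d"
      using U d unfolding form_Cauchy_def by meson
    obtain N2 where N2: "\<And>m n. m \<ge> N2 \<Longrightarrow> n \<ge> N2 \<Longrightarrow> form_norm M b (\<lambda>x. V m x - V n x) < d"
      using V d unfolding form_Cauchy_def by meson
    have "dist (b (U m) (V m)) (b (U n) (V n)) < e" if mn: "m \<ge> max N1 N2" "n \<ge> max N1 N2" for m n
    proof -
      let ?u = "\<lambda>x. U m x - U n x" and ?v = "\<lambda>x. V m x - V n x"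
      have D: "?u \<in> D" "?v \<in> D" by (intro diff_mem memU memV)+
      have qu: "?q ?u < d" using N1[of m n] sqrt_Re_le_form_norm[of ?u] mn by linarith
      have qv: "?q ?v < d" using N2[of m n] sqrt_Re_le_form_norm[of ?v] mn by linarith
      have "b (U m) (V m) - b (U n) (V n) = b ?u (V m) + b (U n) ?v"
        by (simp add: diff_left diff_right memU memV)
      then have "dist (b (U m) (V m)) (b (U n) (V n)) \<le> cmod (b ?u (V m)) + cmod (b (U n) ?v)"
        by (metis dist_norm norm_triangle_ineq)
      also have "\<dots> \<le> 2 * C * (?q ?u * ?q (V m)) + 2 * C * (?q (U n) * ?q ?v)"
        by (intro add_mono bound D memU memV)
      also have "\<dots> \<le> 2 * C * (?q ?u * L) + 2 * C * (K * ?q ?v)"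
        using C_pos K L D by (intro add_mono mult_left_mono mult_right_mono) (auto intro: Re_nonneg)
      also have "\<dots> < 2 * C * (d * L) + 2 * C * (K * d)"
        using C_pos K L qu qv by (intro add_strict_mono mult_strict_left_mono mult_strict_right_mono) auto
      also have "\<dots> = d * (2 * C * (K + L))" by (simp add: algebra_simps)
      also have "\<dots> = e" using C_pos K(1) L(1) by (simp add: d_def)
      finally show ?thesis .
    qed
    then show "\<exists>N. \<forall>m\<ge>N. \<forall>n\<ge>N. dist (b (U m) (V m)) (b (U n) (V n)) < e" by blast
  qed
  then show ?thesis by (simp add: Cauchy_convergent_iff)
qed

lemma tendsto_zero_left:
  assumes W: "\<And>n. W n \<in> D" and V: "form_Cauchy M D b V" and lim: "(\<lambda>n. b (W n) (W n)) \<longlonglongrightarrow> 0"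
  shows "(\<lambda>n. b (W n) (V n)) \<longlonglongrightarrow> 0" and "(\<lambda>n. b (V n) (W n)) \<longlonglongrightarrow> 0"
proof -
  note memV = form_Cauchy_mem[OF V]
  let ?q = "\<lambda>u. sqrt (Re (b u u))"
  obtain L where L: "L > 0" "\<And>n. ?q (V n) \<le> L" using form_Cauchy_bounded[OF V] by blast
  have "(\<lambda>n. 2 * C * (?q (W n) * L)) \<longlonglongrightarrow> 2 * C * (sqrt (Re 0) * L)"
    by (intro tendsto_intros lim)
  then have l: "(\<lambda>n. 2 * C * (?q (W n) * L)) \<longlonglongrightarrow> 0" by simp
  show "(\<lambda>n. b (W n) (V n)) \<longlonglongrightarrow> 0"
  proof (rule Lim_null_comparison[OF _ l], intro always_eventually allI)
    fix n show "cmod (b (W n) (V n)) \<le> 2 * C * (?q (W n) * L)"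
      using C_pos L by (intro order_trans[OF bound[OF W memV]] mult_left_mono) (auto intro: Re_nonneg W)
  qed
  show "(\<lambda>n. b (V n) (W n)) \<longlonglongrightarrow> 0"
  proof (rule Lim_null_comparison[OF _ l], intro always_eventually allI)
    fix n show "cmod (b (V n) (W n)) \<le> 2 * C * (?q (W n) * L)"
      using C_pos L mult_right_mono[OF L(2)[of n], of "?q (W n)"] Re_nonneg[OF W[of n]]
      by (intro order_trans[OF bound[OF memV W]] mult_left_mono) (auto simp: mult.commute)
  qed
qed

text \<open>The place where closability enters: the difference of two approximating sequences of the
  same u is a form-Cauchy sequence that tends to 0 in L_2.\<close>

lemma form_approx_diff_null:
  assumes U: "form_approx M D b U u" and V: "form_approx M D b V u" and u: "u \<in> L2 M"
  shows "(\<lambda>n. b (\<lambda>x. U n x - V n x) (\<lambda>x. U n x - V n x)) \<longlonglongrightarrow> 0"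
  using form_approx_diff[OF U V u u] closable unfolding form_approx_def closable_form_def by simp

lemma closure_dom_L2: "u \<in> closure_dom M D b \<Longrightarrow> u \<in> L2 M"
  by (simp add: closure_dom_def)

text \<open>\<open>closure_form\<close> is a definite description, so a limit has to exist and be
  common to all approximating sequences. Existence is \<open>form_Cauchy_convergent\<close>; for
  independence U and V are replaced one at a time, and \<open>form_approx_diff_null\<close> makes
  both errors vanish in the limit.\<close>

lemma closure_form_tendsto:
  assumes U: "form_approx M D b U u" and V: "form_approx M D b V v" and u: "u \<in> L2 M" and v: "v \<in> L2 M"
  shows "(\<lambda>n. b (U n) (V n)) \<longlonglongrightarrow> closure_form M D b u v"
proof -
  have CU: "form_Cauchy M D b U" and CV: "form_Cauchy M D b V" using U V by (simp_all add: form_approx_def)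
  obtain c where c: "(\<lambda>n. b (U n) (V n)) \<longlonglongrightarrow> c"
    using form_Cauchy_convergent[OF CU CV] by (auto simp: convergent_def)
  have lim: "(\<lambda>n. b (U' n) (V' n)) \<longlonglongrightarrow> c" if U': "form_approx M D b U' u" and V': "form_approx M D b V' v" for U' V'
  proof -
    have C': "form_Cauchy M D b U'" "form_Cauchy M D b V'" using U' V' by (simp_all add: form_approx_def)
    have D: "(\<lambda>x. U n x - U' n x) \<in> D" "(\<lambda>x. V n x - V' n x) \<in> D" for n
      by (intro diff_mem form_approx_mem[OF U] form_approx_mem[OF V] form_approx_mem[OF U'] form_approx_mem[OF V'])+
    have "(\<lambda>n. b (U n) (V n) - b (\<lambda>x. U n x - U' n x) (V n) - b (U' n) (\<lambda>x. V n x - V' n x)) \<longlonglongrightarrow> c - 0 - 0"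
      by (intro tendsto_diff c tendsto_zero_left(1)[OF D(1) CV] tendsto_zero_left(2)[OF D(2) C'(1)]
        form_approx_diff_null[OF U U' u] form_approx_diff_null[OF V V' v])
    then show ?thesis
      by (simp add: diff_left diff_right form_approx_mem[OF U] form_approx_mem[OF V] form_approx_mem[OF U'] form_approx_mem[OF V'])
  qed
  have "closure_form M D b u v = c"
    unfolding closure_form_def
  proof (rule the_equality)
    fix c' assume "\<forall>U V. form_approx M D b U u \<and> form_approx M D b V v \<longrightarrow> (\<lambda>n. b (U n) (V n)) \<longlonglongrightarrow> c'"
    then have "(\<lambda>n. b (U n) (V n)) \<longlonglongrightarrow> c'" using U V by blast
    then show "c' = c" using c LIMSEQ_unique by blast
  qed (use lim in blast)
  then show ?thesis using c by simp
qed

lemma closure_domE: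
  assumes "u \<in> closure_dom M D b"
  obtains U where "form_approx M D b U u" "u \<in> L2 M"
  using assms by (auto simp: closure_dom_def)

lemma subset_closure_dom: "D \<subseteq> closure_dom M D b"
  using D_L2 form_approx_const by (auto simp: closure_dom_def)

text \<open>All identities, and the sectorial inequality with the same C, survive the limit along
  approximating sequences.\<close>

lemma closure_sectorial: "sectorial_form (closure_dom M D b) (closure_form M D b) C"
proof
  show "C > 0" by (rule C_pos)
  show "(\<lambda>x. 0) \<in> closure_dom M D b" using subset_closure_dom zero_mem by blast
next
  fix u v assume u: "u \<in> closure_dom M D b" and v: "v \<in> closure_dom M D b"
  then show "(\<lambda>x. u x + v x) \<in> closure_dom M D b"
    unfolding closure_dom_def using form_approx_add L2_add by blast
next
  fix u c assume u: "u \<in> closure_dom M D b"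
  then show "(\<lambda>x. c * u x) \<in> closure_dom M D b"
    unfolding closure_dom_def using form_approx_scale L2_scale by blast
  obtain U where U: "form_approx M D b U u" "u \<in> L2 M" using u closure_domE by blast
  have l: "(\<lambda>n. b (U n) (U n)) \<longlonglongrightarrow> closure_form M D b u u" by (rule closure_form_tendsto[OF U(1,1,2,2)])
  show "cmod (closure_form M D b u u) \<le> C * Re (closure_form M D b u u)"
    by (rule LIMSEQ_le[OF tendsto_norm[OF l] tendsto_mult_left[OF tendsto_Re[OF l]]])
      (use sectorial[OF form_approx_mem[OF U(1)]] in blast)
next
  fix u w c assume u: "u \<in> closure_dom M D b" and w: "w \<in> closure_dom M D b"
  obtain U where U: "form_approx M D b U u" "u \<in> L2 M" using u closure_domE by blast
  obtain W where W: "form_approx M D b W w" "w \<in> L2 M" using w closure_domE by blast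
  have "(\<lambda>n. b (\<lambda>x. c * U n x) (W n)) \<longlonglongrightarrow> closure_form M D b (\<lambda>x. c * u x) w"
    by (rule closure_form_tendsto[OF form_approx_scale[OF U(1)] W(1) L2_scale[OF U(2)] W(2)])
  moreover have "(\<lambda>n. b (\<lambda>x. c * U n x) (W n)) \<longlonglongrightarrow> c * closure_form M D b u w"
    unfolding scale_left[OF form_approx_mem[OF U(1)] form_approx_mem[OF W(1)]]
    by (intro tendsto_intros closure_form_tendsto U W)
  ultimately show "closure_form M D b (\<lambda>x. c * u x) w = c * closure_form M D b u w"
    using LIMSEQ_unique by blast
  have "(\<lambda>n. b (W n) (\<lambda>x. c * U n x)) \<longlonglongrightarrow> closure_form M D b w (\<lambda>x. c * u x)"
    by (rule closure_form_tendsto[OF W(1) form_approx_scale[OF U(1)] W(2) L2_scale[OF U(2)]])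
  moreover have "(\<lambda>n. b (W n) (\<lambda>x. c * U n x)) \<longlonglongrightarrow> cnj c * closure_form M D b w u"
    unfolding scale_right[OF form_approx_mem[OF U(1)] form_approx_mem[OF W(1)]]
    by (intro tendsto_intros closure_form_tendsto U W)
  ultimately show "closure_form M D b w (\<lambda>x. c * u x) = cnj c * closure_form M D b w u"
    using LIMSEQ_unique by blast
next
  fix u v w assume u: "u \<in> closure_dom M D b" and v: "v \<in> closure_dom M D b" and w: "w \<in> closure_dom M D b"
  obtain U where U: "form_approx M D b U u" "u \<in> L2 M" using u closure_domE by blast
  obtain V where V: "form_approx M D b V v" "v \<in> L2 M" using v closure_domE by blast
  obtain W where W: "form_approx M D b W w" "w \<in> L2 M" using w closure_domE by blast
  have "(\<lambda>n. b (\<lambda>x. U n x + V n x) (W n)) \<longlonglongrightarrow> closure_form M D b (\<lambda>x. u x + v x) w"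
    by (rule closure_form_tendsto[OF form_approx_add[OF U(1) V(1) U(2) V(2)] W(1) L2_add[OF U(2) V(2)] W(2)])
  moreover have "(\<lambda>n. b (\<lambda>x. U n x + V n x) (W n)) \<longlonglongrightarrow> closure_form M D b u w + closure_form M D b v w"
    unfolding add_left[OF form_approx_mem[OF U(1)] form_approx_mem[OF V(1)] form_approx_mem[OF W(1)]]
    by (intro tendsto_intros closure_form_tendsto U V W)
  ultimately show "closure_form M D b (\<lambda>x. u x + v x) w = closure_form M D b u w + closure_form M D b v w"
    using LIMSEQ_unique by blast
  have "(\<lambda>n. b (W n) (\<lambda>x. U n x + V n x)) \<longlonglongrightarrow> closure_form M D b w (\<lambda>x. u x + v x)"
    by (rule closure_form_tendsto[OF W(1) form_approx_add[OF U(1) V(1) U(2) V(2)] W(2) L2_add[OF U(2) V(2)]])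
  moreover have "(\<lambda>n. b (W n) (\<lambda>x. U n x + V n x)) \<longlonglongrightarrow> closure_form M D b w u + closure_form M D b w v"
    unfolding add_right[OF form_approx_mem[OF U(1)] form_approx_mem[OF V(1)] form_approx_mem[OF W(1)]]
    by (intro tendsto_intros closure_form_tendsto U V W)
  ultimately show "closure_form M D b w (\<lambda>x. u x + v x) = closure_form M D b w u + closure_form M D b w v"
    using LIMSEQ_unique by blast
qed

text \<open>The closure respects equality almost everywhere because u enters the approximation only
  through an L_2 distance; the same sequence serves both representatives.\<close>

lemma form_approx_cong:
  assumes U: "form_approx M D b U u" and "u \<in> L2 M" "u' \<in> L2 M" and ae: "AE x in M. u x = u' x"
  shows "form_approx M D b U u'"
proof -
  have "L2_norm M (\<lambda>x. U n x - u x) = L2_norm M (\<lambda>x. U n x - u' x)" for n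
    using ae D_L2D[OF form_approx_mem[OF U]] assms(2,3)
    by (intro L2_norm_cong) (auto intro: L2_D L2_diff elim: eventually_mono)
  then show ?thesis using U by (simp add: form_approx_def)
qed

lemma closure_dom_cong:
  assumes "u \<in> closure_dom M D b" "u' \<in> L2 M" "AE x in M. u x = u' x"
  shows "u' \<in> closure_dom M D b"
  using assms form_approx_cong unfolding closure_dom_def by blast

lemma closure_form_cong:
  assumes u: "u \<in> closure_dom M D b" and v: "v \<in> closure_dom M D b"
    and u': "u' \<in> L2 M" "AE x in M. u x = u' x" and v': "v' \<in> L2 M" "AE x in M. v x = v' x"
  shows "closure_form M D b u v = closure_form M D b u' v'"
proof -
  obtain U where U: "form_approx M D b U u" "u \<in> L2 M" using u closure_domE by blast
  obtain V where V: "form_approx M D b V v" "v \<in> L2 M" using v closure_domE by blast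
  show ?thesis
    using closure_form_tendsto[OF U(1) V(1) U(2) V(2)] LIMSEQ_unique
      closure_form_tendsto[OF form_approx_cong[OF U u'] form_approx_cong[OF V v'] u'(1) v'(1)]
    by blast
qed

end

section \<open>Test functions and weak derivatives\<close>

(* The family is closed under differentiation up to linear combinations, which gives smoothness
   by induction on the order. *)
definition flat :: "nat \<Rightarrow> real \<Rightarrow> real" where
  "flat m t = (if t > 0 then exp (- inverse t) * inverse t ^ m else 0)"

lemma flat_pos: "t > 0 \<Longrightarrow> flat m t > 0" and flat_nonneg: "flat m t \<ge> 0" and flat_eq_0: "t \<le> 0 \<Longrightarrow> flat m t = 0"
  by (auto simp: flat_def)

text \<open>Substituting u = 1/t turns the limit from the right into the limit of u^m / exp u at
  infinity.\<close>

lemma flat_tendsto_0: "(flat m \<longlongrightarrow> 0) (at 0)"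
proof -
  have "((\<lambda>t. inverse t ^ m / exp (inverse t)) \<longlongrightarrow> (0::real)) (at_right 0)"
    using tendsto_power_div_exp_0 filterlim_inverse_at_top_right by (rule filterlim_compose)
  then have "(flat m \<longlongrightarrow> 0) (at_right 0)"
    by (rule Lim_transform_eventually)
      (auto simp: flat_def exp_minus field_simps eventually_at_right_less intro: eventually_at_rightI[of 0 1])
  moreover have "(flat m \<longlongrightarrow> 0) (at_left 0)"
    by (rule Lim_transform_eventually[OF tendsto_const])
      (auto simp: flat_def intro: eventually_at_leftI[of "-1" 0])
  ultimately show ?thesis by (simp add: filterlim_split_at)
qed

lemma flat_has_derivative:
  "(flat m has_field_derivative (flat (m + 2) t - real m * flat (m + 1) t)) (at t)"
proof -
  consider "t > 0" | "t < 0" | "t = 0" by linarith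
  then show ?thesis
  proof cases
    case 1
    have outer: "((\<lambda>u. exp (- u) * u ^ m) has_field_derivative (exp (- u) * (real m * u ^ (m - 1)) - exp (- u) * u ^ m)) (at u)" for u :: real
      by (auto intro!: derivative_eq_intros)
    have "(inverse has_field_derivative - (inverse t ^ 2)) (at t)"
      using DERIV_inverse[of t] 1 by (simp add: numeral_2_eq_2)
    from DERIV_chain2[OF outer this]
    have "((\<lambda>t. exp (- inverse t) * inverse t ^ m) has_field_derivative (flat (m + 2) t - real m * flat (m + 1) t)) (at t)"
      by (rule DERIV_cong) (use 1 in \<open>cases m; simp add: flat_def algebra_simps power2_eq_square\<close>)
    then show ?thesis
      by (rule has_field_derivative_transform_within_open[of _ _ _ "{0<..}"]) (use 1 in \<open>auto simp: flat_def\<close>)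
  next
    case 2
    have "((\<lambda>t. 0::real) has_field_derivative (flat (m + 2) t - real m * flat (m + 1) t)) (at t)"
      using 2 by (simp add: flat_def)
    then show ?thesis
      by (rule has_field_derivative_transform_within_open[of _ _ _ "{..<0}"]) (use 2 in \<open>auto simp: flat_def\<close>)
  next
    case 3
    \<comment> \<open>The difference quotient at 0 is \<open>flat (Suc m)\<close>, so the previous
      lemma gives the derivative 0.\<close>
    have "((\<lambda>h. (flat m (0 + h) - flat m 0) / h) \<longlongrightarrow> 0) (at 0)"
      using flat_tendsto_0[of "Suc m"]
      by (rule Lim_transform_eventually) (auto simp: flat_def field_simps eventually_at_filter)
    then show ?thesis using 3 by (simp add: DERIV_def flat_def)
  qed
qed

section \<open>Calculus of C^k functions and smooth bumps on boxes\<close>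

lemma partial_eq: "(f has_derivative D) (at x) \<Longrightarrow> partial i f x = D (axis i 1)"
  unfolding partial_def using frechet_derivative_at by metis

lemma has_derivative_frechet: "f differentiable (at x) \<Longrightarrow> (f has_derivative frechet_derivative f (at x)) (at x)"
  using frechet_derivative_works by blast

lemma partial_const: "partial i (\<lambda>x. c) = (\<lambda>x. 0)"
  using partial_eq[OF has_derivative_const] by blast

lemma partial_add:
  assumes "\<And>x. f differentiable (at x)" "\<And>x. g differentiable (at x)"
  shows "partial i (\<lambda>x. f x + g x) = (\<lambda>x. partial i f x + partial i g x)"
  using partial_eq[OF has_derivative_add[OF assms[THEN has_derivative_frechet]]] by (fastforce simp: partial_def)

lemma partial_mult:
  assumes "\<And>x. f differentiable (at x)" "\<And>x. g differentiable (at x)"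
  shows "partial i (\<lambda>x. f x * g x) = (\<lambda>x. f x * partial i g x + partial i f x * g x)"
  using partial_eq[OF has_derivative_mult[OF assms[THEN has_derivative_frechet]]] by (fastforce simp: partial_def)

text \<open>The right-hand side is arranged as a pure product so that \<open>Ck_mult\<close> and
  \<open>Ck_const\<close> apply to it in the induction for \<open>Ck_inverse\<close>.\<close>

lemma partial_inverse:
  assumes "\<And>x. f differentiable (at x)" "\<And>x. f x \<noteq> 0"
  shows "partial i (\<lambda>x. inverse (f x)) = (\<lambda>x. (- 1 * partial i f x) * (inverse (f x) * inverse (f x)))"
  using partial_eq[OF Deriv.has_derivative_inverse[OF assms(2) has_derivative_frechet[OF assms(1)]]]
  by (fastforce simp: partial_def)

lemma Ck_SucD: "Ck (Suc k) f \<Longrightarrow> Ck k f"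
proof (induction k arbitrary: f)
  case 0 then show ?case by (auto simp: intro!: continuous_at_imp_continuous_on differentiable_imp_continuous_within)
qed auto

lemma Ck_const: "Ck k (\<lambda>x. c)"
  by (induction k arbitrary: c) (auto simp: partial_const)

lemma Ck_add: "Ck k f \<Longrightarrow> Ck k g \<Longrightarrow> Ck k (\<lambda>x. f x + g x)"
  by (induction k arbitrary: f g) (auto simp: partial_add intro: continuous_on_add)

lemma Ck_mult: "Ck k f \<Longrightarrow> Ck k g \<Longrightarrow> Ck k (\<lambda>x. f x * g x)"
proof (induction k arbitrary: f g)
  case (Suc k)
  have "Ck k f" "Ck k g" using Suc.prems by (blast intro: Ck_SucD)+
  then show ?case using Suc by (auto simp: partial_mult intro!: Ck_add)
qed (auto intro: continuous_on_mult)

lemma Ck_inverse: "Ck k f \<Longrightarrow> (\<And>x. f x \<noteq> 0) \<Longrightarrow> Ck k (\<lambda>x. inverse (f x))"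
proof (induction k arbitrary: f)
  case (Suc k)
  have "Ck k f" using Suc.prems by (blast intro: Ck_SucD)
  then have "Ck k (\<lambda>x. (- 1 * partial i f x) * (inverse (f x) * inverse (f x)))" for i
    using Suc by (intro Ck_mult Ck_const) auto
  moreover have "(\<lambda>x. inverse (f x)) differentiable (at x)" for x
    using Suc.prems by (intro differentiable_inverse) auto
  ultimately show ?case
    unfolding Ck.simps using Suc.prems partial_inverse[of f] by simp
qed (auto intro: continuous_on_inverse)

lemma Ck_prod: "(\<And>i. i \<in> I \<Longrightarrow> Ck k (f i)) \<Longrightarrow> Ck k (\<lambda>x. \<Prod>i\<in>I. f i x)"
  by (induction I rule: infinite_finite_induct) (auto intro: Ck_const Ck_mult)

text \<open>The exponent m is general in the induction because the derivative of
  \<open>flat m\<close> involves \<open>flat (m + 1)\<close> and \<open>flat (m + 2)\<close>. The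
  affine argument lets one lemma cover the lower and the upper face of a box.\<close>

lemma Ck_flat:
  fixes i :: "'d::finite"
  shows "Ck k (\<lambda>x. complex_of_real (flat m (s * (x $ i) + c)))"
proof (induction k arbitrary: m)
  case 0
  have "continuous_on UNIV (flat m)" for m
    using DERIV_isCont[OF flat_has_derivative] by (simp add: continuous_at_imp_continuous_on)
  moreover have "continuous_on UNIV (\<lambda>x::real^'d. s * (x $ i) + c)" by (intro continuous_intros)
  ultimately have "continuous_on UNIV (\<lambda>x. flat m (s * (x $ i) + c))"
    by (rule continuous_on_compose2) simp
  then show ?case unfolding Ck.simps by (rule continuous_on_of_real)
next
  case (Suc k)
  define D where "D m t = flat (m + 2) t - real m * flat (m + 1) t" for m t
  have der: "((\<lambda>x. complex_of_real (flat m (s * (x $ i) + c))) has_derivative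
      (\<lambda>h. complex_of_real (s * (h $ i) * D m (s * (x $ i) + c)))) (at x)" for x
  proof -
    have "((\<lambda>x. s * (x $ i) + c) has_derivative (\<lambda>h. s * (h $ i))) (at x)"
      by (auto intro!: derivative_eq_intros bounded_linear.has_derivative[OF bounded_linear_vec_nth])
    then have "((\<lambda>x. flat m (s * (x $ i) + c)) has_derivative (\<lambda>h. s * (h $ i) * D m (s * (x $ i) + c))) (at x)"
      using flat_has_derivative[of m "s * (x $ i) + c"] unfolding D_def
      by (rule DERIV_compose_FDERIV[rotated])
    then show ?thesis by (rule has_derivative_of_real)
  qed
  have "partial j (\<lambda>x. complex_of_real (flat m (s * (x $ i) + c))) =
     (\<lambda>x. complex_of_real (s * (axis j 1 $ i)) * (complex_of_real (flat (m + 2) (s * (x $ i) + c))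
        + complex_of_real (- real m) * complex_of_real (flat (m + 1) (s * (x $ i) + c))))" for j
    by (rule ext, subst partial_eq[OF der]) (simp add: D_def)
  moreover have "Ck k (\<lambda>x. complex_of_real (s * (axis j 1 $ i)) * (complex_of_real (flat (m + 2) (s * (x $ i) + c))
        + complex_of_real (- real m) * complex_of_real (flat (m + 1) (s * (x $ i) + c))))" for j
    by (intro Ck_mult Ck_add Ck_const Suc.IH)
  ultimately show ?case using der by (auto simp: differentiable_def)
qed

text \<open>A smooth function that is positive exactly on the open box. The coefficients 1 and - 1
  put every factor into the shape s * x_i + c of \<open>Ck_flat\<close>.\<close>

definition box_weight :: "real ^ 'd::finite \<Rightarrow> real ^ 'd \<Rightarrow> real ^ 'd \<Rightarrow> real" where
  "box_weight a b x = (\<Prod>i\<in>UNIV. flat 0 (1 * (x $ i) + (- a $ i)) * flat 0 (- 1 * (x $ i) + b $ i))"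

lemma box_weight_pos_iff: "box_weight a b x > 0 \<longleftrightarrow> x \<in> box a b"
  and box_weight_nonneg: "box_weight a b x \<ge> 0"
  and box_weight_eq_0: "x \<notin> box a b \<Longrightarrow> box_weight a b x = 0"
proof -
  show nn: "box_weight a b x \<ge> 0" unfolding box_weight_def by (intro prod_nonneg mult_nonneg_nonneg flat_nonneg)
  show zero: "box_weight a b x = 0" if "x \<notin> box a b"
  proof -
    have "\<not> (\<forall>i. a $ i < x $ i \<and> x $ i < b $ i)" using that by (simp add: mem_box_cart)
    then obtain i where "\<not> (a $ i < x $ i \<and> x $ i < b $ i)" by blast
    then have "flat 0 (1 * (x $ i) + (- a $ i)) * flat 0 (- 1 * (x $ i) + b $ i) = 0" by (auto simp: flat_eq_0)
    then show ?thesis unfolding box_weight_def by (intro prod_zero) auto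
  qed
  show "box_weight a b x > 0 \<longleftrightarrow> x \<in> box a b"
  proof
    assume "x \<in> box a b"
    then show "box_weight a b x > 0"
      unfolding box_weight_def mem_box_cart by (intro prod_pos ballI mult_pos_pos flat_pos) auto
  qed (use zero in force)
qed

(* w / (w + 1/n) increases to the indicator function of the set where w > 0. *)
definition box_bump :: "real ^ 'd::finite \<Rightarrow> real ^ 'd \<Rightarrow> nat \<Rightarrow> real ^ 'd \<Rightarrow> real" where
  "box_bump a b n x = box_weight a b x / (box_weight a b x + 1 / real (Suc n))"

lemma box_bump_bounds: "0 \<le> box_bump a b n x" "box_bump a b n x \<le> indicator (cbox a b) x"
proof -
  note w = box_weight_nonneg[of a b x]
  show "0 \<le> box_bump a b n x" using w by (simp add: box_bump_def)
  have "box_bump a b n x \<le> 1" using w by (simp add: box_bump_def divide_le_eq add_nonneg_pos)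
  moreover have "box_bump a b n x = 0" if "x \<notin> cbox a b"
  proof -
    have "x \<notin> box a b" using that box_subset_cbox by blast
    then show ?thesis by (simp add: box_bump_def box_weight_eq_0)
  qed
  ultimately show "box_bump a b n x \<le> indicator (cbox a b) x" by (cases "x \<in> cbox a b") auto
qed

lemma box_bump_tendsto: "(\<lambda>n. box_bump a b n x) \<longlonglongrightarrow> indicator (box a b) x"
proof (cases "x \<in> box a b")
  case True
  then have w: "box_weight a b x > 0" by (simp add: box_weight_pos_iff)
  have "(\<lambda>n. box_bump a b n x) \<longlonglongrightarrow> box_weight a b x / (box_weight a b x + 0)"
    unfolding box_bump_def inverse_eq_divide[symmetric]
    using w by (intro tendsto_intros LIMSEQ_inverse_real_of_nat) auto
  then show ?thesis using w True by simp
qed (simp add: box_bump_def box_weight_eq_0)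

lemma box_bump_test_function:
  assumes "cbox a b \<subseteq> \<Omega>"
  shows "(\<lambda>x. complex_of_real (box_bump a b n x)) \<in> test_functions \<Omega>"
proof -
  have w: "Ck k (\<lambda>x. complex_of_real (box_weight a b x))" for k
    unfolding box_weight_def of_real_prod of_real_mult by (intro Ck_prod Ck_mult Ck_flat)
  \<comment> \<open>The summand 1 / Suc n keeps the denominator positive outside the box as well, so
    the quotient is smooth on the whole space.\<close>
  have nz: "complex_of_real (box_weight a b x) + of_real (1 / real (Suc n)) \<noteq> 0" for x
    unfolding of_real_add[symmetric] of_real_eq_0_iff
    using add_nonneg_pos[OF box_weight_nonneg[of a b x], of "1 / real (Suc n)"] by simp
  have "Ck k (\<lambda>x. complex_of_real (box_weight a b x) * inverse (complex_of_real (box_weight a b x) + of_real (1 / real (Suc n))))" for k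
    by (intro Ck_mult Ck_inverse Ck_add Ck_const w nz)
  then have smooth: "Ck k (\<lambda>x. complex_of_real (box_bump a b n x))" for k
    by (simp add: box_bump_def divide_inverse)
  have "x \<in> cbox a b" if "complex_of_real (box_bump a b n x) \<noteq> 0" for x
    using box_bump_bounds[of a b n x] that by (cases "x \<in> cbox a b") auto
  then have sub: "closure {x. complex_of_real (box_bump a b n x) \<noteq> 0} \<subseteq> cbox a b"
    by (intro closure_minimal closed_cbox) blast
  then have "bounded {x. complex_of_real (box_bump a b n x) \<noteq> 0}"
    using bounded_subset[OF bounded_cbox] closure_subset by (metis subset_trans)
  then show ?thesis using smooth sub assms by (simp add: test_functions_def compact_closure)
qed

section \<open>Test functions: supports, difference quotients and integration by parts\<close>

lemma compact_closure_subset: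
  fixes K :: "'a::heine_borel set"
  shows "compact K \<Longrightarrow> S \<subseteq> K \<Longrightarrow> compact (closure S)"
  unfolding compact_closure by (rule bounded_subset[OF compact_imp_bounded])

lemma test_functionsD:
  assumes "f \<in> test_functions \<Omega>"
  shows "Ck k f" "continuous_on S f" "f differentiable (at x)" "Ck k (partial i f)" "continuous_on S (partial i f)"
    "compact (closure {x. f x \<noteq> 0})" "closure {x. f x \<noteq> 0} \<subseteq> \<Omega>" "x \<notin> \<Omega> \<Longrightarrow> f x = 0"
proof -
  have ck: "Ck k f" for k using assms by (simp add: test_functions_def)
  show "Ck k f" by (rule ck)
  show "continuous_on S f" using ck[of 0] continuous_on_subset by (simp) blast
  show "f differentiable (at x)" "Ck k (partial i f)" using ck[of "Suc k"] by auto
  show "continuous_on S (partial i f)" using ck[of "Suc 0"] continuous_on_subset by (simp) blast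
  show "compact (closure {x. f x \<noteq> 0})" "closure {x. f x \<noteq> 0} \<subseteq> \<Omega>" using assms by (simp_all add: test_functions_def)
  then show "x \<notin> \<Omega> \<Longrightarrow> f x = 0" using closure_subset[of "{x. f x \<noteq> 0}"] by blast
qed

lemma partial_eq_0_outside:
  assumes "x \<notin> closure {x. f x \<noteq> 0}" shows "partial i f x = 0"
proof -
  have "((\<lambda>x. 0) has_derivative (\<lambda>h. 0)) (at x)" by simp
  then have "(f has_derivative (\<lambda>h. 0)) (at x)"
    by (rule has_derivative_transform_within_open[of _ _ _ _ "- closure {x. f x \<noteq> 0}"])
      (use assms closure_subset[of "{x. f x \<noteq> 0}"] in auto)
  from partial_eq[OF this] show ?thesis .
qed

lemma test_functions_partial:
  assumes "f \<in> test_functions \<Omega>" shows "partial i f \<in> test_functions \<Omega>"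
proof -
  have sub: "{x. partial i f x \<noteq> 0} \<subseteq> closure {x. f x \<noteq> 0}"
    using partial_eq_0_outside[of _ f i] by blast
  then have "closure {x. partial i f x \<noteq> 0} \<subseteq> closure {x. f x \<noteq> 0}"
    by (intro closure_minimal closed_closure)
  moreover have "compact (closure {x. partial i f x \<noteq> 0})"
    by (rule compact_closure_subset[OF test_functionsD(6)[OF assms] sub])
  ultimately show ?thesis
    using test_functionsD(4,7)[OF assms] by (auto simp: test_functions_def)
qed

lemma continuous_compact_support_integrable:
  fixes f :: "'a::euclidean_space \<Rightarrow> 'b::{banach, second_countable_topology}"
  assumes "continuous_on UNIV f" "compact K" "\<And>x. x \<notin> K \<Longrightarrow> f x = 0"
  shows "integrable lborel f"
proof -
  have "integrable lborel (\<lambda>x. indicator K x *\<^sub>R f x)"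
    using assms(1) by (intro borel_integrable_compact assms(2)) (auto intro: continuous_on_subset)
  moreover have "(\<lambda>x. indicator K x *\<^sub>R f x) = f" using assms(3) by (auto simp: indicator_def)
  ultimately show ?thesis by simp
qed

lemma integrable_lebesgue_on_open:
  fixes f :: "'a::euclidean_space \<Rightarrow> 'b::{banach, second_countable_topology}"
  assumes "open \<Omega>" "integrable lebesgue f" shows "integrable (lebesgue_on \<Omega>) f"
  using assms by (simp add: integrable_restrict_space integrable_mult_indicator)

lemma test_functions_L2:
  assumes \<Omega>: "open \<Omega>" and f: "f \<in> test_functions \<Omega>"
  shows "f \<in> L2 (lebesgue_on \<Omega>)"
proof -
  have "integrable lborel (\<lambda>x. (cmod (f x))\<^sup>2)"
    using test_functionsD(2)[OF f, of UNIV] closure_subset[of "{x. f x \<noteq> 0}"]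
    by (intro continuous_compact_support_integrable[OF _ test_functionsD(6)[OF f]]) (auto intro!: continuous_intros)
  then have "integrable lebesgue (\<lambda>x. (cmod (f x))\<^sup>2)"
    by (simp add: integrable_completion borel_measurable_integrable)
  then have "integrable (lebesgue_on \<Omega>) (\<lambda>x. (cmod (f x))\<^sup>2)"
    by (rule integrable_lebesgue_on_open[OF \<Omega>])
  moreover have "f \<in> borel_measurable (lebesgue_on \<Omega>)"
    using \<Omega> test_functionsD(2)[OF f] by (intro continuous_imp_measurable_on_sets_lebesgue) auto
  ultimately show ?thesis by (simp add: L2_def)
qed

text \<open>The mean value inequality on a segment parallel to the i-th axis. The derivative is
  bounded on that segment only, so that the bound can come from a compact ball.\<close>

lemma difference_quotient_bound:
  fixes f :: "real ^ 'd::finite \<Rightarrow> complex"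
  assumes diff: "\<And>x. f differentiable (at x)" and t: "t \<ge> 0"
    and bound: "\<And>s. 0 \<le> s \<Longrightarrow> s \<le> t \<Longrightarrow> cmod (partial i f (x + s *\<^sub>R axis i 1)) \<le> K"
  shows "cmod (f (x + t *\<^sub>R axis i 1) - f x) \<le> K * t"
proof -
  define p where "p s = f (x + s *\<^sub>R axis i 1)" for s
  have der: "(p has_derivative (\<lambda>r. r *\<^sub>R partial i f (x + s *\<^sub>R axis i 1))) (at s within {0..t})" for s
  proof -
    let ?F = "frechet_derivative f (at (x + s *\<^sub>R axis i 1))"
    have F: "(f has_derivative ?F) (at (x + s *\<^sub>R axis i 1))" by (rule has_derivative_frechet[OF diff])
    have "((\<lambda>s. x + s *\<^sub>R axis i 1) has_derivative (\<lambda>r. r *\<^sub>R axis i 1)) (at s within {0..t})"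
      by (auto intro!: derivative_eq_intros)
    from has_derivative_compose[OF this F]
    have "(p has_derivative (\<lambda>r. ?F (r *\<^sub>R axis i 1))) (at s within {0..t})" by (simp add: p_def[abs_def])
    moreover have "?F (r *\<^sub>R axis i 1) = r *\<^sub>R partial i f (x + s *\<^sub>R axis i 1)" for r
      using linear_scale[OF bounded_linear.linear[OF has_derivative_bounded_linear[OF F]]] by (simp add: partial_def)
    ultimately show ?thesis by simp
  qed
  have "norm (p t - p 0) \<le> K * norm (t - 0)"
  proof (rule differentiable_bound[OF _ der])
    fix s assume "s \<in> {0..t}"
    then show "onorm (\<lambda>r. r *\<^sub>R partial i f (x + s *\<^sub>R axis i 1)) \<le> K"
      using mult_left_mono[OF bound[of s] abs_ge_zero] by (intro onorm_le) (simp add: mult.commute[of K])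
  qed (use t in auto)
  then show ?thesis using t by (simp add: p_def)
qed

text \<open>Stated along a sequence of step lengths because it feeds the dominated convergence
  theorem.\<close>

lemma difference_quotient_tendsto:
  fixes f :: "real ^ 'd::finite \<Rightarrow> complex"
  assumes diff: "f differentiable (at x)" and t: "\<And>n::nat. t n > 0" "t \<longlonglongrightarrow> 0"
  shows "(\<lambda>n. (f (x + t n *\<^sub>R axis i 1) - f x) /\<^sub>R t n) \<longlonglongrightarrow> partial i f x"
proof -
  let ?F = "frechet_derivative f (at x)"
  have F: "(f has_derivative ?F) (at x)" by (rule has_derivative_frechet[OF diff])
  have sc: "?F (r *\<^sub>R axis i 1) = r *\<^sub>R partial i f x" for r
    using linear_scale[OF bounded_linear.linear[OF has_derivative_bounded_linear[OF F]]] by (simp add: partial_def)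
  have "((\<lambda>h. norm (f (x + h) - f x - ?F h) / norm h) \<longlongrightarrow> 0) (at 0)"
    using F by (simp add: has_derivative_at)
  moreover have "filterlim (\<lambda>n. t n *\<^sub>R axis i (1::real)) (at 0) sequentially"
  proof -
    have "(\<lambda>n. t n *\<^sub>R axis i (1::real)) \<longlonglongrightarrow> 0 *\<^sub>R axis i 1" by (intro tendsto_intros t)
    then show ?thesis using t(1) by (simp add: filterlim_at less_imp_neq[symmetric] axis_eq_0_iff always_eventually)
  qed
  ultimately have "(\<lambda>n. norm (f (x + t n *\<^sub>R axis i 1) - f x - ?F (t n *\<^sub>R axis i 1)) / norm (t n *\<^sub>R axis i (1::real))) \<longlonglongrightarrow> 0"
    by (rule filterlim_compose)
  moreover have "norm (f (x + t n *\<^sub>R axis i 1) - f x - ?F (t n *\<^sub>R axis i 1)) / norm (t n *\<^sub>R axis i (1::real))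
      = norm ((f (x + t n *\<^sub>R axis i 1) - f x) /\<^sub>R t n - partial i f x)" for n
  proof -
    have "(f (x + t n *\<^sub>R axis i 1) - f x) /\<^sub>R t n - partial i f x = (f (x + t n *\<^sub>R axis i 1) - f x - ?F (t n *\<^sub>R axis i 1)) /\<^sub>R t n"
      unfolding sc using t(1)[of n] by (simp add: scaleR_diff_right)
    then show ?thesis using t(1)[of n] by (simp add: norm_axis_1 divide_inverse_commute)
  qed
  ultimately have "(\<lambda>n. norm ((f (x + t n *\<^sub>R axis i 1) - f x) /\<^sub>R t n - partial i f x)) \<longlonglongrightarrow> 0" by simp
  then show ?thesis using tendsto_norm_zero_iff LIM_zero_iff by blast
qed

(* The integral of a difference quotient vanishes by translation invariance. *)
lemma integral_partial_eq_0:
  fixes f :: "real ^ 'd::finite \<Rightarrow> complex"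
  assumes diff: "\<And>x. f differentiable (at x)" and cont: "continuous_on UNIV (partial i f)"
    and supp: "compact (closure {x. f x \<noteq> 0})"
  shows "(\<integral>x. partial i f x \<partial>lborel) = 0"
proof -
  let ?e = "axis i (1::real) :: real ^ 'd"
  define t where "t n = 1 / real (Suc n)" for n
  have t: "0 < t n" "t n \<le> 1" "t \<longlonglongrightarrow> 0" for n
    using LIMSEQ_inverse_real_of_nat by (auto simp: t_def[abs_def] inverse_eq_divide)
  have contf: "continuous_on UNIV f"
    using diff by (simp add: continuous_at_imp_continuous_on differentiable_imp_continuous_within)
  have f0: "f x = 0" if "x \<notin> closure {x. f x \<noteq> 0}" for x using that closure_subset[of "{x. f x \<noteq> 0}"] by blast
  have intf: "integrable lborel f" by (rule continuous_compact_support_integrable[OF contf supp f0])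
  \<comment> \<open>The radii R, R + 1 and R + 2: f vanishes off radius R; steps have length t n <=
    1, so difference quotients vanish off radius R + 1; segments that start within radius R + 1 stay
    within R + 2, where K bounds the derivative.\<close>
  obtain R where R: "closure {x. f x \<noteq> 0} \<subseteq> cball 0 R"
    using compact_imp_bounded[OF supp] unfolding bounded_iff by (auto simp: subset_iff)
  have "compact (partial i f ` cball 0 (R + 2))"
    using cont by (intro compact_continuous_image) (auto intro: continuous_on_subset)
  then obtain K where K: "\<And>x. x \<in> cball 0 (R + 2) \<Longrightarrow> cmod (partial i f x) \<le> K"
    by (meson compact_imp_bounded bounded_iff image_eqI)
  have fout: "f x = 0" if "norm x > R" for x using f0 R that by (meson mem_cball_0 not_le subsetD)
  have zero: "(\<integral>x. (f (x + t n *\<^sub>R ?e) - f x) /\<^sub>R t n \<partial>lborel) = 0" for n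
  proof -
    let ?c = "t n *\<^sub>R ?e"
    have m: "f \<in> borel_measurable borel" using contf by (rule borel_measurable_continuous_onI)
    have "integrable (distr lborel borel ((+) ?c)) f" using intf by (simp add: lborel_distr_plus)
    then have i: "integrable lborel (\<lambda>x. f (?c + x))" using m by (subst (asm) integrable_distr_eq) auto
    have "(\<integral>x. f x \<partial>lborel) = (\<integral>x. f x \<partial>distr lborel borel ((+) ?c))" by (simp add: lborel_distr_plus)
    also have "\<dots> = (\<integral>x. f (?c + x) \<partial>lborel)" using m by (subst integral_distr) auto
    finally show ?thesis using i intf by (simp add: add.commute)
  qed
  have "(\<lambda>n. \<integral>x. (f (x + t n *\<^sub>R ?e) - f x) /\<^sub>R t n \<partial>lborel) \<longlonglongrightarrow> (\<integral>x. partial i f x \<partial>lborel)"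
  proof (rule integral_dominated_convergence[where w = "\<lambda>x. \<bar>K\<bar> * indicator (cball 0 (R + 1)) x"])
    show "partial i f \<in> borel_measurable lborel" using borel_measurable_continuous_onI[OF cont] by simp
    show "(\<lambda>x. (f (x + t n *\<^sub>R ?e) - f x) /\<^sub>R t n) \<in> borel_measurable lborel" for n
    proof -
      have "continuous_on UNIV (\<lambda>x. (f (x + t n *\<^sub>R ?e) - f x) /\<^sub>R t n)"
        by (intro continuous_intros contf continuous_on_compose2[OF contf]) auto
      from borel_measurable_continuous_onI[OF this] show ?thesis by simp
    qed
    show "integrable lborel (\<lambda>x. \<bar>K\<bar> * indicator (cball 0 (R + 1) :: (real^'d) set) x)"
      by (intro integrable_mult_right integrable_real_indicator) (auto intro!: emeasure_bounded_finite[OF bounded_cball, unfolded infinity_ennreal_def])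
    show "AE x in lborel. (\<lambda>n. (f (x + t n *\<^sub>R ?e) - f x) /\<^sub>R t n) \<longlonglongrightarrow> partial i f x"
      by (intro AE_I2 difference_quotient_tendsto diff t)
    show "AE x in lborel. norm ((f (x + t n *\<^sub>R ?e) - f x) /\<^sub>R t n) \<le> \<bar>K\<bar> * indicator (cball 0 (R + 1)) x" for n
    proof (intro AE_I2)
      fix x :: "real ^ 'd"
      have nt: "norm (s *\<^sub>R ?e) \<le> 1" if "0 \<le> s" "s \<le> t n" for s using that t(2)[of n] by (simp add: norm_axis_1)
      show "norm ((f (x + t n *\<^sub>R ?e) - f x) /\<^sub>R t n) \<le> \<bar>K\<bar> * indicator (cball 0 (R + 1)) x"
      proof (cases "x \<in> cball 0 (R + 1)")
        case True
        have "cmod (f (x + t n *\<^sub>R ?e) - f x) \<le> \<bar>K\<bar> * t n"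
        proof (rule difference_quotient_bound[OF diff less_imp_le[OF t(1)]])
          fix s assume "0 \<le> s" "s \<le> t n"
          then have "norm (x + s *\<^sub>R ?e) \<le> R + 2" using norm_triangle_ineq[of x "s *\<^sub>R ?e"] nt[of s] True by simp
          then show "cmod (partial i f (x + s *\<^sub>R ?e)) \<le> \<bar>K\<bar>" using K[of "x + s *\<^sub>R ?e"] by simp
        qed
        then show ?thesis using t(1)[of n] True by (simp add: divide_inverse_commute[symmetric] pos_divide_le_eq)
      next
        case False
        then have "norm x > R" "norm (x + t n *\<^sub>R ?e) > R"
          using norm_diff_ineq[of x "t n *\<^sub>R ?e"] nt[of "t n"] t(1)[of n] by auto
        then show ?thesis using False by (simp add: fout)
      qed
    qed
  qed
  then show ?thesis unfolding zero by (simp add: LIMSEQ_const_iff)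
qed

text \<open>A bridge between two settings: the translation argument takes place in
  \<open>lborel\<close>, while weak derivatives are defined with
  \<open>lebesgue_on \<Omega>\<close>.\<close>

lemma integral_lebesgue_on_eq_lborel:
  fixes f :: "'a::euclidean_space \<Rightarrow> complex"
  assumes "open \<Omega>" "continuous_on UNIV f" "\<And>x. x \<notin> \<Omega> \<Longrightarrow> f x = 0"
  shows "(\<integral>x. f x \<partial>lebesgue_on \<Omega>) = (\<integral>x. f x \<partial>lborel)"
proof -
  have "(\<integral>x. f x \<partial>lebesgue_on \<Omega>) = (\<integral>x. indicator \<Omega> x *\<^sub>R f x \<partial>lebesgue)"
    using assms(1) by (subst integral_restrict_space) auto
  also have "(\<lambda>x. indicator \<Omega> x *\<^sub>R f x) = f" using assms(3) by (auto simp: indicator_def)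
  also have "(\<integral>x. f x \<partial>lebesgue) = (\<integral>x. f x \<partial>lborel)"
    using borel_measurable_continuous_onI[OF assms(2)] by (intro integral_completion) simp
  finally show ?thesis .
qed

text \<open>Integration by parts: the derivative of v * f has integral 0 by
  \<open>integral_partial_eq_0\<close>, and the product rule splits that integral into the two
  sides.\<close>

lemma test_functions_weak_partial:
  assumes \<Omega>: "open \<Omega>" and v: "v \<in> test_functions \<Omega>"
  shows "is_weak_partial \<Omega> i v (partial i v)"
  unfolding is_weak_partial_def
proof (intro conjI ballI)
  have pv: "partial i v \<in> test_functions \<Omega>" by (rule test_functions_partial[OF v])
  then show "partial i v \<in> L2 (lebesgue_on \<Omega>)" by (rule test_functions_L2[OF \<Omega>])
  fix f assume f: "f \<in> test_functions \<Omega>"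
  have pf: "partial i f \<in> test_functions \<Omega>" by (rule test_functions_partial[OF f])
  have prod: "partial i (\<lambda>x. v x * f x) = (\<lambda>x. v x * partial i f x + partial i v x * f x)"
    by (rule partial_mult[OF test_functionsD(3)[OF v] test_functionsD(3)[OF f]])
  have cont: "continuous_on UNIV (\<lambda>x. v x * partial i f x + partial i v x * f x)"
    by (intro continuous_intros test_functionsD(2,5)[OF v] test_functionsD(2,5)[OF f])
  have sub: "{x. v x * f x \<noteq> 0} \<subseteq> {x. v x \<noteq> 0}" by auto
  have "(\<integral>x. v x * partial i f x \<partial>lebesgue_on \<Omega>) + (\<integral>x. partial i v x * f x \<partial>lebesgue_on \<Omega>)
      = (\<integral>x. v x * partial i f x + partial i v x * f x \<partial>lebesgue_on \<Omega>)"
    by (intro Bochner_Integration.integral_add[symmetric] L2_mult_integrable test_functions_L2 \<Omega> v f pv pf)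
  also have "\<dots> = (\<integral>x. v x * partial i f x + partial i v x * f x \<partial>lborel)"
    using test_functionsD(8)[OF v] test_functionsD(8)[OF pv]
    by (intro integral_lebesgue_on_eq_lborel \<Omega> cont) auto
  also have "\<dots> = (\<integral>x. partial i (\<lambda>x. v x * f x) x \<partial>lborel)" unfolding prod ..
  also have "\<dots> = 0"
  proof (rule integral_partial_eq_0)
    show "(\<lambda>x. v x * f x) differentiable (at x)" for x
      by (intro differentiable_mult test_functionsD(3)[OF v] test_functionsD(3)[OF f])
    show "continuous_on UNIV (partial i (\<lambda>x. v x * f x))" unfolding prod by (rule cont)
    show "compact (closure {x. v x * f x \<noteq> 0})"
      by (rule compact_closure_subset[OF test_functionsD(6)[OF v]]) (use sub closure_subset in blast)
  qed
  finally show "(\<integral>x. v x * partial i f x \<partial>lebesgue_on \<Omega>) = - (\<integral>x. partial i v x * f x \<partial>lebesgue_on \<Omega>)"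
    by (simp add: eq_neg_iff_add_eq_0)
qed

lemma test_functions_H1: "open \<Omega> \<Longrightarrow> test_functions \<Omega> \<subseteq> H1 \<Omega>"
proof
  fix f assume \<Omega>: "open \<Omega>" and f: "f \<in> test_functions \<Omega>"
  show "f \<in> H1 \<Omega>"
    unfolding H1_def mem_Collect_eq
    using test_functions_L2[OF \<Omega> f] test_functions_weak_partial[OF \<Omega> f] by metis
qed

text \<open>Bumps show that h has integral 0 over every closed box inside \<Omega>, and Lebesgue
  differentiation along shrinking cubes then gives h = 0 almost everywhere. Orthogonality is asked
  for real-valued test functions, which fits both the pairing without conjugation in
  \<open>is_weak_partial\<close> and the conjugated one in \<open>is_weak_A\<close>.\<close>

lemma fundamental_lemma_calculus_of_variations:
  fixes h :: "real ^ 'd::finite \<Rightarrow> complex"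
  assumes \<Omega>: "open \<Omega>" and h: "h \<in> L2 (lebesgue_on \<Omega>)"
    and orth: "\<And>f. f \<in> test_functions \<Omega> \<Longrightarrow> (\<And>x. cnj (f x) = f x) \<Longrightarrow> (\<integral>x. h x * f x \<partial>lebesgue_on \<Omega>) = 0"
  shows "AE x in lebesgue_on \<Omega>. h x = 0"
proof -
  \<comment> \<open>Extension by 0, because the differentiation theorem used below speaks of
    integrals over boxes in the whole space.\<close>
  define g where "g x = indicator \<Omega> x *\<^sub>R h x" for x
  have \<Omega>m: "\<Omega> \<inter> space lebesgue \<in> sets lebesgue" using \<Omega> by simp
  have ind: "(\<lambda>x. indicator S x *\<^sub>R (1::complex)) \<in> L2 (lebesgue_on \<Omega>)"
    if "S \<in> lmeasurable" for S :: "(real^'d) set"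
  proof -
    have "integrable lebesgue (indicat_real S)" using that by (simp add: lmeasurable_iff_integrable)
    then have "integrable (lebesgue_on \<Omega>) (indicat_real S)"
      by (rule integrable_lebesgue_on_open[OF \<Omega>])
    moreover have "indicat_real S = (\<lambda>x. (cmod (indicator S x *\<^sub>R (1::complex)))\<^sup>2)" by (auto simp: indicator_def)
    ultimately show ?thesis
      using borel_measurable_integrable[of "lebesgue_on \<Omega>" "indicat_real S"] by (simp add: L2_def)
  qed
  have inth: "integrable (lebesgue_on \<Omega>) (\<lambda>x. indicator S x *\<^sub>R h x)"
    if "S \<in> lmeasurable" for S :: "(real^'d) set"
    using L2_mult_integrable[OF ind[OF that] h] by simp
  have swap: "(\<lambda>x. indicator \<Omega> x *\<^sub>R (indicator S x *\<^sub>R h x)) = (\<lambda>x. indicator S x *\<^sub>R g x)" for S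
    by (auto simp: g_def mult.commute)
  have intg: "set_integrable lebesgue S g" if "S \<in> lmeasurable" for S :: "(real^'d) set"
    using inth[OF that] unfolding set_integrable_def integrable_restrict_space[OF \<Omega>m] swap .
  \<comment> \<open>The bumps tend to the indicator of the open box and are dominated by that of the
    closed one; h is integrable there, being square-integrable on a set of finite measure. Passing
    from the open to the closed box does not change the integral.\<close>
  have box0: "integral (cbox a b) g = 0" if ab: "cbox a b \<subseteq> \<Omega>" for a b
  proof -
    have "(\<lambda>n. \<integral>x. h x * complex_of_real (box_bump a b n x) \<partial>lebesgue_on \<Omega>)
        \<longlonglongrightarrow> (\<integral>x. h x * complex_of_real (indicator (box a b) x) \<partial>lebesgue_on \<Omega>)"
    proof (rule integral_dominated_convergence[where w = "\<lambda>x. norm (indicator (cbox a b) x *\<^sub>R h x)"])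
      show "(\<lambda>x. h x * complex_of_real (indicator (box a b) x)) \<in> borel_measurable (lebesgue_on \<Omega>)"
        using borel_measurable_integrable[OF inth[of "box a b"]] by (simp add: scaleR_conv_of_real mult.commute)
      show "(\<lambda>x. h x * complex_of_real (box_bump a b n x)) \<in> borel_measurable (lebesgue_on \<Omega>)" for n
        by (intro borel_measurable_times L2_D(1)[OF h] L2_D(1)[OF test_functions_L2[OF \<Omega> box_bump_test_function[OF ab]]])
      show "integrable (lebesgue_on \<Omega>) (\<lambda>x. norm (indicator (cbox a b) x *\<^sub>R h x))"
        by (intro integrable_norm inth) simp
      show "AE x in lebesgue_on \<Omega>. (\<lambda>n. h x * complex_of_real (box_bump a b n x)) \<longlonglongrightarrow> h x * complex_of_real (indicator (box a b) x)"
        by (intro AE_I2 tendsto_intros box_bump_tendsto)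
      show "AE x in lebesgue_on \<Omega>. norm (h x * complex_of_real (box_bump a b n x)) \<le> norm (indicator (cbox a b) x *\<^sub>R h x)" for n
        using box_bump_bounds[of a b n]
        by (intro AE_I2) (simp add: norm_mult mult.commute[of _ "cmod _"] mult_left_mono del: indicator_simps)
    qed
    moreover have "(\<integral>x. h x * complex_of_real (box_bump a b n x) \<partial>lebesgue_on \<Omega>) = 0" for n
      by (rule orth[OF box_bump_test_function[OF ab]]) simp
    ultimately have "(\<integral>x. h x * complex_of_real (indicator (box a b) x) \<partial>lebesgue_on \<Omega>) = 0"
      by (simp add: LIMSEQ_const_iff)
    then have "(\<integral>x. indicator (box a b) x *\<^sub>R h x \<partial>lebesgue_on \<Omega>) = 0"
      by (simp add: scaleR_conv_of_real mult.commute)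
    then have "set_lebesgue_integral lebesgue (box a b) g = 0"
      unfolding integral_restrict_space[OF \<Omega>m] swap set_lebesgue_integral_def .
    then show ?thesis
      using set_lebesgue_integral_eq_integral(2)[OF intg[of "box a b"]] by (simp add: integral_open_interval)
  qed
  have gi: "g integrable_on cbox a b" for a b
    using set_lebesgue_integral_eq_integral(1)[OF intg[of "cbox a b"]] by simp
  obtain N where N: "negligible N"
    and lim: "\<And>x e. \<lbrakk>x \<notin> N; 0 < e\<rbrakk> \<Longrightarrow> \<exists>d>0. \<forall>t. 0 < t \<and> t < d \<longrightarrow>
      norm (integral (cbox x (x + t *\<^sub>R One)) g /\<^sub>R t ^ DIM(real^'d) - g x) < e"
    using integrable_ccontinuous_explicit[of g, OF gi] by metis
  have "h x = 0" if x: "x \<in> \<Omega>" "x \<notin> N" for x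
  proof (rule ccontr)
    assume "h x \<noteq> 0"
    then have "norm (g x) > 0" using x by (simp add: g_def)
    then obtain d where d: "d > 0" and lt: "\<And>t. 0 < t \<Longrightarrow> t < d \<Longrightarrow>
      norm (integral (cbox x (x + t *\<^sub>R One)) g /\<^sub>R t ^ DIM(real^'d) - g x) < norm (g x)"
      using lim[OF x(2)] by blast
    obtain r where r: "r > 0" "cball x r \<subseteq> \<Omega>" using \<Omega> x(1) open_contains_cball by blast
    define S where "S = norm (One :: real^'d)"
    \<comment> \<open>The first term puts t below d; the second keeps the diagonal t * S of the cube
      at most r, so that the cube stays inside \<Omega>.\<close>
    define t where "t = min (d / 2) (r / (S + 1))"
    have S: "S \<ge> 0" by (simp add: S_def)
    have t: "0 < t" "t < d" using d r S by (auto simp: t_def add_nonneg_pos)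
    have "t * (S + 1) \<le> r" using S by (simp add: t_def pos_le_divide_eq[symmetric] add_nonneg_pos)
    then have tS: "t * S \<le> r" using t S by (simp add: algebra_simps)
    have "cbox x (x + t *\<^sub>R One) \<subseteq> cball x r"
    proof
      fix y assume y: "y \<in> cbox x (x + t *\<^sub>R One)"
      have "norm (y - x) \<le> norm (t *\<^sub>R One :: real^'d)"
        using y by (intro norm_le_componentwise) (auto simp: mem_box inner_diff_left inner_add_left)
      then show "y \<in> cball x r" using tS t by (simp add: dist_norm norm_minus_commute S_def)
    qed
    \<comment> \<open>The mean over the cube is 0, so its distance from g x is norm (g x) itself,
      which cannot be smaller than norm (g x).\<close>
    then show False using lt[OF t] box0[of x "x + t *\<^sub>R One"] r by simp
  qed
  moreover have "AE x in lebesgue. x \<notin> N"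
    using N negligible_iff_null_sets AE_not_in by blast
  ultimately show ?thesis
    using \<Omega> by (subst AE_restrict_space_iff) (auto elim: eventually_mono)
qed

section \<open>Weak derivatives and sectoriality of \<open>b_N\<close>\<close>

context
  fixes \<Omega> :: "(real ^ 'd::finite) set"
  assumes \<Omega>: "open \<Omega>"
begin

lemma is_weak_partial_add:
  assumes "u \<in> L2 (lebesgue_on \<Omega>)" "v \<in> L2 (lebesgue_on \<Omega>)"
    and g: "is_weak_partial \<Omega> i u g" and h: "is_weak_partial \<Omega> i v h"
  shows "is_weak_partial \<Omega> i (\<lambda>x. u x + v x) (\<lambda>x. g x + h x)"
  unfolding is_weak_partial_def
proof (intro conjI ballI)
  have gh: "g \<in> L2 (lebesgue_on \<Omega>)" "h \<in> L2 (lebesgue_on \<Omega>)" using g h by (simp_all add: is_weak_partial_def)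
  then show "(\<lambda>x. g x + h x) \<in> L2 (lebesgue_on \<Omega>)" by (rule L2_add)
  fix f assume f: "f \<in> test_functions \<Omega>"
  have fL: "f \<in> L2 (lebesgue_on \<Omega>)" "partial i f \<in> L2 (lebesgue_on \<Omega>)"
    by (intro test_functions_L2 test_functions_partial \<Omega> f)+
  show "(\<integral>x. (u x + v x) * partial i f x \<partial>lebesgue_on \<Omega>) = - (\<integral>x. (g x + h x) * f x \<partial>lebesgue_on \<Omega>)"
    using g h f assms(1,2) gh fL by (simp add: is_weak_partial_def distrib_right L2_mult_integrable)
qed

lemma is_weak_partial_scale:
  assumes g: "is_weak_partial \<Omega> i u g"
  shows "is_weak_partial \<Omega> i (\<lambda>x. c * u x) (\<lambda>x. c * g x)"
  using g by (simp add: is_weak_partial_def L2_scale mult.assoc)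

text \<open>g - h pairs to 0 with every test function. This is what makes the choice in
  \<open>weak_partial\<close> harmless.\<close>

lemma is_weak_partial_unique:
  assumes g: "is_weak_partial \<Omega> i u g" and h: "is_weak_partial \<Omega> i u h"
  shows "AE x in lebesgue_on \<Omega>. g x = h x"
proof -
  have gh: "g \<in> L2 (lebesgue_on \<Omega>)" "h \<in> L2 (lebesgue_on \<Omega>)" using g h by (simp_all add: is_weak_partial_def)
  have "AE x in lebesgue_on \<Omega>. g x - h x = 0"
  proof (rule fundamental_lemma_calculus_of_variations[OF \<Omega> L2_diff[OF gh]])
    fix f assume f: "f \<in> test_functions \<Omega>"
    have "(\<integral>x. (g x - h x) * f x \<partial>lebesgue_on \<Omega>) = (\<integral>x. g x * f x \<partial>lebesgue_on \<Omega>) - (\<integral>x. h x * f x \<partial>lebesgue_on \<Omega>)"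
      using L2_mult_integrable[OF gh(1) test_functions_L2[OF \<Omega> f]] L2_mult_integrable[OF gh(2) test_functions_L2[OF \<Omega> f]]
      by (simp add: left_diff_distrib)
    then show "(\<integral>x. (g x - h x) * f x \<partial>lebesgue_on \<Omega>) = 0" using g h f by (simp add: is_weak_partial_def)
  qed
  then show ?thesis by simp
qed

lemma weak_partial_works: "u \<in> H1 \<Omega> \<Longrightarrow> is_weak_partial \<Omega> i u (weak_partial \<Omega> i u)"
  unfolding H1_def weak_partial_def by (auto intro!: someI_ex[of "is_weak_partial \<Omega> i u"])

lemma H1_L2: "H1 \<Omega> \<subseteq> L2 (lebesgue_on \<Omega>)"
  by (auto simp: H1_def)

lemma weak_partial_L2: "u \<in> H1 \<Omega> \<Longrightarrow> weak_partial \<Omega> i u \<in> L2 (lebesgue_on \<Omega>)"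
  using weak_partial_works by (simp add: is_weak_partial_def)

lemma H1_add: "u \<in> H1 \<Omega> \<Longrightarrow> v \<in> H1 \<Omega> \<Longrightarrow> (\<lambda>x. u x + v x) \<in> H1 \<Omega>"
  unfolding H1_def using is_weak_partial_add L2_add by blast

lemma H1_scale: "u \<in> H1 \<Omega> \<Longrightarrow> (\<lambda>x. c * u x) \<in> H1 \<Omega>"
  unfolding H1_def using is_weak_partial_scale L2_scale by blast

lemma H1_zero: "(\<lambda>x. 0) \<in> H1 \<Omega>"
proof -
  have "is_weak_partial \<Omega> i (\<lambda>x. 0) (\<lambda>x. 0)" for i by (simp add: is_weak_partial_def)
  then show ?thesis unfolding H1_def using L2_zero by blast
qed

text \<open>A chosen representative need not be additive pointwise; both sides are weak derivatives
  of the same function, so uniqueness makes them agree almost everywhere.\<close>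

lemma weak_partial_add:
  assumes u: "u \<in> H1 \<Omega>" and v: "v \<in> H1 \<Omega>"
  shows "AE x in lebesgue_on \<Omega>. weak_partial \<Omega> i (\<lambda>x. u x + v x) x = weak_partial \<Omega> i u x + weak_partial \<Omega> i v x"
  using H1_L2 u v
  by (intro is_weak_partial_unique[OF weak_partial_works[OF H1_add[OF u v]] is_weak_partial_add[OF _ _ weak_partial_works[OF u] weak_partial_works[OF v]]]) auto

lemma weak_partial_scale:
  assumes u: "u \<in> H1 \<Omega>"
  shows "AE x in lebesgue_on \<Omega>. weak_partial \<Omega> i (\<lambda>x. c * u x) x = c * weak_partial \<Omega> i u x"
  by (rule is_weak_partial_unique[OF weak_partial_works[OF H1_scale[OF u]] is_weak_partial_scale[OF weak_partial_works[OF u]]])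

text \<open>With the coefficient absorbed into the first factor, sesquilinearity of
  \<open>b_N\<close> reduces to that of the inner product, and \<open>L2_inner_cong\<close> takes
  care of the null sets on which the chosen weak derivatives fail to be linear.\<close>

lemma b_N_eq_L2_inner:
  "b_N \<Omega> a u v = (\<Sum>i\<in>UNIV. \<Sum>j\<in>UNIV.
     L2_inner (lebesgue_on \<Omega>) (\<lambda>x. a i j x * weak_partial \<Omega> i u x) (weak_partial \<Omega> j v))"
  unfolding b_N_def L2_inner_def by (simp add: mult_ac)

text \<open>The origin of the constant 1 / cos \<theta>: a point of modulus r and argument \<beta>
  has real part r cos \<beta> >= r cos \<theta>, and cos \<theta> is positive because \<theta> < pi
  / 2.\<close>

lemma sector_norm_le:
  assumes \<theta>: "0 \<le> \<theta>" "\<theta> < pi / 2" and z: "z \<in> sector \<theta>"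
  shows "cmod z \<le> 1 / cos \<theta> * Re z"
proof -
  obtain r \<beta> where r: "0 \<le> r" "\<bar>\<beta>\<bar> \<le> \<theta>" and z: "z = complex_of_real r * cis \<beta>"
    using z by (auto simp: sector_def)
  have c: "cos \<theta> > 0" using \<theta> by (intro cos_gt_zero_pi) auto
  have "cos \<theta> \<le> cos \<bar>\<beta>\<bar>" using r \<theta> by (intro cos_monotone_0_pi_le) auto
  then have "r * cos \<theta> \<le> r * cos \<beta>" using r by (intro mult_left_mono) (auto simp: cos_abs_real)
  then show ?thesis using r c by (simp add: z norm_mult pos_le_divide_eq)
qed

lemma b_N_sectorial:
  assumes a: "\<And>i j. a i j \<in> Linf (lebesgue_on \<Omega>)"
    and \<theta>: "0 \<le> \<theta>" "\<theta> < pi / 2"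
    and sec: "AE z in lebesgue_on \<Omega>. \<forall>\<xi> :: 'd \<Rightarrow> complex.
           (\<Sum>i\<in>UNIV. \<Sum>j\<in>UNIV. a i j z * \<xi> i * cnj (\<xi> j)) \<in> sector \<theta>"
  shows "sectorial_form (H1 \<Omega>) (b_N \<Omega> a) (1 / cos \<theta>)"
proof
  let ?M = "lebesgue_on \<Omega>" and ?w = "weak_partial \<Omega>"
  note wL = weak_partial_L2
  have aw: "(\<lambda>x. a i j x * f x) \<in> L2 ?M" if "f \<in> L2 ?M" for i j f
    using a that by (rule L2_mult_Linf)
  show "1 / cos \<theta> > 0" using \<theta> by (simp add: cos_gt_zero_pi)
  show "(\<lambda>x. 0) \<in> H1 \<Omega>" by (rule H1_zero)
  fix u assume u: "u \<in> H1 \<Omega>"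
  show "(\<lambda>x. c * u x) \<in> H1 \<Omega>" for c using u by (rule H1_scale)
  show "cmod (b_N \<Omega> a u u) \<le> 1 / cos \<theta> * Re (b_N \<Omega> a u u)"
  proof -
    define F where "F x = (\<Sum>i\<in>UNIV. \<Sum>j\<in>UNIV. a i j x * ?w i u x * cnj (?w j u x))" for x
    have int: "integrable ?M (\<lambda>x. a i j x * ?w i u x * cnj (?w j u x))" for i j
      by (intro L2_mult_cnj_integrable aw wL u)
    have iF: "integrable ?M F" unfolding F_def by (intro Bochner_Integration.integrable_sum int)
    have b: "b_N \<Omega> a u u = (\<integral>x. F x \<partial>?M)"
      unfolding b_N_eq_L2_inner L2_inner_def F_def
      by (simp add: Bochner_Integration.integral_sum Bochner_Integration.integrable_sum int)
    have "cmod (\<integral>x. F x \<partial>?M) \<le> (\<integral>x. cmod (F x) \<partial>?M)" by (rule integral_norm_bound)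
    also have "\<dots> \<le> (\<integral>x. 1 / cos \<theta> * Re (F x) \<partial>?M)"
    proof (rule integral_mono_AE)
      show "AE x in ?M. cmod (F x) \<le> 1 / cos \<theta> * Re (F x)"
        using sec
      proof eventually_elim
        fix x assume "\<forall>\<xi>. (\<Sum>i\<in>UNIV. \<Sum>j\<in>UNIV. a i j x * \<xi> i * cnj (\<xi> j)) \<in> sector \<theta>"
        \<comment> \<open>The vector \<xi> is the weak gradient of u at x.\<close>
        then have "F x \<in> sector \<theta>" unfolding F_def by (rule allE[of _ "\<lambda>i. ?w i u x"])
        then show "cmod (F x) \<le> 1 / cos \<theta> * Re (F x)" by (rule sector_norm_le[OF \<theta>])
      qed
    qed (use iF in \<open>auto intro!: integrable_mult_right integrable_norm\<close>)
    also have "\<dots> = 1 / cos \<theta> * Re (\<integral>x. F x \<partial>?M)" using iF by simp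
    finally show ?thesis unfolding b .
  qed
  fix w assume w: "w \<in> H1 \<Omega>"
  show "b_N \<Omega> a (\<lambda>x. c * u x) w = c * b_N \<Omega> a u w" for c
  proof -
    have "L2_inner ?M (\<lambda>x. a i j x * ?w i (\<lambda>x. c * u x) x) (?w j w) = c * L2_inner ?M (\<lambda>x. a i j x * ?w i u x) (?w j w)" for i j
    proof -
      have "L2_inner ?M (\<lambda>x. a i j x * ?w i (\<lambda>x. c * u x) x) (?w j w) = L2_inner ?M (\<lambda>x. c * (a i j x * ?w i u x)) (?w j w)"
        using weak_partial_scale[OF u, of i c]
        by (intro L2_inner_cong L2_D(1)[OF aw] L2_D(1)[OF wL] L2_D(1)[OF L2_scale] aw wL u w H1_scale) (auto elim: eventually_mono)
      then show ?thesis by (simp add: L2.scale_left aw wL u w)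
    qed
    then show ?thesis unfolding b_N_eq_L2_inner by (simp add: sum_distrib_left)
  qed
  show "b_N \<Omega> a w (\<lambda>x. c * u x) = cnj c * b_N \<Omega> a w u" for c
  proof -
    have "L2_inner ?M (\<lambda>x. a i j x * ?w i w x) (?w j (\<lambda>x. c * u x)) = cnj c * L2_inner ?M (\<lambda>x. a i j x * ?w i w x) (?w j u)" for i j
    proof -
      have "L2_inner ?M (\<lambda>x. a i j x * ?w i w x) (?w j (\<lambda>x. c * u x)) = L2_inner ?M (\<lambda>x. a i j x * ?w i w x) (\<lambda>x. c * ?w j u x)"
        by (intro L2_inner_cong L2_D(1)[OF aw] L2_D(1)[OF wL] L2_D(1)[OF L2_scale] aw wL u w H1_scale weak_partial_scale) simp
      then show ?thesis by (simp add: L2.scale_right aw wL u w)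
    qed
    then show ?thesis unfolding b_N_eq_L2_inner by (simp add: sum_distrib_left)
  qed
  fix v assume v: "v \<in> H1 \<Omega>"
  show "b_N \<Omega> a (\<lambda>x. u x + v x) w = b_N \<Omega> a u w + b_N \<Omega> a v w"
  proof -
    have "L2_inner ?M (\<lambda>x. a i j x * ?w i (\<lambda>x. u x + v x) x) (?w j w) =
      L2_inner ?M (\<lambda>x. a i j x * ?w i u x) (?w j w) + L2_inner ?M (\<lambda>x. a i j x * ?w i v x) (?w j w)" for i j
    proof -
      have "L2_inner ?M (\<lambda>x. a i j x * ?w i (\<lambda>x. u x + v x) x) (?w j w)
         = L2_inner ?M (\<lambda>x. a i j x * ?w i u x + a i j x * ?w i v x) (?w j w)"
        using weak_partial_add[OF u v, of i]
        by (intro L2_inner_cong L2_D(1)[OF aw] L2_D(1)[OF wL] L2_D(1)[OF L2_add] aw wL u v w H1_add)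
          (auto simp: distrib_left elim: eventually_mono)
      then show ?thesis by (simp add: L2.add_left aw wL u v w)
    qed
    then show ?thesis unfolding b_N_eq_L2_inner by (simp add: sum.distrib)
  qed
  show "b_N \<Omega> a w (\<lambda>x. u x + v x) = b_N \<Omega> a w u + b_N \<Omega> a w v"
  proof -
    have "L2_inner ?M (\<lambda>x. a i j x * ?w i w x) (?w j (\<lambda>x. u x + v x)) =
      L2_inner ?M (\<lambda>x. a i j x * ?w i w x) (?w j u) + L2_inner ?M (\<lambda>x. a i j x * ?w i w x) (?w j v)" for i j
    proof -
      have "L2_inner ?M (\<lambda>x. a i j x * ?w i w x) (?w j (\<lambda>x. u x + v x))
         = L2_inner ?M (\<lambda>x. a i j x * ?w i w x) (\<lambda>x. ?w j u x + ?w j v x)"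
        by (intro L2_inner_cong L2_D(1)[OF aw] L2_D(1)[OF wL] L2_D(1)[OF L2_add] aw wL u v w H1_add weak_partial_add) simp
      then show ?thesis by (simp add: L2.add_right aw wL u v w)
    qed
    then show ?thesis unfolding b_N_eq_L2_inner by (simp add: sum.distrib)
  qed
  show "(\<lambda>x. u x + v x) \<in> H1 \<Omega>" using u v by (rule H1_add)
qed

end

section \<open>Traces and the Green formula\<close>

lemma sets_hausdorff [simp, measurable_cong]: "sets (hausdorff s) = sets borel"
  unfolding hausdorff_def by (simp add: sets_measure_of_conv sets.sigma_sets_eq[of borel, simplified])

lemma space_hausdorff [simp]: "space (hausdorff s) = UNIV"
  unfolding hausdorff_def by (simp add: space_measure_of_conv)

text \<open>This and the next three lemmas express everything over \<open>surf G\<close> by the one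
  measure \<open>hausdorff\<close> with a cut-off to G, where two nested sets can be
  compared.\<close>

lemma borel_measurable_surf_iff:
  "G \<in> sets borel \<Longrightarrow> f \<in> borel_measurable (surf G) \<longleftrightarrow> (\<lambda>x. indicator G x *\<^sub>R f x) \<in> borel_measurable (hausdorff (CARD('d) - 1))"
  for f :: "real ^ 'd::finite \<Rightarrow> 'b::real_normed_vector"
  unfolding surf_def by (rule borel_measurable_restrict_space_iff) simp

lemma integral_surf:
  fixes f :: "real ^ 'd::finite \<Rightarrow> 'b::{banach, second_countable_topology}"
  assumes "G \<in> sets borel"
  shows "(\<integral>x. f x \<partial>surf G) = (\<integral>x. indicator G x *\<^sub>R f x \<partial>hausdorff (CARD('d) - 1))"
  unfolding surf_def by (rule integral_restrict_space) (simp add: assms)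

lemma integrable_surf:
  fixes f :: "real ^ 'd::finite \<Rightarrow> 'b::{banach, second_countable_topology}"
  assumes "G \<in> sets borel"
  shows "integrable (surf G) f \<longleftrightarrow> integrable (hausdorff (CARD('d) - 1)) (\<lambda>x. indicator G x *\<^sub>R f x)"
  unfolding surf_def by (rule integrable_restrict_space) (simp add: assms)

lemma AE_surf_iff:
  fixes G :: "(real ^ 'd::finite) set"
  assumes "G \<in> sets borel"
  shows "(AE x in surf G. P x) \<longleftrightarrow> (AE x in hausdorff (CARD('d) - 1). x \<in> G \<longrightarrow> P x)"
  unfolding surf_def by (rule AE_restrict_space_iff) (simp add: assms)

context
  fixes G F :: "(real ^ 'd::finite) set"
  assumes G: "G \<in> sets borel" and F: "F \<in> sets borel" and GF: "G \<subseteq> F"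
begin

lemma integral_surf_superset:
  fixes f :: "real ^ 'd \<Rightarrow> 'b::{banach, second_countable_topology}"
  assumes "\<And>x. x \<notin> G \<Longrightarrow> f x = 0"
  shows "(\<integral>x. f x \<partial>surf F) = (\<integral>x. f x \<partial>surf G)"
proof -
  have "(\<lambda>x. indicator F x *\<^sub>R f x) = (\<lambda>x. indicator G x *\<^sub>R f x)"
    using assms GF by (auto simp: fun_eq_iff indicator_def)
  then show ?thesis by (simp only: integral_surf[OF G] integral_surf[OF F])
qed

lemma zero_ext_L2:
  assumes "f \<in> L2 (surf G)" shows "zero_ext G f \<in> L2 (surf F)"
proof -
  have 1: "(\<lambda>x. indicator F x *\<^sub>R zero_ext G f x) = (\<lambda>x. indicator G x *\<^sub>R f x)"
    using GF by (auto simp: fun_eq_iff indicator_def zero_ext_def)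
  have 2: "(\<lambda>x. indicator F x *\<^sub>R (cmod (zero_ext G f x))\<^sup>2) = (\<lambda>x. indicator G x *\<^sub>R (cmod (f x))\<^sup>2)"
    using GF by (auto simp: fun_eq_iff indicator_def zero_ext_def)
  show ?thesis using assms unfolding L2_def mem_Collect_eq
    borel_measurable_surf_iff[OF G] borel_measurable_surf_iff[OF F] integrable_surf[OF G] integrable_surf[OF F] 1 2 .
qed

lemma L2_surf_subset:
  assumes "f \<in> L2 (surf F)" shows "f \<in> L2 (surf G)"
proof -
  let ?h = "hausdorff (CARD('d) - 1) :: (real^'d) measure"
  have m: "(\<lambda>x. indicator F x *\<^sub>R f x) \<in> borel_measurable ?h"
    and i: "integrable ?h (\<lambda>x. indicator F x *\<^sub>R (cmod (f x))\<^sup>2)"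
    using assms by (simp_all only: L2_def mem_Collect_eq borel_measurable_surf_iff[OF F] integrable_surf[OF F])
  have 1: "(\<lambda>x. indicator G x *\<^sub>R f x) = (\<lambda>x. indicator G x *\<^sub>R (indicator F x *\<^sub>R f x))"
    and 2: "(\<lambda>x. indicator G x *\<^sub>R (cmod (f x))\<^sup>2) = (\<lambda>x. indicator G x *\<^sub>R (indicator F x *\<^sub>R (cmod (f x))\<^sup>2))"
    using GF by (auto simp: fun_eq_iff indicator_def)
  have "(\<lambda>x. indicator G x *\<^sub>R f x) \<in> borel_measurable ?h"
    unfolding 1 by (rule borel_measurable_scaleR[OF borel_measurable_indicator m]) (simp add: G)
  moreover have "integrable ?h (\<lambda>x. indicator G x *\<^sub>R (cmod (f x))\<^sup>2)"
    unfolding 2 by (rule integrable_mult_indicator[OF _ i]) (simp add: G)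
  ultimately show ?thesis
    by (simp only: L2_def mem_Collect_eq borel_measurable_surf_iff[OF G] integrable_surf[OF G])
qed

text \<open>Normal derivatives live on the whole boundary, \<open>Tr\<close> and \<open>B\<close> on
  G only; this identifies the two boundary pairings.\<close>

lemma L2_inner_zero_ext: "L2_inner (surf F) (zero_ext G f) g = L2_inner (surf G) f g"
proof -
  have "L2_inner (surf F) (zero_ext G f) g = (\<integral>x. zero_ext G f x * cnj (g x) \<partial>surf G)"
    unfolding L2_inner_def by (rule integral_surf_superset) (simp add: zero_ext_def)
  also have "\<dots> = L2_inner (surf G) f g"
    unfolding L2_inner_def
    by (rule Bochner_Integration.integral_cong) (auto simp: zero_ext_def surf_def space_restrict_space)
  finally show ?thesis .
qed

lemma AE_surf_imp_iff: "(AE x in surf F. x \<in> G \<longrightarrow> P x) \<longleftrightarrow> (AE x in surf G. P x)"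
  unfolding AE_surf_iff[OF G] AE_surf_iff[OF F] using GF by (intro AE_cong) auto

end

lemma sum_eq_sym: "sum_eq M N p q \<Longrightarrow> sum_eq M N q p"
  by (auto simp: sum_eq_def elim: eventually_mono)

section \<open>The closed form \<open>bbar\<close>, and traces as a relation\<close>

locale elliptic_form =
  fixes \<Omega> :: "(real ^ 'd::finite) set" and a :: "'d coeffs" and \<theta> :: real
  assumes open_\<Omega>: "open \<Omega>"
    and a_Linf: "\<And>i j. a i j \<in> Linf (lebesgue_on \<Omega>)"
    and \<theta>: "0 \<le> \<theta>" "\<theta> < pi / 2"
    and a_sector: "AE z in lebesgue_on \<Omega>. \<forall>\<xi> :: 'd \<Rightarrow> complex.
           (\<Sum>i\<in>UNIV. \<Sum>j\<in>UNIV. a i j z * \<xi> i * cnj (\<xi> j)) \<in> sector \<theta>"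
    and b_N_closable: "closable_form (lebesgue_on \<Omega>) (H1 \<Omega>) (b_N \<Omega> a)"
begin

sublocale bN: closable_sectorial_form "H1 \<Omega>" "b_N \<Omega> a" "1 / cos \<theta>" "lebesgue_on \<Omega>"
  by (rule closable_sectorial_form.intro[OF b_N_sectorial[OF open_\<Omega> a_Linf \<theta> a_sector]], unfold_locales)
    (use H1_L2[OF open_\<Omega>] b_N_closable in auto)

sublocale bbar: sectorial_form "bbar_dom \<Omega> a" "bbar \<Omega> a" "1 / cos \<theta>"
  unfolding bbar_dom_def bbar_def by (rule bN.closure_sectorial)

abbreviation "LO \<equiv> lebesgue_on \<Omega>"
abbreviation "SF \<equiv> surf (frontier \<Omega>)"

lemma bbar_dom_L2: "u \<in> bbar_dom \<Omega> a \<Longrightarrow> u \<in> L2 LO"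
  unfolding bbar_dom_def by (rule bN.closure_dom_L2)

lemma H1_bbar_dom: "u \<in> H1 \<Omega> \<Longrightarrow> u \<in> bbar_dom \<Omega> a"
  unfolding bbar_dom_def using bN.subset_closure_dom by blast

lemma bbar_dom_cong: "u \<in> bbar_dom \<Omega> a \<Longrightarrow> u' \<in> L2 LO \<Longrightarrow> AE x in LO. u x = u' x \<Longrightarrow> u' \<in> bbar_dom \<Omega> a"
  unfolding bbar_dom_def by (rule bN.closure_dom_cong)

lemma bbar_cong:
  "u \<in> bbar_dom \<Omega> a \<Longrightarrow> v \<in> bbar_dom \<Omega> a \<Longrightarrow> u' \<in> L2 LO \<Longrightarrow> AE x in LO. u x = u' x \<Longrightarrow>
   v' \<in> L2 LO \<Longrightarrow> AE x in LO. v x = v' x \<Longrightarrow> bbar \<Omega> a u v = bbar \<Omega> a u' v'"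
  unfolding bbar_dom_def bbar_def by (rule bN.closure_form_cong)

lemma bbar_norm_sq: "u \<in> bbar_dom \<Omega> a \<Longrightarrow> (bbar_norm \<Omega> a u)\<^sup>2 = Re (bbar \<Omega> a u u) + (L2_norm LO u)\<^sup>2"
  unfolding bbar_norm_def form_norm_def using bbar.Re_nonneg[of u] by simp

lemma bbar_norm_zero: "bbar_norm \<Omega> a (\<lambda>x. 0) = 0"
  unfolding bbar_norm_def form_norm_def using bbar.zero_left[OF bbar.zero_mem] by simp

lemma bbar_norm_diff_sq:
  assumes "u \<in> bbar_dom \<Omega> a" "v \<in> bbar_dom \<Omega> a"
  shows "(bbar_norm \<Omega> a (\<lambda>x. u x - v x))\<^sup>2 \<le> 2 * (bbar_norm \<Omega> a u)\<^sup>2 + 2 * (bbar_norm \<Omega> a v)\<^sup>2"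
  using bbar.Re_diff_le[OF assms] L2_norm_diff_sq[OF assms[THEN bbar_dom_L2]] assms
  by (simp add: bbar_norm_sq bbar.diff_mem)

lemma bbar_norm_nonneg: "u \<in> bbar_dom \<Omega> a \<Longrightarrow> 0 \<le> bbar_norm \<Omega> a u"
  unfolding bbar_norm_def form_norm_def using bbar.Re_nonneg[of u] by simp

lemma bbar_norm_cong:
  assumes u: "u \<in> bbar_dom \<Omega> a" and u': "u' \<in> L2 LO" "AE x in LO. u x = u' x"
  shows "bbar_norm \<Omega> a u = bbar_norm \<Omega> a u'"
  unfolding bbar_norm_def form_norm_def
  using bbar_cong[OF u u u' u'] L2_norm_cong[OF u'(2)] u' bbar_dom_L2[OF u] by (simp add: L2_def bbar_def)

lemma tendsto_bbar_norm_diff: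
  assumes U: "\<And>n. U n \<in> bbar_dom \<Omega> a" and V: "\<And>n. V n \<in> bbar_dom \<Omega> a"
    and "(\<lambda>n. bbar_norm \<Omega> a (U n)) \<longlonglongrightarrow> 0" "(\<lambda>n. bbar_norm \<Omega> a (V n)) \<longlonglongrightarrow> 0"
  shows "(\<lambda>n. bbar_norm \<Omega> a (\<lambda>x. U n x - V n x)) \<longlonglongrightarrow> 0"
proof -
  have "(\<lambda>n. 2 * (bbar_norm \<Omega> a (U n))\<^sup>2 + 2 * (bbar_norm \<Omega> a (V n))\<^sup>2) \<longlonglongrightarrow> 2 * 0\<^sup>2 + 2 * 0\<^sup>2"
    by (intro tendsto_intros assms)
  then have "(\<lambda>n. 2 * (bbar_norm \<Omega> a (U n))\<^sup>2 + 2 * (bbar_norm \<Omega> a (V n))\<^sup>2) \<longlonglongrightarrow> 0" by simp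
  then have "(\<lambda>n. (bbar_norm \<Omega> a (\<lambda>x. U n x - V n x))\<^sup>2) \<longlonglongrightarrow> 0"
    by (rule Lim_null_comparison[rotated]) (use bbar_norm_diff_sq[OF U V] in auto)
  then have "(\<lambda>n. sqrt ((bbar_norm \<Omega> a (\<lambda>x. U n x - V n x))\<^sup>2)) \<longlonglongrightarrow> sqrt 0" by (rule tendsto_real_sqrt)
  then show ?thesis by (simp add: bbar_norm_nonneg bbar.diff_mem U V)
qed

text \<open>The norm controls only the real part of the diagonal at V n - v;
  \<open>bbar.bound\<close> upgrades this to convergence of the complex values against a fixed
  u.\<close>

lemma bbar_tendsto_right:
  assumes u: "u \<in> bbar_dom \<Omega> a" and v: "v \<in> bbar_dom \<Omega> a" and V: "\<And>n. V n \<in> bbar_dom \<Omega> a"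
    and lim: "(\<lambda>n. bbar_norm \<Omega> a (\<lambda>x. V n x - v x)) \<longlonglongrightarrow> 0"
  shows "(\<lambda>n. bbar \<Omega> a u (V n)) \<longlonglongrightarrow> bbar \<Omega> a u v"
proof -
  define K where "K = 2 * (1 / cos \<theta>) * sqrt (Re (bbar \<Omega> a u u))"
  have K: "K \<ge> 0" unfolding K_def using bbar.C_pos bbar.Re_nonneg[OF u] by (intro mult_nonneg_nonneg) auto
  have "(\<lambda>n. bbar \<Omega> a u (V n) - bbar \<Omega> a u v) \<longlonglongrightarrow> 0"
  proof (rule Lim_null_comparison)
    show "\<forall>\<^sub>F n in sequentially. cmod (bbar \<Omega> a u (V n) - bbar \<Omega> a u v) \<le> K * bbar_norm \<Omega> a (\<lambda>x. V n x - v x)"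
    proof (intro always_eventually allI)
      fix n
      let ?d = "\<lambda>x. V n x - v x"
      have d: "?d \<in> bbar_dom \<Omega> a" by (intro bbar.diff_mem V v)
      have "cmod (bbar \<Omega> a u (V n) - bbar \<Omega> a u v) \<le> K * sqrt (Re (bbar \<Omega> a ?d ?d))"
        using bbar.bound[OF u d] bbar.diff_right[OF V v u] by (simp add: K_def mult.assoc)
      also have "\<dots> \<le> K * bbar_norm \<Omega> a ?d"
        unfolding bbar_norm_def form_norm_def bbar_def by (intro mult_left_mono K) simp
      finally show "cmod (bbar \<Omega> a u (V n) - bbar \<Omega> a u v) \<le> K * bbar_norm \<Omega> a ?d" .
    qed
    show "(\<lambda>n. K * bbar_norm \<Omega> a (\<lambda>x. V n x - v x)) \<longlonglongrightarrow> 0"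
      using tendsto_mult_left[OF lim, of K] by simp
  qed
  then show ?thesis using LIM_zero_iff by blast
qed

lemma frontier_borel: "frontier \<Omega> \<in> sets borel" by (simp add: borel_closed)

text \<open>Continuity on the closure gives measurability on the boundary, so the finite integral in
  \<open>D_b\<close> amounts to membership in L_2 and the closure properties of L_2 become
  available.\<close>

lemma D_b_iff: "u \<in> D_b \<Omega> \<longleftrightarrow> u \<in> H1 \<Omega> \<and> continuous_on (closure \<Omega>) u \<and> u \<in> L2 SF"
proof -
  have "u \<in> borel_measurable SF" if "continuous_on (closure \<Omega>) u"
  proof -
    have "continuous_on (frontier \<Omega>) u" using that by (rule continuous_on_subset) (auto simp: frontier_def)
    then have "u \<in> borel_measurable (restrict_space borel (frontier \<Omega>))" by (rule borel_measurable_continuous_on_restrict)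
    moreover have "sets SF = sets (restrict_space borel (frontier \<Omega>))"
      unfolding surf_def by (rule sets_restrict_space_cong) simp
    ultimately show ?thesis using measurable_cong_sets by blast
  qed
  then show ?thesis by (auto simp: D_b_def L2_def integrable_iff_bounded)
qed

lemma D_b_diff: "u \<in> D_b \<Omega> \<Longrightarrow> v \<in> D_b \<Omega> \<Longrightarrow> (\<lambda>x. u x - v x) \<in> D_b \<Omega>"
  by (auto simp: D_b_iff intro: bN.diff_mem continuous_on_diff L2_diff)

lemma D_b_bbar_dom: "u \<in> D_b \<Omega> \<Longrightarrow> u \<in> bbar_dom \<Omega> a"
  by (simp add: D_b_iff H1_bbar_dom)

text \<open>Differences reduce uniqueness of traces to the traces of 0, which
  \<open>is_trace_part\<close> describes.\<close>

lemma is_trace_diff: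
  assumes u: "is_trace \<Omega> a u \<phi>" and v: "is_trace \<Omega> a v \<psi>"
  shows "is_trace \<Omega> a (\<lambda>x. u x - v x) (\<lambda>x. \<phi> x - \<psi> x)"
proof -
  have m: "u \<in> bbar_dom \<Omega> a" "v \<in> bbar_dom \<Omega> a" "\<phi> \<in> L2 SF" "\<psi> \<in> L2 SF" using u v by (simp_all add: is_trace_def)
  obtain U where U: "\<And>n. U n \<in> D_b \<Omega>" "(\<lambda>n. bbar_norm \<Omega> a (\<lambda>x. U n x - u x)) \<longlonglongrightarrow> 0"
    "(\<lambda>n. L2_norm SF (\<lambda>x. U n x - \<phi> x)) \<longlonglongrightarrow> 0" using u by (auto simp: is_trace_def)
  obtain V where V: "\<And>n. V n \<in> D_b \<Omega>" "(\<lambda>n. bbar_norm \<Omega> a (\<lambda>x. V n x - v x)) \<longlonglongrightarrow> 0"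
    "(\<lambda>n. L2_norm SF (\<lambda>x. V n x - \<psi> x)) \<longlonglongrightarrow> 0" using v by (auto simp: is_trace_def)
  have UV: "U n \<in> L2 SF" "V n \<in> L2 SF" for n using U(1) V(1) by (simp_all add: D_b_iff)
  have "(\<lambda>n. bbar_norm \<Omega> a (\<lambda>x. (U n x - u x) - (V n x - v x))) \<longlonglongrightarrow> 0"
    by (intro tendsto_bbar_norm_diff bbar.diff_mem m D_b_bbar_dom U V)
  moreover have "(\<lambda>n. L2_norm SF (\<lambda>x. (U n x - \<phi> x) - (V n x - \<psi> x))) \<longlonglongrightarrow> 0"
    by (intro tendsto_L2_norm_diff L2_diff m UV U V)
  ultimately show ?thesis
    unfolding is_trace_def using m U(1) V(1)
    by (intro conjI exI[of _ "\<lambda>n x. U n x - V n x"] allI bbar.diff_mem L2_diff D_b_diff) (auto simp: algebra_simps)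
qed

lemma is_trace_cong:
  assumes u: "is_trace \<Omega> a u \<phi>" and u': "u' \<in> L2 LO" "AE x in LO. u x = u' x"
  shows "is_trace \<Omega> a u' \<phi>"
proof -
  have m: "u \<in> bbar_dom \<Omega> a" using u by (simp add: is_trace_def)
  have "bbar_norm \<Omega> a (\<lambda>x. v x - u x) = bbar_norm \<Omega> a (\<lambda>x. v x - u' x)" if v: "v \<in> D_b \<Omega>" for v
    using u'(2)
    by (intro bbar_norm_cong bbar.diff_mem D_b_bbar_dom[OF v] m L2_diff bbar_dom_L2[OF D_b_bbar_dom[OF v]] u'(1))
      (auto elim: eventually_mono)
  then show ?thesis using u bbar_dom_cong[OF m u'] unfolding is_trace_def by auto
qed

lemma is_trace_D_b: "v \<in> D_b \<Omega> \<Longrightarrow> is_trace \<Omega> a v v"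
  unfolding is_trace_def
  by (intro conjI exI[of _ "\<lambda>n. v"]) (auto simp: D_b_bbar_dom bbar_norm_zero D_b_iff)

lemma D_b_H1_b\<sigma>: "v \<in> D_b \<Omega> \<Longrightarrow> v \<in> H1_b\<sigma> \<Omega> a"
  unfolding H1_b\<sigma>_def using is_trace_D_b D_b_bbar_dom by blast

lemma H1_b\<sigma>_bbar_dom: "v \<in> H1_b\<sigma> \<Omega> a \<Longrightarrow> v \<in> bbar_dom \<Omega> a"
  by (simp add: H1_b\<sigma>_def)

lemma test_functions_frontier: "v \<in> test_functions \<Omega> \<Longrightarrow> x \<in> frontier \<Omega> \<Longrightarrow> v x = 0"
  using test_functionsD(8)[of v \<Omega> x] open_\<Omega> by (simp add: frontier_def interior_open)

lemma test_functions_D_b: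
  assumes v: "v \<in> test_functions \<Omega>" shows "v \<in> D_b \<Omega>"
proof -
  have "(\<integral>\<^sup>+x. ennreal ((cmod (v x))\<^sup>2) \<partial>SF) = (\<integral>\<^sup>+x. 0 \<partial>SF)"
    using test_functions_frontier[OF v]
    by (intro nn_integral_cong) (simp add: surf_def space_restrict_space)
  then show ?thesis
    using v test_functions_H1[OF open_\<Omega>] test_functionsD(2)[OF v] by (auto simp: D_b_def)
qed

text \<open>On real-valued test functions the conjugation in \<open>is_weak_A\<close> disappears,
  and the fundamental lemma applies to f - g.\<close>

lemma is_weak_A_unique:
  assumes f: "is_weak_A \<Omega> a u f" and g: "is_weak_A \<Omega> a u g"
  shows "AE x in LO. f x = g x"
proof -
  have L: "f \<in> L2 LO" "g \<in> L2 LO" using f g by (simp_all add: is_weak_A_def)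
  have "AE x in LO. f x - g x = 0"
  proof (rule fundamental_lemma_calculus_of_variations[OF open_\<Omega> L2_diff[OF L]])
    fix v assume v: "v \<in> test_functions \<Omega>" and real: "\<And>x. cnj (v x) = v x"
    have "(\<integral>x. f x * cnj (v x) \<partial>LO) = bbar \<Omega> a u v" "(\<integral>x. g x * cnj (v x) \<partial>LO) = bbar \<Omega> a u v"
      using f g v by (simp_all add: is_weak_A_def)
    then have "(\<integral>x. f x * v x \<partial>LO) = (\<integral>x. g x * v x \<partial>LO)" unfolding real by simp
    then show "(\<integral>x. (f x - g x) * v x \<partial>LO) = 0"
      using L2_mult_integrable[OF L(1) test_functions_L2[OF open_\<Omega> v]] L2_mult_integrable[OF L(2) test_functions_L2[OF open_\<Omega> v]]
      by (simp add: left_diff_distrib)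
  qed
  then show ?thesis by simp
qed

lemma calA_works: "calA_in_L2 \<Omega> a u \<Longrightarrow> is_weak_A \<Omega> a u (calA \<Omega> a u)"
  unfolding calA_in_L2_def calA_def by (auto intro!: someI_ex[of "is_weak_A \<Omega> a u"])

end

section \<open>The trace as a function on G\<close>

locale elliptic_form_trace = elliptic_form \<Omega> a \<theta>
  for \<Omega> :: "(real ^ 'd::finite) set" and a :: "'d coeffs" and \<theta> :: real +
  fixes G :: "(real ^ 'd::finite) set"
  assumes trace_part: "is_trace_part \<Omega> a G"
begin

abbreviation "SG \<equiv> surf G"

lemma G: "G \<in> sets borel" "G \<subseteq> frontier \<Omega>"
  using trace_part by (simp_all add: is_trace_part_def)

lemmas G_sub = G(1) frontier_borel G(2)

lemma is_trace_0_iff: "is_trace \<Omega> a (\<lambda>x. 0) \<phi> \<longleftrightarrow> \<phi> \<in> L2 SF \<and> (AE x in SG. \<phi> x = 0)"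
  using trace_part AE_surf_imp_iff[OF G_sub, of "\<lambda>x. \<phi> x = 0"] unfolding is_trace_part_def by blast

lemma trace_unique:
  assumes "is_trace \<Omega> a u \<phi>" "is_trace \<Omega> a u \<psi>"
  shows "AE x in SG. \<phi> x = \<psi> x"
  using is_trace_diff[OF assms] by (simp add: is_trace_0_iff)

lemma Tr_works:
  assumes u: "u \<in> H1_b\<sigma> \<Omega> a"
  shows "Tr \<Omega> a G u \<in> L2 SG" "is_trace \<Omega> a u (zero_ext G (Tr \<Omega> a G u))"
proof -
  obtain \<phi> where \<phi>: "is_trace \<Omega> a u \<phi>" using u by (auto simp: H1_b\<sigma>_def)
  then have L: "\<phi> \<in> L2 SF" by (simp add: is_trace_def)
  have LG: "\<phi> \<in> L2 SG" by (rule L2_surf_subset[OF G_sub L])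
  \<comment> \<open>The part of \<phi> that lives off G is a trace of 0; subtracting it from \<phi>
    leaves a trace of u that vanishes off G, as the choice in \<open>Tr\<close> demands.\<close>
  have "AE x in SG. \<phi> x - zero_ext G \<phi> x = 0"
    by (rule AE_I2) (simp add: surf_def space_restrict_space zero_ext_def)
  then have "is_trace \<Omega> a (\<lambda>x. 0) (\<lambda>x. \<phi> x - zero_ext G \<phi> x)"
    unfolding is_trace_0_iff by (intro conjI L2_diff L zero_ext_L2[OF G_sub LG])
  from is_trace_diff[OF \<phi> this] have "is_trace \<Omega> a u (zero_ext G \<phi>)" by simp
  then have "\<exists>\<phi>. \<phi> \<in> L2 SG \<and> is_trace \<Omega> a u (zero_ext G \<phi>)" using LG by blast
  then have "Tr \<Omega> a G u \<in> L2 SG \<and> is_trace \<Omega> a u (zero_ext G (Tr \<Omega> a G u))"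
    unfolding Tr_def by (rule someI_ex)
  then show "Tr \<Omega> a G u \<in> L2 SG" "is_trace \<Omega> a u (zero_ext G (Tr \<Omega> a G u))" by auto
qed

text \<open>Computes the chosen \<open>Tr\<close> from any available trace, for instance from the
  boundary values of an element of \<open>D_b\<close>.\<close>

lemma Tr_eq:
  assumes u: "is_trace \<Omega> a u \<phi>"
  shows "AE x in SG. Tr \<Omega> a G u x = \<phi> x"
proof -
  have "u \<in> H1_b\<sigma> \<Omega> a" using u by (auto simp: H1_b\<sigma>_def is_trace_def)
  from trace_unique[OF Tr_works(2)[OF this] u] have "AE x in SG. zero_ext G (Tr \<Omega> a G u) x = \<phi> x" .
  moreover have "AE x in SG. zero_ext G (Tr \<Omega> a G u) x = Tr \<Omega> a G u x"
    by (rule AE_I2) (simp add: surf_def space_restrict_space zero_ext_def)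
  ultimately show ?thesis by eventually_elim simp
qed

lemma Tr_cong:
  assumes u: "u \<in> H1_b\<sigma> \<Omega> a" and u': "u' \<in> L2 LO" "AE x in LO. u x = u' x"
  shows "AE x in SG. Tr \<Omega> a G u x = Tr \<Omega> a G u' x"
proof -
  have t: "is_trace \<Omega> a u' (zero_ext G (Tr \<Omega> a G u))" by (rule is_trace_cong[OF Tr_works(2)[OF u] u'])
  have "AE x in SG. zero_ext G (Tr \<Omega> a G u) x = Tr \<Omega> a G u x"
    by (rule AE_I2) (simp add: surf_def space_restrict_space zero_ext_def)
  then show ?thesis using Tr_eq[OF t] by eventually_elim simp
qed

lemma L2_inner_Tr_D_b:
  assumes v: "v \<in> D_b \<Omega>" and \<eta>: "\<eta> \<in> L2 SG"
  shows "L2_inner SG \<eta> (Tr \<Omega> a G v) = L2_inner SG \<eta> v"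
  using v L2_surf_subset[OF G_sub]
  by (intro L2_inner_cong Tr_eq is_trace_D_b L2_D(1)[OF \<eta>] L2_D(1)[OF Tr_works(1)] L2_D(1)[of v] D_b_H1_b\<sigma>)
    (auto simp: D_b_iff)

(* Test functions identify f, and D(b) identifies the boundary term. Conversely D(b) is dense for
   the norm of the closed form and the traces together, by the definition of a trace. *)
lemma Green_formula_iff:
  assumes u: "u \<in> bbar_dom \<Omega> a" and f: "f \<in> L2 LO" and \<eta>: "\<eta> \<in> L2 SG"
  shows "(\<forall>v\<in>H1_b\<sigma> \<Omega> a. bbar \<Omega> a u v = L2_inner LO f v + L2_inner SG \<eta> (Tr \<Omega> a G v)) \<longleftrightarrow>
    calA_in_L2 \<Omega> a u \<and> is_normal_derivative \<Omega> a u (zero_ext G \<eta>) \<and> (AE x in LO. f x = calA \<Omega> a u x)"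
    (is "?L \<longleftrightarrow> ?R")
proof
  assume L: ?L
  have "is_weak_A \<Omega> a u f"
    unfolding is_weak_A_def
  proof (intro conjI ballI f)
    fix v assume v: "v \<in> test_functions \<Omega>"
    have vD: "v \<in> D_b \<Omega>" by (rule test_functions_D_b[OF v])
    have "L2_inner SG \<eta> v = L2_inner SG \<eta> (\<lambda>x. 0)"
      unfolding L2_inner_def using test_functions_frontier[OF v] G(2)
      by (intro Bochner_Integration.integral_cong) (auto simp: surf_def space_restrict_space)
    then show "bbar \<Omega> a u v = (\<integral>x. f x * cnj (v x) \<partial>LO)"
      using L D_b_H1_b\<sigma>[OF vD] L2_inner_Tr_D_b[OF vD \<eta>] by (simp add: L2_inner_def)
  qed
  then have cal: "calA_in_L2 \<Omega> a u" and eq: "AE x in LO. f x = calA \<Omega> a u x"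
    using u calA_works[of u] is_weak_A_unique by (auto simp: calA_in_L2_def)
  have cL: "calA \<Omega> a u \<in> L2 LO" using calA_works[OF cal] by (simp add: is_weak_A_def)
  have "is_normal_derivative \<Omega> a u (zero_ext G \<eta>)"
    unfolding is_normal_derivative_def
  proof (intro conjI ballI cal zero_ext_L2[OF G_sub \<eta>])
    fix v assume v: "v \<in> D_b \<Omega>"
    have vL: "v \<in> L2 LO" by (rule bbar_dom_L2[OF D_b_bbar_dom[OF v]])
    have "L2_inner LO f v = L2_inner LO (calA \<Omega> a u) v"
      by (intro L2_inner_cong eq L2_D(1)[OF f] L2_D(1)[OF cL] L2_D(1)[OF vL]) simp
    then have "bbar \<Omega> a u v = L2_inner LO (calA \<Omega> a u) v + L2_inner SF (zero_ext G \<eta>) v"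
      using L D_b_H1_b\<sigma>[OF v] L2_inner_Tr_D_b[OF v \<eta>] L2_inner_zero_ext[OF G_sub] by simp
    then show "bbar \<Omega> a u v - (\<integral>x. calA \<Omega> a u x * cnj (v x) \<partial>LO) = (\<integral>x. zero_ext G \<eta> x * cnj (v x) \<partial>SF)"
      by (simp add: L2_inner_def)
  qed
  then show ?R using cal eq by blast
next
  assume R: ?R
  then have cL: "calA \<Omega> a u \<in> L2 LO" using calA_works[of u] by (simp add: is_weak_A_def)
  have Db: "bbar \<Omega> a u v = L2_inner LO f v + L2_inner SF (zero_ext G \<eta>) v" if v: "v \<in> D_b \<Omega>" for v
  proof -
    have vL: "v \<in> L2 LO" by (rule bbar_dom_L2[OF D_b_bbar_dom[OF v]])
    have "L2_inner LO f v = L2_inner LO (calA \<Omega> a u) v"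
      using R by (intro L2_inner_cong L2_D(1)[OF f] L2_D(1)[OF cL] L2_D(1)[OF vL]) auto
    moreover have "bbar \<Omega> a u v - L2_inner LO (calA \<Omega> a u) v = L2_inner SF (zero_ext G \<eta>) v"
      using R v unfolding is_normal_derivative_def L2_inner_def by blast
    ultimately show ?thesis by (simp add: algebra_simps)
  qed
  show ?L
  proof
    fix v assume v: "v \<in> H1_b\<sigma> \<Omega> a"
    have vb: "v \<in> bbar_dom \<Omega> a" by (rule H1_b\<sigma>_bbar_dom[OF v])
    have z: "zero_ext G \<eta> \<in> L2 SF" "zero_ext G (Tr \<Omega> a G v) \<in> L2 SF"
      by (intro zero_ext_L2[OF G_sub] \<eta> Tr_works(1)[OF v])+
    obtain V where V: "\<And>n. V n \<in> D_b \<Omega>" and lim: "(\<lambda>n. bbar_norm \<Omega> a (\<lambda>x. V n x - v x)) \<longlonglongrightarrow> 0"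
      and limS: "(\<lambda>n. L2_norm SF (\<lambda>x. V n x - zero_ext G (Tr \<Omega> a G v) x)) \<longlonglongrightarrow> 0"
      using Tr_works(2)[OF v] unfolding is_trace_def by blast
    have Vb: "V n \<in> bbar_dom \<Omega> a" for n by (rule D_b_bbar_dom[OF V])
    have VL: "V n \<in> L2 LO" "v \<in> L2 LO" for n by (intro bbar_dom_L2 Vb vb)+
    have VS: "V n \<in> L2 SF" for n using V by (simp add: D_b_iff)
    \<comment> \<open>The real part of the form is nonnegative on the diagonal, so the form norm
      dominates the L_2 norm.\<close>
    have limL: "(\<lambda>n. L2_norm LO (\<lambda>x. V n x - v x)) \<longlonglongrightarrow> 0"
    proof (rule Lim_null_comparison[OF _ lim], intro always_eventually allI)
      fix n
      have "0 \<le> Re (bbar \<Omega> a (\<lambda>x. V n x - v x) (\<lambda>x. V n x - v x))" by (intro bbar.Re_nonneg bbar.diff_mem Vb vb)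
      then show "norm (L2_norm LO (\<lambda>x. V n x - v x)) \<le> bbar_norm \<Omega> a (\<lambda>x. V n x - v x)"
        unfolding bbar_norm_def form_norm_def bbar_def by (simp add: real_le_rsqrt)
    qed
    have "(\<lambda>n. L2_inner LO f (V n) + L2_inner SF (zero_ext G \<eta>) (V n))
        \<longlonglongrightarrow> L2_inner LO f v + L2_inner SF (zero_ext G \<eta>) (zero_ext G (Tr \<Omega> a G v))"
      by (intro tendsto_add L2_inner_tendsto f VL z VS limL limS)
    moreover have "(\<lambda>n. L2_inner LO f (V n) + L2_inner SF (zero_ext G \<eta>) (V n)) \<longlonglongrightarrow> bbar \<Omega> a u v"
      using bbar_tendsto_right[OF u vb Vb lim] unfolding Db[OF V] .
    ultimately have "bbar \<Omega> a u v = L2_inner LO f v + L2_inner SF (zero_ext G \<eta>) (zero_ext G (Tr \<Omega> a G v))"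
      using LIMSEQ_unique by blast
    moreover have "L2_inner SG \<eta> (zero_ext G (Tr \<Omega> a G v)) = L2_inner SG \<eta> (Tr \<Omega> a G v)"
      unfolding L2_inner_def
      by (rule Bochner_Integration.integral_cong) (auto simp: zero_ext_def surf_def space_restrict_space)
    ultimately show "bbar \<Omega> a u v = L2_inner LO f v + L2_inner SG \<eta> (Tr \<Omega> a G v)"
      by (simp add: L2_inner_zero_ext[OF G_sub])
  qed
qed

end

section \<open>The operator associated with \<open>form_a\<close> and \<open>jmap\<close>\<close>

locale elliptic_operator = elliptic_form_trace \<Omega> a \<theta> G
  for \<Omega> :: "(real ^ 'd::finite) set" and a :: "'d coeffs" and \<theta> :: real and G :: "(real ^ 'd) set" +
  fixes \<alpha> :: "real ^ 'd::finite \<Rightarrow> complex" and B :: "(real ^ 'd \<Rightarrow> complex) \<Rightarrow> (real ^ 'd \<Rightarrow> complex)"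
  assumes \<alpha>: "\<alpha> \<in> Linf (surf G)"
    and B: "bounded_operator_L2 (surf G) B"
begin

abbreviation "graph_A \<equiv> associated_graph (H1_b\<sigma> \<Omega> a) (form_a \<Omega> a G \<alpha>) (jmap \<Omega> a G B) (spaceH \<Omega> a G B)
   (sum_inner LO SG) (sum_eq LO SG)"

lemma B_L2: "\<phi> \<in> L2 SG \<Longrightarrow> B \<phi> \<in> L2 SG"
  using B by (simp add: bounded_operator_L2_def)

lemma form_a_eq: "form_a \<Omega> a G \<alpha> u v = bbar \<Omega> a u v + L2_inner SG (\<lambda>x. \<alpha> x * Tr \<Omega> a G u x) (Tr \<Omega> a G v)"
  unfolding form_a_def L2_inner_def by (simp add: mult_ac)

text \<open>The adjoint is specified for B in the first argument; two conjugations move it to the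
  second, where \<open>jmap\<close> puts B.\<close>

lemma sum_inner_jmap:
  assumes "v \<in> H1_b\<sigma> \<Omega> a" "\<psi> \<in> L2 SG"
  shows "sum_inner LO SG (f, \<psi>) (jmap \<Omega> a G B v) = L2_inner LO f v + L2_inner SG (L2_adjoint SG B \<psi>) (Tr \<Omega> a G v)"
  using L2_adjoint(2)[OF B assms(2) Tr_works(1)[OF assms(1)]]
    L2_inner_commute[of SG \<psi> "B (Tr \<Omega> a G v)"] L2_inner_commute[of SG "L2_adjoint SG B \<psi>" "Tr \<Omega> a G v"]
  by (simp add: sum_inner_def jmap_def)

lemma form_equation_iff:
  assumes u: "u \<in> H1_b\<sigma> \<Omega> a" and f: "f \<in> L2 LO" and \<psi>: "\<psi> \<in> L2 SG"
  shows "(\<forall>v\<in>H1_b\<sigma> \<Omega> a. form_a \<Omega> a G \<alpha> u v = sum_inner LO SG (f, \<psi>) (jmap \<Omega> a G B v)) \<longleftrightarrow>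
    calA_in_L2 \<Omega> a u \<and>
    is_normal_derivative \<Omega> a u (zero_ext G (\<lambda>z. L2_adjoint SG B \<psi> z - \<alpha> z * Tr \<Omega> a G u z)) \<and>
    (AE x in LO. f x = calA \<Omega> a u x)"
proof -
  have L: "L2_adjoint SG B \<psi> \<in> L2 SG" "(\<lambda>x. \<alpha> x * Tr \<Omega> a G u x) \<in> L2 SG"
    by (intro L2_adjoint(1)[OF B \<psi>] L2_mult_Linf[OF \<alpha>] Tr_works(1)[OF u])+
  have "form_a \<Omega> a G \<alpha> u v = sum_inner LO SG (f, \<psi>) (jmap \<Omega> a G B v) \<longleftrightarrow>
    bbar \<Omega> a u v = L2_inner LO f v + L2_inner SG (\<lambda>z. L2_adjoint SG B \<psi> z - \<alpha> z * Tr \<Omega> a G u z) (Tr \<Omega> a G v)"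
    if v: "v \<in> H1_b\<sigma> \<Omega> a" for v
    unfolding form_a_eq sum_inner_jmap[OF v \<psi>] L2.diff_left[OF L Tr_works(1)[OF v]] by (auto simp: algebra_simps)
  then show ?thesis
    using Green_formula_iff[OF H1_b\<sigma>_bbar_dom[OF u] f L2_diff[OF L]] by simp
qed

text \<open>Two elements that \<open>jmap\<close> sends to the same x agree almost everywhere on
  \<Omega>; this makes the form value independent of which of them is taken.\<close>

lemma form_a_cong:
  assumes u: "u \<in> H1_b\<sigma> \<Omega> a" and u': "u' \<in> H1_b\<sigma> \<Omega> a" and ae: "AE x in LO. u x = u' x" and v: "v \<in> H1_b\<sigma> \<Omega> a"
  shows "form_a \<Omega> a G \<alpha> u v = form_a \<Omega> a G \<alpha> u' v"
proof -
  note d = H1_b\<sigma>_bbar_dom[OF u] H1_b\<sigma>_bbar_dom[OF u'] H1_b\<sigma>_bbar_dom[OF v]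
  have "bbar \<Omega> a u v = bbar \<Omega> a u' v"
    by (intro bbar_cong d bbar_dom_L2 ae) simp
  moreover have "L2_inner SG (\<lambda>x. \<alpha> x * Tr \<Omega> a G u x) (Tr \<Omega> a G v) = L2_inner SG (\<lambda>x. \<alpha> x * Tr \<Omega> a G u' x) (Tr \<Omega> a G v)"
    using Tr_cong[OF u bbar_dom_L2[OF d(2)] ae]
    by (intro L2_inner_cong L2_D(1)[OF L2_mult_Linf[OF \<alpha>]] L2_D(1)[OF Tr_works(1)] Tr_works(1) u u' v)
      (auto elim: eventually_mono)
  ultimately show ?thesis by (simp add: form_a_eq)
qed

lemma spaceH_L2: "p \<in> spaceH \<Omega> a G B \<Longrightarrow> fst p \<in> L2 LO \<and> snd p \<in> L2 SG"
  by (auto simp: spaceH_def sum_closure_def)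

text \<open>Orthogonality to the range of \<open>jmap\<close> passes to the closure by continuity of
  the inner product. Here z ranges over the whole direct sum, so that a difference of two elements
  of \<open>spaceH\<close> can be inserted directly.\<close>

lemma orthogonal_spaceH:
  assumes z: "fst z \<in> L2 LO" "snd z \<in> L2 SG"
    and orth: "\<And>v. v \<in> H1_b\<sigma> \<Omega> a \<Longrightarrow> sum_inner LO SG z (jmap \<Omega> a G B v) = 0"
    and p: "p \<in> spaceH \<Omega> a G B"
  shows "sum_inner LO SG z p = 0"
proof -
  have pL: "fst p \<in> L2 LO" "snd p \<in> L2 SG" using spaceH_L2[OF p] by auto
  obtain s where s: "\<And>n. s n \<in> {(u, B (Tr \<Omega> a G u)) | u. u \<in> H1_b\<sigma> \<Omega> a}"
    and lim: "(\<lambda>n::nat. sqrt ((L2_norm LO (\<lambda>x. fst (s n) x - fst p x))\<^sup>2 +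
                     (L2_norm SG (\<lambda>x. snd (s n) x - snd p x))\<^sup>2)) \<longlonglongrightarrow> 0"
    using p unfolding spaceH_def sum_closure_def by blast
  have "\<exists>v. s n = jmap \<Omega> a G B v \<and> v \<in> H1_b\<sigma> \<Omega> a" for n using s[of n] by (auto simp: jmap_def)
  then obtain V where V: "\<And>n. s n = jmap \<Omega> a G B (V n)" "\<And>n. V n \<in> H1_b\<sigma> \<Omega> a" by metis
  have sL: "fst (s n) \<in> L2 LO" "snd (s n) \<in> L2 SG" for n
    using V by (auto simp: jmap_def intro: bbar_dom_L2 H1_b\<sigma>_bbar_dom B_L2 Tr_works)
  have l: "(\<lambda>n. L2_norm LO (\<lambda>x. fst (s n) x - fst p x)) \<longlonglongrightarrow> 0" "(\<lambda>n. L2_norm SG (\<lambda>x. snd (s n) x - snd p x)) \<longlonglongrightarrow> 0"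
    by (rule Lim_null_comparison[OF _ lim], simp)+
  have "(\<lambda>n. sum_inner LO SG z (s n)) \<longlonglongrightarrow> sum_inner LO SG z p"
    unfolding sum_inner_def by (intro tendsto_add L2_inner_tendsto z pL sL l)
  then show ?thesis using orth V by (simp add: LIMSEQ_const_iff)
qed

lemma graph_A_unique:
  assumes 1: "graph_A x p" and 2: "graph_A x q" shows "sum_eq LO SG p q"
proof -
  have pq: "p \<in> spaceH \<Omega> a G B" "q \<in> spaceH \<Omega> a G B" using 1 2 by (simp_all add: associated_graph_def)
  note L = spaceH_L2[OF pq(1)] spaceH_L2[OF pq(2)]
  obtain u where u: "u \<in> H1_b\<sigma> \<Omega> a" "AE t in LO. u t = fst x t"
    and eu: "\<And>v. v \<in> H1_b\<sigma> \<Omega> a \<Longrightarrow> form_a \<Omega> a G \<alpha> u v = sum_inner LO SG p (jmap \<Omega> a G B v)"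
    using 1 by (auto simp: associated_graph_def sum_eq_def jmap_def)
  obtain w where w: "w \<in> H1_b\<sigma> \<Omega> a" "AE t in LO. w t = fst x t"
    and ew: "\<And>v. v \<in> H1_b\<sigma> \<Omega> a \<Longrightarrow> form_a \<Omega> a G \<alpha> w v = sum_inner LO SG q (jmap \<Omega> a G B v)"
    using 2 by (auto simp: associated_graph_def sum_eq_def jmap_def)
  have uw: "AE t in LO. u t = w t" using u(2) w(2) by eventually_elim simp
  define z where "z = ((\<lambda>t. fst p t - fst q t), (\<lambda>t. snd p t - snd q t))"
  have zL: "fst z \<in> L2 LO" "snd z \<in> L2 SG" using L by (auto simp: z_def intro: L2_diff)
  have diff: "sum_inner LO SG z r = sum_inner LO SG p r - sum_inner LO SG q r"
    if "fst r \<in> L2 LO" "snd r \<in> L2 SG" for r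
    using that L by (simp add: sum_inner_def z_def L2.diff_left)
  have orth: "sum_inner LO SG z (jmap \<Omega> a G B v) = 0" if v: "v \<in> H1_b\<sigma> \<Omega> a" for v
    using eu[OF v] ew[OF v] form_a_cong[OF u(1) w(1) uw v] diff[of "jmap \<Omega> a G B v"] v
    by (simp add: jmap_def bbar_dom_L2 H1_b\<sigma>_bbar_dom B_L2 Tr_works)
  \<comment> \<open>Both terms on the right vanish, because p and q each lie in the closure of the
    range to which z is orthogonal.\<close>
  have "sum_inner LO SG z z = sum_inner LO SG z p - sum_inner LO SG z q"
    using L zL by (simp add: sum_inner_def z_def L2.diff_right)
  then have "sum_inner LO SG z z = 0"
    using orthogonal_spaceH[OF zL orth] pq by simp
  then have "complex_of_real ((L2_norm LO (fst z))\<^sup>2 + (L2_norm SG (snd z))\<^sup>2) = 0"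
    using zL by (simp add: sum_inner_def L2_inner_self)
  then have "(L2_norm LO (fst z))\<^sup>2 + (L2_norm SG (snd z))\<^sup>2 = 0" by (simp only: of_real_eq_0_iff)
  then have "L2_norm LO (fst z) = 0" "L2_norm SG (snd z) = 0" by (simp_all add: sum_power2_eq_zero_iff)
  then have "AE t in LO. fst z t = 0" "AE t in SG. snd z t = 0" using zL L2_norm_eq_0D by blast+
  then show ?thesis by (simp add: z_def sum_eq_def)
qed

text \<open>\<open>associated_operator\<close> returns some value of the graph; this leads from it
  to any other representative in \<open>spaceH\<close>.\<close>

lemma graph_A_cong:
  assumes g: "graph_A x p" and q: "q \<in> spaceH \<Omega> a G B" and eq: "sum_eq LO SG p q"
  shows "graph_A x q"
proof -
  have p: "p \<in> spaceH \<Omega> a G B" using g by (simp add: associated_graph_def)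
  note L = spaceH_L2[OF p] spaceH_L2[OF q]
  have "sum_inner LO SG p (jmap \<Omega> a G B v) = sum_inner LO SG q (jmap \<Omega> a G B v)" if v: "v \<in> H1_b\<sigma> \<Omega> a" for v
    unfolding sum_inner_def jmap_def fst_conv snd_conv
    using eq L by (intro arg_cong2[of _ _ _ _ "(+)"] L2_inner_cong L2_D(1)[OF B_L2]
      L2_D(1)[OF bbar_dom_L2[OF H1_b\<sigma>_bbar_dom[OF v]]] Tr_works v) (auto simp: sum_eq_def intro: L2_D)
  then show ?thesis using g q by (auto simp: associated_graph_def)
qed

text \<open>Trades the chosen value of the operator for its graph: \<open>graph_A_cong\<close> gives
  one direction, uniqueness of the value up to null sets the other.\<close>

lemma op_A_iff:
  assumes y: "y \<in> spaceH \<Omega> a G B"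
  shows "x \<in> dom_A \<Omega> a G \<alpha> B \<and> sum_eq LO SG (op_A \<Omega> a G \<alpha> B x) y \<longleftrightarrow> graph_A x y"
proof
  assume "x \<in> dom_A \<Omega> a G \<alpha> B \<and> sum_eq LO SG (op_A \<Omega> a G \<alpha> B x) y"
  then have ex: "\<exists>y. graph_A x y" and eq: "sum_eq LO SG (op_A \<Omega> a G \<alpha> B x) y"
    by (simp_all add: dom_A_def associated_dom_def)
  have "graph_A x (op_A \<Omega> a G \<alpha> B x)"
    unfolding op_A_def associated_operator_def using ex by (rule someI_ex)
  then show "graph_A x y" using y eq by (rule graph_A_cong)
next
  assume g: "graph_A x y"
  have "graph_A x (op_A \<Omega> a G \<alpha> B x)"
    unfolding op_A_def associated_operator_def using g by (rule someI)
  then show "x \<in> dom_A \<Omega> a G \<alpha> B \<and> sum_eq LO SG (op_A \<Omega> a G \<alpha> B x) y"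
    unfolding dom_A_def associated_dom_def mem_Collect_eq using g graph_A_unique by blast
qed

end

theorem proposition4p17:
  fixes \<Omega> :: "(real ^ 'd::finite) set"
    and a :: "'d \<Rightarrow> 'd \<Rightarrow> real ^ 'd \<Rightarrow> complex"
    and \<theta> \<omega> :: real
    and G :: "(real ^ 'd) set"
    and \<alpha> :: "real ^ 'd \<Rightarrow> complex"
    and B :: "(real ^ 'd \<Rightarrow> complex) \<Rightarrow> (real ^ 'd \<Rightarrow> complex)"
    and x y :: "(real ^ 'd \<Rightarrow> complex) \<times> (real ^ 'd \<Rightarrow> complex)"
  assumes "open \<Omega>"
    and "\<And>K. compact K \<Longrightarrow> K \<subseteq> frontier \<Omega> \<Longrightarrow> emeasure (surf (frontier \<Omega>)) K < \<infinity>"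
    and "\<And>i j. a i j \<in> Linf (lebesgue_on \<Omega>)"
    and "0 \<le> \<theta>" and "\<theta> < pi / 2"
    and "AE z in lebesgue_on \<Omega>. \<forall>\<xi> :: 'd \<Rightarrow> complex.
           (\<Sum>i\<in>UNIV. \<Sum>j\<in>UNIV. a i j z * \<xi> i * cnj (\<xi> j)) \<in> sector \<theta>"
    and "closable_form (lebesgue_on \<Omega>) (H1 \<Omega>) (b_N \<Omega> a)"
    and "is_trace_part \<Omega> a G"
    and "Tr_continuous \<Omega> a G"
    and "\<alpha> \<in> Linf (surf G)"
    and "bounded_operator_L2 (surf G) B"
    and "\<omega> > 0"
    and "\<And>\<phi>. \<phi> \<in> L2 (surf G) \<Longrightarrow>
           \<omega> * (L2_norm (surf G) (B \<phi>))\<^sup>2 + (\<integral>z. Re (\<alpha> z) * (cmod (\<phi> z))\<^sup>2 \<partial>surf G) \<ge> 0"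
    and "x \<in> spaceH \<Omega> a G B" and "y \<in> spaceH \<Omega> a G B"
  shows "(x \<in> dom_A \<Omega> a G \<alpha> B \<and> sum_eq (lebesgue_on \<Omega>) (surf G) (op_A \<Omega> a G \<alpha> B x) y) \<longleftrightarrow>
    (\<exists>u\<in>H1_b\<sigma> \<Omega> a. \<exists>\<psi>\<in>L2 (surf G).
       sum_eq (lebesgue_on \<Omega>) (surf G) x (u, B (Tr \<Omega> a G u)) \<and>
       calA_in_L2 \<Omega> a u \<and>
       is_normal_derivative \<Omega> a u
         (zero_ext G (\<lambda>z. L2_adjoint (surf G) B \<psi> z - \<alpha> z * Tr \<Omega> a G u z)) \<and>
       sum_eq (lebesgue_on \<Omega>) (surf G) y (calA \<Omega> a u, \<psi>))"
proof -
  interpret elliptic_operator \<Omega> a \<theta> G \<alpha> B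
    using assms(1,3-8,10,11) by unfold_locales auto
  note yL = spaceH_L2[OF assms(15)]
  have "graph_A x y \<longleftrightarrow> (\<exists>u\<in>H1_b\<sigma> \<Omega> a. \<exists>\<psi>\<in>L2 SG. sum_eq LO SG x (u, B (Tr \<Omega> a G u)) \<and> calA_in_L2 \<Omega> a u \<and>
       is_normal_derivative \<Omega> a u (zero_ext G (\<lambda>z. L2_adjoint SG B \<psi> z - \<alpha> z * Tr \<Omega> a G u z)) \<and>
       sum_eq LO SG y (calA \<Omega> a u, \<psi>))" (is "_ \<longleftrightarrow> ?R")
  proof
    assume "graph_A x y"
    then obtain u where u: "u \<in> H1_b\<sigma> \<Omega> a" and x: "sum_eq LO SG (jmap \<Omega> a G B u) x"
      and eq: "\<forall>v\<in>H1_b\<sigma> \<Omega> a. form_a \<Omega> a G \<alpha> u v = sum_inner LO SG (fst y, snd y) (jmap \<Omega> a G B v)"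
      by (auto simp: associated_graph_def)
    \<comment> \<open>The witness for \<psi> is the boundary component of y.\<close>
    then show ?R
      using eq[unfolded form_equation_iff[OF u conjunct1[OF yL] conjunct2[OF yL]]] sum_eq_sym[OF x] yL
      by (intro bexI[OF _ u] bexI[of _ "snd y"]) (auto simp: jmap_def sum_eq_def)
  next
    assume ?R
    then obtain u \<psi> where u: "u \<in> H1_b\<sigma> \<Omega> a" and \<psi>: "\<psi> \<in> L2 SG" and x: "sum_eq LO SG x (u, B (Tr \<Omega> a G u))"
      and c: "calA_in_L2 \<Omega> a u"
      and n: "is_normal_derivative \<Omega> a u (zero_ext G (\<lambda>z. L2_adjoint SG B \<psi> z - \<alpha> z * Tr \<Omega> a G u z))"
      and y: "sum_eq LO SG y (calA \<Omega> a u, \<psi>)" by blast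
    have eq: "form_a \<Omega> a G \<alpha> u v = sum_inner LO SG (fst y, \<psi>) (jmap \<Omega> a G B v)" if "v \<in> H1_b\<sigma> \<Omega> a" for v
      using form_equation_iff[OF u conjunct1[OF yL] \<psi>] c n y that by (auto simp: sum_eq_def)
    \<comment> \<open>\<psi> and \<open>snd y\<close> agree only almost everywhere, so they are
      exchanged inside the inner product.\<close>
    have "sum_inner LO SG (fst y, \<psi>) (jmap \<Omega> a G B v) = sum_inner LO SG y (jmap \<Omega> a G B v)" if v: "v \<in> H1_b\<sigma> \<Omega> a" for v
      unfolding sum_inner_def jmap_def fst_conv snd_conv
      using y yL \<psi> by (intro arg_cong2[of _ _ _ _ "(+)"] refl L2_inner_cong L2_D(1)[OF B_L2] Tr_works v)
        (auto simp: sum_eq_def intro: L2_D elim: eventually_mono)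
    then show "graph_A x y"
      unfolding associated_graph_def using assms(14,15) sum_eq_sym[OF x] eq u by (auto simp: jmap_def)
  qed
  then show ?thesis using op_A_iff[OF assms(15)] by blast
qed

end
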